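(* Let $n\ge2$. Then: (i) A basis of orthogonal idempotents of $\mathcal{W}_n$ is given by $\frac12(I^+_{k,n}+I^-_{k,n})$ for $1\le k\le n$, $k\equiv n\pmod 2$, and $\frac12(J^+_{l,n}+J^-_{l,n}-I^+_{l,n}-I^-_{l,n})$ for $0\le l\le n-4$, $l\equiv n\pmod2$. Their images under $\Gamma$ are respectively $\sum_{\lambda\vdash n,\ \ell_o(\lambda)=k,\ \ell_e(\lambda)=0}\frac{1}{z_\lambda}p_\lambda$ and $\sum_{\lambda\vdash n,\ \ell_o(\lambda)=l,\ \ell_e(\lambda)>0\text{ even}}\frac1{z_\lambda}p_\lambda$. (ii) A basis of orthogonal idempotents of $\mathcal{W}^\circ_n$ is given by $I^+_{k,n}$ for $1\le k\le n$, $k\equiv n\pmod2$, and $\frac12(J^+_{l,n}-I^+_{l,n})$ for $0\le l\le n-2$, $l\equiv n\pmod 2$. Their images under $\Gamma$ are respectively $\sum_{\lambda\vdash n,\ \ell_o(\lambda)=k,\ \ell_e(\lambda)=0}\frac1{z_\lambda}p_\lambda$ and $\sum_{\lambda\vdash n,\ \ell_o(\lambda)=l,\ \ell_e(\lambda)>0}\frac1{z_\lambda}p_\lambda$. (iii) A basis of orthogonal idempotents of $\mathcal{C}_n$ is given by $\frac12(I^+_{k,n}+I^-_{k,n})$ for $1\le k\le n$, $k\equiv n\pmod2$; $\frac12(J^+_{l,n}+J^-_{l,n}-I^+_{l,n}-I^-_{l,n})$ for $0\le l\le n-4$, $l\equiv n\pmod2$; and $\frac12(J^+_{m,n}-J^-_{m,n})$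 for $0\le m\le n-2$, $m\equiv n\pmod2$. Their images under $\Gamma$ are respectively $\sum_{\lambda\vdash n,\ \ell_o(\lambda)=k,\ \ell_e(\lambda)=0}\frac1{z_\lambda}p_\lambda$, $\sum_{\lambda\vdash n,\ \ell_o(\lambda)=l,\ \ell_e(\lambda)\text{ even}}\frac1{z_\lambda}p_\lambda$, and $\sum_{\lambda\vdash n,\ \ell_o(\lambda)=m,\ \ell_e(\lambda)>0\text{ odd}}\frac1{z_\lambda}p_\lambda$. (iv) A basis of orthogonal idempotents of $\mathcal{P}_n$ is given by $I^-_{k,n}$ for $1\le k\le n$, $k\equiv n\pmod2$, with images $\sum_{\lambda\vdash n,\ \ell_o(\lambda)=k,\ \ell_e(\lambda)=0}\frac1{z_\lambda}p_\lambda$ under $\Gamma$. (v) A basis of orthogonal idempotents of $\mathcal{P}^\circ_n$ is given by $J^+_{k,n}$ for $0\le k\le n$, $k\equiv n\pmod 2$, with images $\sum_{\lambda\vdash n,\ \ell_o(\lambda)=k}\frac1{z_\lambda}p_\lambda$ under $\Gamma$.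
   Context: Noncommutative symmetric functions: $\mathbf{Sym}=\bigoplus_n\mathbf{Sym}_n$ over $\mathbb{Q}$ with ribbon basis $R_I$ ($I$ compositions of $n$; a composition $(i_1,\dots,i_r)$ has descent set $\{i_1,\dots,i_1+\dots+i_{r-1}\}$), $R_\emptyset=1$. $\mathbf{Sym}_n$ is identified with the descent algebra $\mathcal{D}_n\subseteq\mathbb{Q}[\mathfrak{S}_n]$ via $R_I\mapsto\sum\{\sigma:\mathrm{Des}(\sigma)=\text{descent set of }I\}$; the internal product is that of $\mathbb{Q}[\mathfrak{S}_n]$ (with $(\alpha\beta)(i)=\alpha(\beta(i))$) in each degree and zero across degrees. External product: $R_{(i_1,\dots,i_r)}\star R_{(j_1,\dots,j_s)}=R_{(i_1,\dots,i_r,j_1,\dots,j_s)}+R_{(i_1,\dots,i_{r-1},i_r+j_1,j_2,\dots,j_s)}$; both products extend to the completion $\widehat{\mathbf{Sym}}$ of formal sums of homogeneous elements. For $F$ with zero degree-$0$ part, $\log_\star(1+F)=\sum_{m\ge1}\frac{(-1)^{m-1}}{m}F^{\star m}$, $\exp_\star F=\sum_{m\ge0}\frac1{m!}F^{\star m}$, and $(1+F)^{\star c}=\exp_\star(c\log_\star(1+F))$ for $c\in\mathbb{Q}$. Let $V_1^+=\sum_{i\ge0}R_{(i)}$, $V_1^-=\sum_{i\ge0}R_{(1^i)}$, $V_2^+=V_1^+\star V_1^-$, $V_2^-=V_1^-\star V_1^+$. Define $I_1^-=\frac12\log_\star V_2^-$, $I_1^+=\frac12\log_\star V_2^+$, $I_k^\pm=\frac1{k!}(I_1^\pm)^{\star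 k}$ (with $I_0^\pm=1$), $J_0^+=V_1^+\star(V_2^-)^{\star(-1/2)}$, $J_0^-=V_1^-\star(V_2^+)^{\star(-1/2)}$, $J_k^+=J_0^+\star I_k^-$, $J_k^-=J_0^-\star I_k^+$; subscripts $k,n$ denote degree-$n$ components. Run algebras: for $\sigma\in\mathfrak{S}_n$, an alternating run is a maximal monotone sequence of consecutive entries of $\sigma(1),\dots,\sigma(n)$, a left run the same for $\sigma(0)=0,\sigma(1),\dots,\sigma(n)$; $W_k^+$ (resp. $W_k^-$) is the sum of $\sigma$ with $k$ runs and first run ascending (resp. descending), $W_k=W_k^++W_k^-$, $W_k^\circ$ is the sum of $\sigma$ with $k$ left runs. $\mathcal{W}_n=\mathrm{span}\{W_k\}$, $\mathcal{W}_n^\circ=\mathrm{span}\{W^\circ_k\}$, $\mathcal{C}_n=\mathrm{span}\{W_{2k},W^+_{2k-1},W^-_{2k-1}\}$, $\mathcal{P}_n$ (resp. $\mathcal{P}_n^\circ$) is spanned by the sums of permutations in $\mathfrak{S}_n$ with a fixed number of peaks (resp. left peaks), where a peak is $i\in[2,n-1]$ with $\sigma(i-1)<\sigma(i)>\sigma(i+1)$ and a left peak is $i\in[1,n-1]$ with the same condition, $\sigma(0)=0$. Symmetric functions: $p_\lambda$ power sums, $h_J$ complete homogeneous, $z_\lambda=\prod_r r^{m_r}m_r!$ with $m_r$ the multiplicity of $r$ in $\lambda$; $\ell_o(\lambda)$ and $\ell_e(\lambda)$ are the numbers of odd and even parts of $\lambda$. $\Gamma:\mathbf{Sym}\to Sym$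 is the linear map $R_I\mapsto r_I=\sum_{J\preccurlyeq I}(-1)^{\ell(I)-\ell(J)}h_J$ (the ribbon skew Schur function), where $J\preccurlyeq I$ means the descent set of $J$ is contained in that of $I$; it is a homomorphism for the internal product (Kronecker product on $Sym_n$) and the external product (ordinary product).
   Formalization: In (ii) the second family is J^+_{l,n} − I^+_{l,n} without the factor 1/2 (with it the elements are not idempotent), and in (iii) the image of the second family is summed over ℓ_e(λ)>0 even, as in (i), instead of ℓ_e(λ) even. *)

theory Defs
  imports
    Complex_Main
    "HOL-Library.Function_Algebras"
    "HOL-Library.Indicator_Function"
    "HOL-Library.Multiset"
    "HOL-Library.Poly_Mapping"
    "HOL-Combinatorics.Permutations"
begin

text \<open>
  Vectors over the rationals with respect to a distinguished basis are coefficient functions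
  \<open>'a \<Rightarrow> rat\<close>. Their addition is the pointwise one of \<open>Function_Algebras\<close>; the pointwise product
  and the constant function \<open>1\<close> of that theory play no role.
\<close>

definition scaleQ :: "rat \<Rightarrow> ('a \<Rightarrow> rat) \<Rightarrow> 'a \<Rightarrow> rat" where
  "scaleQ c f = (\<lambda>x. c * f x)"

interpretation ratfun: vector_space "scaleQ :: rat \<Rightarrow> ('a \<Rightarrow> rat) \<Rightarrow> 'a \<Rightarrow> rat"
  by unfold_locales (auto simp: scaleQ_def fun_eq_iff algebra_simps)


section \<open>Compositions and noncommutative symmetric functions\<close>

definition is_composition :: "nat list \<Rightarrow> bool" where
  "is_composition I \<longleftrightarrow> 0 \<notin> set I"

definition compositions :: "nat \<Rightarrow> nat list set" where
  "compositions n = {I. is_composition I \<and> sum_list I = n}"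

definition comp_descents :: "nat list \<Rightarrow> nat set" where
  "comp_descents I = {sum_list (take j I) | j. 1 \<le> j \<and> j < length I}"

text \<open>
  An element of the completed algebra is a formal sum of ribbons, given by the coefficient of
  each \<open>R\<^sub>I\<close>; its values at lists that are not compositions are irrelevant.
\<close>

type_synonym ncsf = "nat list \<Rightarrow> rat"

definition homog :: "nat \<Rightarrow> ncsf \<Rightarrow> ncsf" where
  "homog n F = (\<lambda>K. if K \<in> compositions n then F K else 0)"

text \<open>The ribbons occurring (each with coefficient 1) in \<open>R\<^sub>I \<star> R\<^sub>J\<close>.\<close>

definition ribbon_terms :: "nat list \<Rightarrow> nat list \<Rightarrow> nat list set" where
  "ribbon_terms I J =
     (if I = [] then {J} else if J = [] then {I}
      else {I @ J, butlast I @ (last I + hd J) # tl J})"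

definition star :: "ncsf \<Rightarrow> ncsf \<Rightarrow> ncsf"  (infixl \<open>\<star>\<close> 70) where
  "F \<star> G = (\<lambda>K. \<Sum>(I, J) | is_composition I \<and> is_composition J \<and> K \<in> ribbon_terms I J. F I * G J)"

definition star_one :: ncsf where
  "star_one = indicator {[]}"

primrec star_pow :: "ncsf \<Rightarrow> nat \<Rightarrow> ncsf" where
  "star_pow F 0 = star_one"
| "star_pow F (Suc m) = F \<star> star_pow F m"

text \<open>
  The formal series below are locally finite when \<open>G - star_one\<close> (resp. \<open>F\<close>) has zero
  degree-0 part: then each ribbon has nonzero coefficient in only finitely many summands.
\<close>

definition log_star :: "ncsf \<Rightarrow> ncsf" where
  "log_star G = (\<lambda>K. Sum_any (\<lambda>m. if m = 0 then 0
      else (-1) ^ (m - 1) / of_nat m * star_pow (G - star_one) m K))"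

definition exp_star :: "ncsf \<Rightarrow> ncsf" where
  "exp_star F = (\<lambda>K. Sum_any (\<lambda>m. 1 / fact m * star_pow F m K))"

definition star_powr :: "ncsf \<Rightarrow> rat \<Rightarrow> ncsf" where
  "star_powr G c = exp_star (scaleQ c (log_star G))"

definition V1_plus :: ncsf where
  "V1_plus = indicator (insert [] {[i] | i. i \<ge> 1})"

definition V1_minus :: ncsf where
  "V1_minus = indicator {replicate i 1 | i. True}"

definition V2_plus :: ncsf where
  "V2_plus = V1_plus \<star> V1_minus"

definition V2_minus :: ncsf where
  "V2_minus = V1_minus \<star> V1_plus"

definition I1_plus :: ncsf where
  "I1_plus = scaleQ (1/2) (log_star V2_plus)"

definition I1_minus :: ncsf where
  "I1_minus = scaleQ (1/2) (log_star V2_minus)"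

definition I_plus :: "nat \<Rightarrow> ncsf" where
  "I_plus k = scaleQ (1 / fact k) (star_pow I1_plus k)"

definition I_minus :: "nat \<Rightarrow> ncsf" where
  "I_minus k = scaleQ (1 / fact k) (star_pow I1_minus k)"

definition J0_plus :: ncsf where
  "J0_plus = V1_plus \<star> star_powr V2_minus (- 1/2)"

definition J0_minus :: ncsf where
  "J0_minus = V1_minus \<star> star_powr V2_plus (- 1/2)"

definition J_plus :: "nat \<Rightarrow> ncsf" where
  "J_plus k = J0_plus \<star> I_minus k"

definition J_minus :: "nat \<Rightarrow> ncsf" where
  "J_minus k = J0_minus \<star> I_plus k"

abbreviation I_plus_deg :: "nat \<Rightarrow> nat \<Rightarrow> ncsf" where "I_plus_deg k n \<equiv> homog n (I_plus k)"
abbreviation I_minus_deg :: "nat \<Rightarrow> nat \<Rightarrow> ncsf" where "I_minus_deg k n \<equiv> homog n (I_minus k)"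
abbreviation J_plus_deg :: "nat \<Rightarrow> nat \<Rightarrow> ncsf" where "J_plus_deg k n \<equiv> homog n (J_plus k)"
abbreviation J_minus_deg :: "nat \<Rightarrow> nat \<Rightarrow> ncsf" where "J_minus_deg k n \<equiv> homog n (J_minus k)"


section \<open>The group algebra of the symmetric group\<close>

text \<open>
  Elements of the group algebra of \<open>S\<^sub>n\<close> are functions supported on
  \<open>{\<sigma>. \<sigma> permutes {1..n}}\<close>. Such \<open>\<sigma>\<close> satisfies \<open>\<sigma> 0 = 0\<close>, the convention for left runs and
  left peaks.
\<close>

type_synonym galg = "(nat \<Rightarrow> nat) \<Rightarrow> rat"

definition gmult :: "nat \<Rightarrow> galg \<Rightarrow> galg \<Rightarrow> galg" where
  "gmult n f g = (\<lambda>\<sigma>. \<Sum>(\<alpha>, \<beta>) | \<alpha> permutes {1..n} \<and> \<beta> permutes {1..n} \<and> \<alpha> \<circ> \<beta> = \<sigma>. f \<alpha> * g \<beta>)"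

definition perm_sum :: "nat \<Rightarrow> ((nat \<Rightarrow> nat) \<Rightarrow> bool) \<Rightarrow> galg" where
  "perm_sum n P = indicator {\<sigma>. \<sigma> permutes {1..n} \<and> P \<sigma>}"

definition Des :: "nat \<Rightarrow> (nat \<Rightarrow> nat) \<Rightarrow> nat set" where
  "Des n \<sigma> = {i. 1 \<le> i \<and> i < n \<and> \<sigma> i > \<sigma> (i + 1)}"

text \<open>The identification of \<open>Sym\<^sub>n\<close> with the descent algebra.\<close>

definition to_descent :: "nat \<Rightarrow> ncsf \<Rightarrow> galg" where
  "to_descent n F =
     (\<Sum>I\<in>compositions n. scaleQ (F I) (perm_sum n (\<lambda>\<sigma>. Des n \<sigma> = comp_descents I)))"

text \<open>
  A run of the word \<open>\<sigma> m, \<dots>, \<sigma> n\<close> is recorded by its first and last position.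
\<close>

definition monotone_segment :: "(nat \<Rightarrow> nat) \<Rightarrow> nat \<Rightarrow> nat \<Rightarrow> bool" where
  "monotone_segment \<sigma> a b \<longleftrightarrow> strict_mono_on {a..b} \<sigma> \<or> strict_antimono_on {a..b} \<sigma>"

definition runs :: "nat \<Rightarrow> nat \<Rightarrow> (nat \<Rightarrow> nat) \<Rightarrow> (nat \<times> nat) set" where
  "runs m n \<sigma> = {(a, b). m \<le> a \<and> a \<le> b \<and> b \<le> n \<and> monotone_segment \<sigma> a b \<and>
     (\<forall>a' b'. m \<le> a' \<and> a' \<le> a \<and> b \<le> b' \<and> b' \<le> n \<and> monotone_segment \<sigma> a' b' \<longrightarrow> a' = a \<and> b' = b)}"

definition W :: "nat \<Rightarrow> nat \<Rightarrow> galg" where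
  "W n k = perm_sum n (\<lambda>\<sigma>. card (runs 1 n \<sigma>) = k)"

definition W_plus :: "nat \<Rightarrow> nat \<Rightarrow> galg" where
  "W_plus n k = perm_sum n (\<lambda>\<sigma>. card (runs 1 n \<sigma>) = k \<and>
     (\<exists>b. (1, b) \<in> runs 1 n \<sigma> \<and> strict_mono_on {1..b} \<sigma>))"

definition W_minus :: "nat \<Rightarrow> nat \<Rightarrow> galg" where
  "W_minus n k = perm_sum n (\<lambda>\<sigma>. card (runs 1 n \<sigma>) = k \<and>
     (\<exists>b. (1, b) \<in> runs 1 n \<sigma> \<and> strict_antimono_on {1..b} \<sigma>))"

definition W_left :: "nat \<Rightarrow> nat \<Rightarrow> galg" where
  "W_left n k = perm_sum n (\<lambda>\<sigma>. card (runs 0 n \<sigma>) = k)"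

definition peaks :: "nat \<Rightarrow> (nat \<Rightarrow> nat) \<Rightarrow> nat set" where
  "peaks n \<sigma> = {i. 2 \<le> i \<and> i < n \<and> \<sigma> (i - 1) < \<sigma> i \<and> \<sigma> i > \<sigma> (i + 1)}"

definition left_peaks :: "nat \<Rightarrow> (nat \<Rightarrow> nat) \<Rightarrow> nat set" where
  "left_peaks n \<sigma> = {i. 1 \<le> i \<and> i < n \<and> \<sigma> (i - 1) < \<sigma> i \<and> \<sigma> i > \<sigma> (i + 1)}"

definition W_alg :: "nat \<Rightarrow> galg set" where
  "W_alg n = ratfun.span {W n k | k. k \<ge> 1}"

definition W_left_alg :: "nat \<Rightarrow> galg set" where
  "W_left_alg n = ratfun.span {W_left n k | k. k \<ge> 1}"

definition C_alg :: "nat \<Rightarrow> galg set" where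
  "C_alg n = ratfun.span ({W n (2 * k) | k. k \<ge> 1} \<union>
     {W_plus n (2 * k - 1) | k. k \<ge> 1} \<union> {W_minus n (2 * k - 1) | k. k \<ge> 1})"

definition P_alg :: "nat \<Rightarrow> galg set" where
  "P_alg n = ratfun.span {perm_sum n (\<lambda>\<sigma>. card (peaks n \<sigma>) = k) | k. True}"

definition P_left_alg :: "nat \<Rightarrow> galg set" where
  "P_left_alg n = ratfun.span {perm_sum n (\<lambda>\<sigma>. card (left_peaks n \<sigma>) = k) | k. True}"

definition orthogonal_idempotent_basis :: "nat \<Rightarrow> galg set \<Rightarrow> 'i set \<Rightarrow> ('i \<Rightarrow> galg) \<Rightarrow> bool" where
  "orthogonal_idempotent_basis n A X e \<longleftrightarrow>
     inj_on e X \<and> ratfun.independent (e ` X) \<and> ratfun.span (e ` X) = A \<and>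
     (\<forall>i\<in>X. gmult n (e i) (e i) = e i) \<and>
     (\<forall>i\<in>X. \<forall>j\<in>X. i \<noteq> j \<longrightarrow> gmult n (e i) (e j) = 0)"


text \<open>Written with \<open>k + d \<le> n\<close>, since for \<open>n < d\<close> the upper bound \<open>n - d\<close> is negative.\<close>

definition index_set :: "nat \<Rightarrow> nat \<Rightarrow> nat \<Rightarrow> nat set" where
  "index_set n a d = {k. a \<le> k \<and> k + d \<le> n \<and> k mod 2 = n mod 2}"


section \<open>Symmetric functions\<close>

text \<open>
  The ambient ring is that of formal power series over the rationals in the variables
  \<open>x\<^sub>0, x\<^sub>1, \<dots>\<close>; a monomial is given by its finitely supported exponent vector.
\<close>

typedef pseries = "UNIV :: ((nat \<Rightarrow>\<^sub>0 nat) \<Rightarrow> rat) set"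
  morphisms pcoeff Pseries ..

setup_lifting type_definition_pseries

lemma pseries_eqI: "(\<And>m. pcoeff f m = pcoeff g m) \<Longrightarrow> f = g"
  by (metis ext pcoeff_inject)

lemma finite_add_decompositions:
  "finite {(a, b). a + b = (m :: nat \<Rightarrow>\<^sub>0 nat)}"
proof -
  let ?N = "Max (insert 0 (Poly_Mapping.lookup m ` Poly_Mapping.keys m))"
  let ?F = "{f. \<forall>x. (x \<in> Poly_Mapping.keys m \<longrightarrow> f x \<in> {..?N}) \<and> (x \<notin> Poly_Mapping.keys m \<longrightarrow> f x = (0::nat))}"
  have "finite ?F"
    by (rule finite_set_of_finite_funs) auto
  then have "finite (Poly_Mapping.lookup -` ?F)"
    by (rule finite_vimageI) (simp add: inj_def poly_mapping_eqI)
  moreover have sub: "a \<in> Poly_Mapping.lookup -` ?F" if "a + b = m" for a b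
  proof -
    have le: "Poly_Mapping.lookup a x \<le> Poly_Mapping.lookup m x" for x
      using that by (auto simp: lookup_add)
    show ?thesis
    proof (clarsimp, intro conjI impI)
      fix x assume "x \<in> Poly_Mapping.keys m"
      then have "Poly_Mapping.lookup m x \<le> ?N"
        by (intro Max_ge) auto
      then show "Poly_Mapping.lookup a x \<le> ?N"
        using le[of x] by linarith
    next
      fix x assume "x \<notin> Poly_Mapping.keys m"
      then show "Poly_Mapping.lookup a x = 0"
        using le[of x] by (simp add: in_keys_iff)
    qed
  qed
  ultimately have fin: "finite (Poly_Mapping.lookup -` ?F \<times> Poly_Mapping.lookup -` ?F)"
    by blast
  have "{(a, b). a + b = m} \<subseteq> Poly_Mapping.lookup -` ?F \<times> Poly_Mapping.lookup -` ?F"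
  proof
    fix p assume "p \<in> {(a, b). a + b = m}"
    then have "fst p + snd p = m" "snd p + fst p = m"
      by (auto simp: add.commute)
    then show "p \<in> Poly_Mapping.lookup -` ?F \<times> Poly_Mapping.lookup -` ?F"
      using sub[of "fst p" "snd p"] sub[of "snd p" "fst p"] by (simp only: mem_Times_iff)
  qed
  then show ?thesis
    using fin by (rule finite_subset)
qed

instantiation pseries :: comm_ring_1
begin

lift_definition zero_pseries :: pseries is "\<lambda>m. 0" .
lift_definition one_pseries :: pseries is "\<lambda>m. if m = 0 then 1 else 0" .
lift_definition plus_pseries :: "pseries \<Rightarrow> pseries \<Rightarrow> pseries" is "\<lambda>f g m. f m + g m" .
lift_definition minus_pseries :: "pseries \<Rightarrow> pseries \<Rightarrow> pseries" is "\<lambda>f g m. f m - g m" .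
lift_definition uminus_pseries :: "pseries \<Rightarrow> pseries" is "\<lambda>f m. - f m" .
lift_definition times_pseries :: "pseries \<Rightarrow> pseries \<Rightarrow> pseries" is
  "\<lambda>f g m. \<Sum>(a, b) | a + b = m. f a * g b" .

instance
proof
  fix f g h :: pseries
  show "f * g * h = f * (g * h)"
  proof (rule pseries_eqI)
    fix m
    let ?D = "\<lambda>m. {(a, b). a + b = (m :: nat \<Rightarrow>\<^sub>0 nat)}"
    have "pcoeff (f * g * h) m = (\<Sum>p\<in>?D m. \<Sum>q\<in>?D (fst p).
        pcoeff f (fst q) * pcoeff g (snd q) * pcoeff h (snd p))"
      by (simp add: times_pseries.rep_eq case_prod_unfold sum_distrib_right)
    also have "\<dots> = (\<Sum>(p, q)\<in>Sigma (?D m) (\<lambda>p. ?D (fst p)).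
        pcoeff f (fst q) * pcoeff g (snd q) * pcoeff h (snd p))"
      by (rule sum.Sigma) (auto simp: finite_add_decompositions)
    also have "\<dots> = (\<Sum>(p, q)\<in>Sigma (?D m) (\<lambda>p. ?D (snd p)).
        pcoeff f (fst p) * (pcoeff g (fst q) * pcoeff h (snd q)))"
      by (rule sum.reindex_bij_witness
            [where i = "\<lambda>((a, s), (b, c)). ((a + b, c), (a, b))"
               and j = "\<lambda>((s, c), (a, b)). ((a, b + c), (b, c))"])
         (auto simp: add.assoc mult.assoc)
    also have "\<dots> = (\<Sum>p\<in>?D m. \<Sum>q\<in>?D (snd p).
        pcoeff f (fst p) * (pcoeff g (fst q) * pcoeff h (snd q)))"
      by (rule sum.Sigma[symmetric]) (auto simp: finite_add_decompositions)
    also have "\<dots> = pcoeff (f * (g * h)) m"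
      by (simp add: times_pseries.rep_eq case_prod_unfold sum_distrib_left)
    finally show "pcoeff (f * g * h) m = pcoeff (f * (g * h)) m" .
  qed
  show "f * g = g * f"
  proof (rule pseries_eqI)
    fix m
    show "pcoeff (f * g) m = pcoeff (g * f) m"
      unfolding times_pseries.rep_eq
      by (rule sum.reindex_bij_witness[where i = prod.swap and j = prod.swap])
         (auto simp: add.commute mult.commute)
  qed
  show "1 * f = f"
  proof (rule pseries_eqI)
    fix m
    have "pcoeff (1 * f) m = (\<Sum>(a, b)\<in>{(0, m)}. pcoeff 1 a * pcoeff f b)"
      unfolding times_pseries.rep_eq
      by (rule sum.mono_neutral_right)
         (auto simp: finite_add_decompositions one_pseries.rep_eq split: if_splits)
    then show "pcoeff (1 * f) m = pcoeff f m"
      by (simp add: one_pseries.rep_eq)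
  qed
  show "(f + g) * h = f * h + g * h"
    by (rule pseries_eqI)
       (simp add: times_pseries.rep_eq plus_pseries.rep_eq case_prod_unfold
          distrib_right sum.distrib)
  show "(0::pseries) \<noteq> 1"
    by transfer (auto simp: fun_eq_iff)
qed (transfer; simp add: fun_eq_iff algebra_simps)+

end

lift_definition ps_scale :: "rat \<Rightarrow> pseries \<Rightarrow> pseries" is "\<lambda>c f m. c * f m" .

definition monom_degree :: "(nat \<Rightarrow>\<^sub>0 nat) \<Rightarrow> nat" where
  "monom_degree m = (\<Sum>i\<in>Poly_Mapping.keys m. Poly_Mapping.lookup m i)"

lift_definition power_sum :: "nat \<Rightarrow> pseries" is
  "\<lambda>r m. if \<exists>i. m = Poly_Mapping.single i r then 1 else 0" .

lift_definition complete_hom :: "nat \<Rightarrow> pseries" is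
  "\<lambda>r m. if monom_degree m = r then 1 else 0" .

definition h_comp :: "nat list \<Rightarrow> pseries" where
  "h_comp J = prod_list (map complete_hom J)"

definition ribbon_schur :: "nat list \<Rightarrow> pseries" where
  "ribbon_schur I =
     (\<Sum>J | J \<in> compositions (sum_list I) \<and> comp_descents J \<subseteq> comp_descents I.
        (-1) ^ (length I - length J) * h_comp J)"

text \<open>Only meaningful for \<open>F\<close> of finite support, i.e. on the uncompleted algebra.\<close>

definition Gamma_map :: "ncsf \<Rightarrow> pseries" where
  "Gamma_map F = (\<Sum>I | is_composition I \<and> F I \<noteq> 0. ps_scale (F I) (ribbon_schur I))"

definition partitions :: "nat \<Rightarrow> nat multiset set" where
  "partitions n = {\<mu>. 0 \<notin># \<mu> \<and> sum_mset \<mu> = n}"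

definition p_part :: "nat multiset \<Rightarrow> pseries" where
  "p_part \<mu> = (\<Prod>r\<in>#\<mu>. power_sum r)"

definition z_part :: "nat multiset \<Rightarrow> nat" where
  "z_part \<mu> = (\<Prod>r\<in>set_mset \<mu>. r ^ count \<mu> r * fact (count \<mu> r))"

definition odd_parts :: "nat multiset \<Rightarrow> nat" where
  "odd_parts \<mu> = size (filter_mset odd \<mu>)"

definition even_parts :: "nat multiset \<Rightarrow> nat" where
  "even_parts \<mu> = size (filter_mset even \<mu>)"

definition p_sum :: "nat \<Rightarrow> (nat multiset \<Rightarrow> bool) \<Rightarrow> pseries" where
  "p_sum n P = (\<Sum>\<mu> | \<mu> \<in> partitions n \<and> P \<mu>. ps_scale (1 / of_nat (z_part \<mu>)) (p_part \<mu>))"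

end

theory Submission
  imports
    Defs
    "HOL-Computational_Algebra.Formal_Power_Series"
    "HOL-Computational_Algebra.Polynomial"
begin

text \<open>
  Let \<open>V\<^sub>k\<^sup>\<plusminus>\<close> be the alternating external product of \<open>k\<close> factors \<open>V\<^sub>1\<^sup>+\<close> and \<open>V\<^sub>1\<^sup>-\<close> whose first factor is
  \<open>V\<^sub>1\<^sup>\<plusminus>\<close>. The exponential series gives \<open>V\<^sub>k\<^sup>\<plusminus> = \<Sum>\<^sub>j k\<^sup>j I\<^sub>j\<^sup>\<plusminus>\<close> for even \<open>k\<close> and
  \<open>V\<^sub>k\<^sup>\<plusminus> = \<Sum>\<^sub>j k\<^sup>j J\<^sub>j\<^sup>\<plusminus>\<close> for odd \<open>k\<close>, so every polynomial identity for the \<open>V\<^sub>k\<^sup>\<plusminus>\<close> turns into one for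
  the \<open>I\<^sub>j\<^sup>\<plusminus>\<close> and \<open>J\<^sub>j\<^sup>\<plusminus>\<close>. In the group algebra \<open>V\<^sub>k\<^sup>\<plusminus>\<close> is the sum, over all words of length \<open>n\<close> in \<open>k\<close>
  signed letters, of the permutations sorting these words; sorting twice shows that
  \<open>V\<^sub>a\<^sup>\<plusminus> V\<^sub>b\<^sup>\<plusminus>\<close> is some \<open>V\<^sub>a\<^sub>b\<^sup>\<plusminus>\<close>, which yields all products of the \<open>I\<^sub>j\<^sup>\<plusminus>\<close> and \<open>J\<^sub>j\<^sup>\<plusminus>\<close>.
  The coefficient of a permutation with \<open>r\<close> left runs in \<open>V\<^sub>k\<^sup>+\<close> is the coefficient of \<open>x\<^sup>k\<close> in
  \<open>u c\<^sup>n\<^sup>-\<^sup>r s\<^sup>r / 2\<close>, where \<open>u = (1 + x) / (1 - x)\<close> has even part \<open>c\<close> and odd part \<open>s\<close>; this places the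
  idempotents in the five algebras. Their images under \<open>\<Gamma>\<close> follow from Newton's identities and are
  nonzero, so that the idempotents are independent, and counting dimensions finishes the proof.
\<close>

text \<open>The \<open>I\<^sub>j\<close> and \<open>J\<^sub>j\<close> come from logarithms and
  square roots, so they cannot be multiplied combinatorially; only \<open>V\<^sub>k\<close> at
  integers \<open>k\<close> counts something. The exponent -1/2 in \<open>J\<^sub>0\<close> is what
  makes \<open>V\<^sub>1 V\<^sub>2^m = J\<^sub>0 exp((2m+1) I\<^sub>1)\<close>
  (\<open>J\<^sub>0\<close> and \<open>I\<^sub>1\<close> of opposite sign), so that in each degree
  the odd products are polynomial in 2m+1 itself. A polynomial is determined by its values on either
  parity class, hence even and odd \<open>k\<close> can be compared separately. Orthogonality
  between different \<open>j\<close> is the absence of mixed monomials in \<open>(ab)^j\<close>; for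
  equal \<open>j\<close> there remain four elements, in which everything is arithmetic with
  coefficients. The peak algebras need a coincidence: \<open>r\<close> and \<open>r + 1\<close> left
  runs give the same coefficient at \<open>x^k\<close> whenever \<open>k\<close> and
  \<open>r\<close> have different parity. Under Gamma the logarithms of \<open>V\<^sub>1^+\<close>
  and \<open>V\<^sub>1^-\<close> have the same odd and opposite even power sums. So
  \<open>V\<^sub>2\<close>, and with it every \<open>I\<^sub>j\<close>, sees no even part, while
  \<open>J\<^sub>j\<close> weights each even part by 1 or -1.\<close>

unbundle fps_syntax

section \<open>Formal power series in two noncommuting variables\<close>

typedef wseries = "UNIV :: (bool list \<Rightarrow> rat) set"
  morphisms wcoeff Wseries ..

setup_lifting type_definition_wseries

lemma wseries_eqI: "(\<And>w. wcoeff f w = wcoeff g w) \<Longrightarrow> f = g"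
  by (metis ext wcoeff_inject)

instantiation wseries :: ring_1
begin

lift_definition zero_wseries :: wseries is "\<lambda>w. 0" .
lift_definition one_wseries :: wseries is "\<lambda>w. if w = [] then 1 else 0" .
lift_definition plus_wseries :: "wseries \<Rightarrow> wseries \<Rightarrow> wseries" is "\<lambda>f g w. f w + g w" .
lift_definition minus_wseries :: "wseries \<Rightarrow> wseries \<Rightarrow> wseries" is "\<lambda>f g w. f w - g w" .
lift_definition uminus_wseries :: "wseries \<Rightarrow> wseries" is "\<lambda>f w. - f w" .
lift_definition times_wseries :: "wseries \<Rightarrow> wseries \<Rightarrow> wseries" is
  "\<lambda>f g w. \<Sum>c\<le>length w. f (take c w) * g (drop c w)" .

instance
proof
  fix f g h :: wseries
  show "f * g * h = f * (g * h)"
  proof (rule wseries_eqI)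
    fix w
    have "wcoeff (f * g * h) w = (\<Sum>c\<le>length w. \<Sum>a\<le>c.
        wcoeff f (take a w) * wcoeff g (take (c - a) (drop a w)) * wcoeff h (drop c w))"
      unfolding times_wseries.rep_eq sum_distrib_right
      by (intro sum.cong) (auto simp: min_def drop_take)
    also have "\<dots> = (\<Sum>(c, a)\<in>Sigma {..length w} (\<lambda>c. {..c}).
        wcoeff f (take a w) * wcoeff g (take (c - a) (drop a w)) * wcoeff h (drop c w))"
      by (rule sum.Sigma) auto
    also have "\<dots> = (\<Sum>(a, b)\<in>Sigma {..length w} (\<lambda>a. {..length w - a}).
        wcoeff f (take a w) * (wcoeff g (take b (drop a w)) * wcoeff h (drop (a + b) w)))"
      by (rule sum.reindex_bij_witness
            [where i = "\<lambda>(a, b). (a + b, a)" and j = "\<lambda>(c, a). (a, c - a)"])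
         (auto simp: mult.assoc)
    also have "\<dots> = (\<Sum>a\<le>length w. \<Sum>b\<le>length w - a.
        wcoeff f (take a w) * (wcoeff g (take b (drop a w)) * wcoeff h (drop (a + b) w)))"
      by (rule sum.Sigma[symmetric]) auto
    also have "\<dots> = wcoeff (f * (g * h)) w"
      by (simp add: times_wseries.rep_eq sum_distrib_left add.commute)
    finally show "wcoeff (f * g * h) w = wcoeff (f * (g * h)) w" .
  qed
  show "1 * f = f"
  proof (rule wseries_eqI)
    fix w
    have "wcoeff (1 * f) w = (\<Sum>c\<in>{0}. wcoeff 1 (take c w) * wcoeff f (drop c w))"
      unfolding times_wseries.rep_eq
      by (rule sum.mono_neutral_right) (auto simp: one_wseries.rep_eq)
    then show "wcoeff (1 * f) w = wcoeff f w"
      by (simp add: one_wseries.rep_eq)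
  qed
  show "f * 1 = f"
  proof (rule wseries_eqI)
    fix w
    have "wcoeff (f * 1) w = (\<Sum>c\<in>{length w}. wcoeff f (take c w) * wcoeff 1 (drop c w))"
      unfolding times_wseries.rep_eq
      by (rule sum.mono_neutral_right) (auto simp: one_wseries.rep_eq)
    then show "wcoeff (f * 1) w = wcoeff f w"
      by (simp add: one_wseries.rep_eq)
  qed
  show "(f + g) * h = f * h + g * h" "f * (g + h) = f * g + f * h"
    by (rule wseries_eqI;
        simp add: times_wseries.rep_eq plus_wseries.rep_eq algebra_simps sum.distrib)+
  show "(0::wseries) \<noteq> 1"
    by transfer (auto simp: fun_eq_iff)
qed (transfer; simp add: fun_eq_iff algebra_simps)+

end

lift_definition wconst :: "rat \<Rightarrow> wseries" is "\<lambda>c w. if w = [] then c else 0" .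

lemma wcoeff_simps [simp]:
  "wcoeff 0 w = 0"
  "wcoeff (f + g) w = wcoeff f w + wcoeff g w"
  "wcoeff (f - g) w = wcoeff f w - wcoeff g w"
  "wcoeff (- f) w = - wcoeff f w"
  by (transfer; simp)+

lemma wcoeff_one: "wcoeff 1 w = (if w = [] then 1 else 0)"
  by transfer simp

lemma wcoeff_Nil [simp]: "wcoeff 1 [] = 1" "wcoeff (f * g) [] = wcoeff f [] * wcoeff g []"
  "wcoeff (wconst c) [] = c"
  by (transfer; simp)+

lemma wcoeff_power_Nil [simp]: "wcoeff (f ^ m) [] = wcoeff f [] ^ m"
  by (induction m) auto

lemma wcoeff_sum: "wcoeff (\<Sum>x\<in>X. f x) w = (\<Sum>x\<in>X. wcoeff (f x) w)"
  by (induction X rule: infinite_finite_induct) auto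

lemma wcoeff_mult: "wcoeff (f * g) w = (\<Sum>c\<le>length w. wcoeff f (take c w) * wcoeff g (drop c w))"
  by transfer simp

lemma wcoeff_wconst_mult [simp]: "wcoeff (wconst c * f) w = c * wcoeff f w"
proof -
  have "wcoeff (wconst c * f) w = (\<Sum>a\<in>{0}. wcoeff (wconst c) (take a w) * wcoeff f (drop a w))"
    unfolding wcoeff_mult by (rule sum.mono_neutral_right) (auto simp: wconst.rep_eq)
  then show ?thesis by simp
qed

lemma wconst_mult_right: "f * wconst c = wconst c * f"
proof (rule wseries_eqI)
  fix w
  have "wcoeff (f * wconst c) w
      = (\<Sum>a\<in>{length w}. wcoeff f (take a w) * wcoeff (wconst c) (drop a w))"
    unfolding wcoeff_mult by (rule sum.mono_neutral_right) (auto simp: wconst.rep_eq)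
  then show "wcoeff (f * wconst c) w = wcoeff (wconst c * f) w" by simp
qed

lemma wconst_mult_left: "f * (wconst c * g) = wconst c * (f * g)"
  by (metis mult.assoc wconst_mult_right)

lemma wconst_hom: "wconst (a * b) = wconst a * wconst b" "wconst (a + b) = wconst a + wconst b"
  "wconst 1 = 1"
  by (rule wseries_eqI, simp add: wconst.rep_eq wcoeff_one)+

lemma wconst_mult_power: "(wconst c * f) ^ m = wconst (c ^ m) * f ^ m"
proof (induction m)
  case (Suc m)
  have "(wconst c * f) ^ Suc m = wconst c * (f * (wconst (c ^ m) * f ^ m))"
    by (simp add: Suc mult.assoc)
  also have "\<dots> = wconst (c ^ Suc m) * f ^ Suc m"
    by (simp only: wconst_mult_left[of f] wconst_hom power_Suc mult.assoc)
  finally show ?case .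
qed (simp add: wconst_hom)

text \<open>Orders of vanishing add: wherever a word shorter than \<open>i + j\<close> is cut, one
  of the two pieces is too short.\<close>

lemma wcoeff_mult_eq_0:
  assumes "\<And>u. length u < i \<Longrightarrow> wcoeff f u = 0" "\<And>u. length u < j \<Longrightarrow> wcoeff g u = 0"
    and "length w < i + j"
  shows "wcoeff (f * g) w = 0"
  unfolding wcoeff_mult
proof (intro sum.neutral ballI)
  fix c assume "c \<in> {..length w}"
  then show "wcoeff f (take c w) * wcoeff g (drop c w) = 0"
    using assms(1)[of "take c w"] assms(2)[of "drop c w"] assms(3) by (cases "c < i") auto
qed

lemma wcoeff_power_eq_0:
  assumes "wcoeff f [] = 0" "length w < m"
  shows "wcoeff (f ^ m) w = 0"
  using assms(2)
proof (induction m arbitrary: w)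
  case (Suc m)
  show ?case unfolding power_Suc
    using Suc.IH Suc.prems assms(1)
    by (intro wcoeff_mult_eq_0[where i = 1 and j = m]) auto
qed auto

lemma wcoeff_mult_cong:
  assumes "\<And>u. length u \<le> length w \<Longrightarrow> wcoeff f u = wcoeff f' u"
    "\<And>u. length u \<le> length w \<Longrightarrow> wcoeff g u = wcoeff g' u"
  shows "wcoeff (f * g) w = wcoeff (f' * g') w"
  unfolding wcoeff_mult by (rule sum.cong) (use assms in auto)


subsection \<open>Substitution into a power series\<close>

text \<open>Stopping the sum at the length of the word makes substitution total. It is the genuine
  infinite sum when \<open>f\<close> has no constant term, since higher powers of \<open>f\<close>
  then vanish on the word.\<close>

lift_definition ev :: "wseries \<Rightarrow> rat fps \<Rightarrow> wseries" is
  "\<lambda>f p w. \<Sum>m\<le>length w. p $ m * wcoeff (Wseries f ^ m) w" .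

lemma wcoeff_ev: "wcoeff (ev f p) w = (\<Sum>m\<le>length w. p $ m * wcoeff (f ^ m) w)"
  by (simp add: ev.rep_eq wcoeff_inverse)

lemma wcoeff_ev':
  assumes "wcoeff f [] = 0" "length w \<le> N"
  shows "wcoeff (ev f p) w = wcoeff (\<Sum>m\<le>N. wconst (p $ m) * f ^ m) w"
  unfolding wcoeff_sum wcoeff_ev
  by (rule sum.mono_neutral_cong_left) (use assms wcoeff_power_eq_0 in auto)

lemma ev_Nil [simp]: "wcoeff (ev f p) [] = p $ 0"
  by (simp add: wcoeff_ev)

lemma ev_add: "ev f (p + q) = ev f p + ev f q"
  by (rule wseries_eqI) (simp add: wcoeff_ev algebra_simps sum.distrib)

lemma ev_const: "ev f (fps_const c * p) = wconst c * ev f p"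
  by (rule wseries_eqI) (simp add: wcoeff_ev sum_distrib_left algebra_simps)

lemma ev_one [simp]: "ev f 1 = 1"
  by (rule wseries_eqI) (simp add: wcoeff_ev if_distrib[of "\<lambda>x. x * _"] cong: if_cong)

lemma ev_X:
  assumes "wcoeff f [] = 0"
  shows "ev f fps_X = f"
  using assms by (intro wseries_eqI) (auto simp: wcoeff_ev fps_X_nth if_distrib[of "\<lambda>x. x * _"]
      Suc_le_eq cong: if_cong)

lemma wcoeff_two_terms:
  "wcoeff (wconst a * f ^ i * (wconst b * f ^ j)) w = a * b * wcoeff (f ^ (i + j)) w"
  by (metis wconst_mult_left mult.assoc power_add wcoeff_wconst_mult)

text \<open>With a common cutoff at the length of the word, the terms with \<open>i + j\<close>
  beyond it vanish by order; the remaining triangle is summed along its diagonals.\<close>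

lemma ev_mult:
  assumes "wcoeff f [] = 0"
  shows "ev f (p * q) = ev f p * ev f q"
proof (rule wseries_eqI)
  fix w :: "bool list"
  define N where "N = length w"
  have vanish: "wcoeff (f ^ (i + j)) w = 0" if "\<not> j \<le> N - i" for i j
    using that assms by (intro wcoeff_power_eq_0) (auto simp: N_def)
  have "wcoeff (ev f p * ev f q) w =
      wcoeff ((\<Sum>i\<le>N. wconst (p $ i) * f ^ i) * (\<Sum>j\<le>N. wconst (q $ j) * f ^ j)) w"
    unfolding N_def by (rule wcoeff_mult_cong) (rule wcoeff_ev'[OF assms], assumption)+
  also have "\<dots> = (\<Sum>i\<le>N. \<Sum>j\<le>N. p $ i * q $ j * wcoeff (f ^ (i + j)) w)"
    by (simp only: sum_product wcoeff_sum wcoeff_two_terms)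
  also have "\<dots> = (\<Sum>(i, j)\<in>{..N} \<times> {..N}. p $ i * q $ j * wcoeff (f ^ (i + j)) w)"
    by (rule sum.cartesian_product)
  also have "\<dots> = (\<Sum>(i, j)\<in>Sigma {..N} (\<lambda>i. {..N - i}). p $ i * q $ j * wcoeff (f ^ (i + j)) w)"
    by (rule sum.mono_neutral_right)
       (use vanish in \<open>auto, blast\<close>)
  also have "\<dots> = (\<Sum>(m, i)\<in>Sigma {..N} (\<lambda>m. {..m}). p $ i * q $ (m - i) * wcoeff (f ^ m) w)"
    by (rule sum.reindex_bij_witness[where i = "\<lambda>(m, i). (i, m - i)" and j = "\<lambda>(i, j). (i + j, i)"]) auto
  also have "\<dots> = (\<Sum>m\<le>N. \<Sum>i\<le>m. p $ i * q $ (m - i) * wcoeff (f ^ m) w)"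
    by (rule sum.Sigma[symmetric]) auto
  also have "\<dots> = wcoeff (ev f (p * q)) w"
    by (simp add: wcoeff_ev fps_mult_nth N_def sum_distrib_right atLeast0AtMost)
  finally show "wcoeff (ev f (p * q)) w = wcoeff (ev f p * ev f q) w" ..
qed

lemma ev_power:
  assumes "wcoeff f [] = 0"
  shows "ev f (p ^ m) = ev f p ^ m"
  by (induction m) (use assms in \<open>auto simp: ev_mult\<close>)

text \<open>After exchanging the sums, the cutoffs agree because \<open>q ^ m\<close> has no
  coefficient below \<open>m\<close>.\<close>

lemma ev_ev:
  assumes "wcoeff f [] = 0" "q $ 0 = 0"
  shows "ev (ev f q) p = ev f (p oo q)"
proof (rule wseries_eqI)
  fix w :: "bool list"
  define N where "N = length w"
  have "wcoeff (ev (ev f q) p) w = (\<Sum>m\<le>N. p $ m * (\<Sum>j\<le>N. q ^ m $ j * wcoeff (f ^ j) w))"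
    by (simp add: wcoeff_ev N_def ev_power[OF assms(1), symmetric])
  also have "\<dots> = (\<Sum>j\<le>N. (\<Sum>m\<le>N. p $ m * q ^ m $ j) * wcoeff (f ^ j) w)"
    unfolding sum_distrib_left sum_distrib_right by (subst sum.swap) (simp add: mult.assoc)
  also have "\<dots> = (\<Sum>j\<le>N. (p oo q) $ j * wcoeff (f ^ j) w)"
  proof (rule sum.cong[OF refl])
    fix j assume "j \<in> {..N}"
    then have "(\<Sum>m\<le>N. p $ m * q ^ m $ j) = (\<Sum>m\<le>j. p $ m * q ^ m $ j)"
      by (intro sum.mono_neutral_right) (use assms in \<open>auto simp: startsby_zero_power_prefix\<close>)
    then show "(\<Sum>m\<le>N. p $ m * q ^ m $ j) * wcoeff (f ^ j) w = (p oo q) $ j * wcoeff (f ^ j) w"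
      by (simp add: fps_compose_nth atLeast0AtMost)
  qed
  finally show "wcoeff (ev (ev f q) p) w = wcoeff (ev f (p oo q)) w"
    by (simp add: wcoeff_ev N_def)
qed

text \<open>The composite solves \<open>(1 + X) g' = c g\<close>, whose solutions are the multiples
  of the binomial series; the constant term 1 fixes the multiple.\<close>

lemma fps_exp_compose_ln: "fps_exp c oo fps_ln (1::rat) = fps_binomial c"
proof -
  define g where "g = fps_exp c oo fps_ln (1::rat)"
  have "fps_deriv g = (fps_deriv (fps_exp c) oo fps_ln 1) * fps_deriv (fps_ln 1)"
    unfolding g_def by (rule fps_compose_deriv) simp
  also have "\<dots> = fps_const c * g / (1 + fps_X)"
    by (simp add: g_def fps_ln_deriv fps_compose_mult_distrib fps_divide_unit)
  finally have "g = fps_const (g $ 0) * fps_binomial c"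
    by (simp add: fps_binomial_ODE_unique)
  then show ?thesis by (simp add: g_def)
qed

section \<open>Compositions as words\<close>

fun comp_aux :: "nat \<Rightarrow> bool list \<Rightarrow> nat list" where
  "comp_aux a [] = [a]"
| "comp_aux a (b # w) = (if b then a # comp_aux (Suc 0) w else comp_aux (Suc a) w)"

text \<open>
  The composition of \<open>n\<close> with descent set \<open>{i. 1 \<le> i < n \<and> w ! i}\<close>, where \<open>n = length w\<close>. The first
  bit of \<open>w\<close> is ignored; with this redundant bit, cutting a ribbon in two becomes cutting a word.
\<close>

definition comp_of :: "bool list \<Rightarrow> nat list" where
  "comp_of w = (case w of [] \<Rightarrow> [] | b # v \<Rightarrow> comp_aux (Suc 0) v)"

lemma comp_of_simps [simp]: "comp_of [] = []" "comp_of (b # v) = comp_aux (Suc 0) v"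
  by (simp_all add: comp_of_def)

lemma comp_aux_not_Nil [simp]: "comp_aux a w \<noteq> []"
  by (induction a w rule: comp_aux.induct) auto

lemma sum_list_comp_aux [simp]: "sum_list (comp_aux a w) = a + length w"
  by (induction a w rule: comp_aux.induct) auto

lemma sum_list_comp_of [simp]: "sum_list (comp_of w) = length w"
  by (cases w) auto

lemma is_composition_comp_aux: "a > 0 \<Longrightarrow> is_composition (comp_aux a w)"
  by (induction a w rule: comp_aux.induct) (auto simp: is_composition_def)

lemma is_composition_comp_of [simp]: "is_composition (comp_of w)"
  by (cases w) (auto simp: is_composition_comp_aux, simp add: is_composition_def)

lemma comp_of_in_compositions [simp]: "comp_of w \<in> compositions (length w)"
  by (simp add: compositions_def)

lemma hd_comp_aux_ge: "a \<le> hd (comp_aux a w)"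
  by (induction a w rule: comp_aux.induct) auto

text \<open>The head of the composition reveals the first bit: it is \<open>a\<close> after True and
  at least \<open>Suc a\<close> after False.\<close>

lemma comp_aux_inj: "comp_aux a v = comp_aux a v' \<Longrightarrow> v = v'"
proof (induction v arbitrary: a v')
  case Nil
  then have "sum_list (comp_aux a []) = sum_list (comp_aux a v')" by simp
  then show ?case by simp
next
  case (Cons b u)
  then have "sum_list (comp_aux a (b # u)) = sum_list (comp_aux a v')" by simp
  then obtain b' u' where v': "v' = b' # u'"
    unfolding sum_list_comp_aux by (cases v') auto
  show ?case
    using Cons hd_comp_aux_ge[of "Suc a" u] hd_comp_aux_ge[of "Suc a" u']
    unfolding v' by (auto split: if_splits dest: arg_cong[of _ _ hd])
qed

lemma comp_aux_replicate: "comp_aux a (replicate m False @ w) = comp_aux (a + m) w"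
  by (induction m arbitrary: a) auto

lemma comp_aux_surj:
  assumes "is_composition K" "K \<noteq> []"
  shows "\<exists>v. comp_aux (Suc 0) v = K"
  using assms
proof (induction K)
  case (Cons a K)
  then have a: "a > 0" by (auto simp: is_composition_def)
  show ?case
  proof (cases "K = []")
    case True
    then show ?thesis
      using a comp_aux_replicate[of 1 "a - 1" "[]"] by (intro exI[of _ "replicate (a - 1) False"]) auto
  next
    case False
    then obtain v where "comp_aux (Suc 0) v = K"
      using Cons by (auto simp: is_composition_def)
    then have "comp_aux (Suc 0) (replicate (a - 1) False @ True # v) = a # K"
      using a by (simp add: comp_aux_replicate)
    then show ?thesis by blast
  qed
qed auto

lemma comp_aux_append_True: "comp_aux a (u @ True # v) = comp_aux a u @ comp_aux (Suc 0) v"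
  by (induction a u rule: comp_aux.induct) auto

lemma comp_aux_shift: "comp_aux (a + c) v = (c + hd (comp_aux a v)) # tl (comp_aux a v)"
  by (induction v arbitrary: a) (auto simp flip: add_Suc)

lemma comp_aux_append_False:
  "comp_aux a (u @ False # v) =
     butlast (comp_aux a u) @ (last (comp_aux a u) + hd (comp_aux (Suc 0) v)) # tl (comp_aux (Suc 0) v)"
proof (induction a u rule: comp_aux.induct)
  case (1 a)
  show ?case using comp_aux_shift[of "Suc 0" a v] by (simp only: append_Nil comp_aux.simps) simp
qed auto

lemma ribbon_terms_comp_aux:
  "K \<in> ribbon_terms (comp_aux (Suc 0) u) (comp_aux (Suc 0) v) \<longleftrightarrow> (\<exists>b. K = comp_aux (Suc 0) (u @ b # v))"
  by (auto simp: ribbon_terms_def comp_aux_append_True comp_aux_append_False ex_bool_eq)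

lemma bij_betw_comp_aux:
  assumes "n > 0"
  shows "bij_betw (comp_aux (Suc 0)) {v. length v = n - 1} (compositions n)"
proof (rule bij_betwI')
  fix K assume K: "K \<in> compositions n"
  then have "K \<noteq> []" using assms by (auto simp: compositions_def)
  then obtain v where "comp_aux (Suc 0) v = K"
    using K comp_aux_surj by (auto simp: compositions_def)
  with K show "\<exists>v\<in>{v. length v = n - 1}. K = comp_aux (Suc 0) v"
    by (auto simp: compositions_def)
next
  fix v assume "v \<in> {v :: bool list. length v = n - 1}"
  with assms show "comp_aux (Suc 0) v \<in> compositions n"
    by (auto simp: compositions_def is_composition_comp_aux)
qed (use comp_aux_inj in blast)

lemma finite_compositions [simp]: "finite (compositions n)"
proof (cases "n = 0")
  case True
  have "compositions 0 = {[]}"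
    by (auto simp: compositions_def is_composition_def) (metis list.set_intros(1) neq_Nil_conv)
  with True show ?thesis by simp
next
  case False
  have "finite {v :: bool list. length v = n - 1}"
    using finite_lists_length_eq[of "UNIV :: bool set"] by simp
  then show ?thesis using bij_betw_finite[OF bij_betw_comp_aux] False by auto
qed

text \<open>At an interior cut the bit there selects one of the two ribbons of the product: True
  keeps the adjacent parts separate, False joins them.\<close>

lemma comp_of_cut_in: "comp_of w \<in> ribbon_terms (comp_of (take c w)) (comp_of (drop c w))"
proof (cases w)
  case (Cons b v)
  show ?thesis
  proof (cases c)
    case 0
    then show ?thesis by (simp add: ribbon_terms_def)
  next
    case (Suc d)
    show ?thesis
    proof (cases "d < length v")
      case True
      then have "v = take d v @ v ! d # drop (Suc d) v" by (rule id_take_nth_drop)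
      moreover have "drop d v = v ! d # drop (Suc d) v"
        using True by (rule Cons_nth_drop_Suc[symmetric])
      ultimately show ?thesis
        unfolding Cons Suc by (simp add: ribbon_terms_comp_aux) metis
    qed (simp add: Cons Suc ribbon_terms_def)
  qed
qed (simp add: ribbon_terms_def)

text \<open>For nonempty factors, their words determine the word of the ribbon up to the single bit
  between them, and this bit becomes the ignored first bit of the right piece. Empty factors are the
  cuts at the two ends.\<close>

lemma ribbon_cuts:
  "{(I, J). is_composition I \<and> is_composition J \<and> comp_of w \<in> ribbon_terms I J}
     = (\<lambda>c. (comp_of (take c w), comp_of (drop c w))) ` {..length w}" (is "?A = ?B")
proof
  show "?B \<subseteq> ?A" using comp_of_cut_in by auto
  show "?A \<subseteq> ?B"
  proof clarify
    fix I J assume I: "is_composition I" and J: "is_composition J" and K: "comp_of w \<in> ribbon_terms I J"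
    consider "I = []" | "J = []" | "I \<noteq> []" "J \<noteq> []" by blast
    then show "(I, J) \<in> ?B"
    proof cases
      case 1
      then have "(I, J) = (comp_of (take 0 w), comp_of (drop 0 w))"
        using K by (simp add: ribbon_terms_def)
      then show ?thesis by blast
    next
      case 2
      then have "(I, J) = (comp_of (take (length w) w), comp_of (drop (length w) w))"
        using K by (simp add: ribbon_terms_def split: if_splits)
      then show ?thesis by blast
    next
      case 3
      then obtain u v where uv: "I = comp_aux (Suc 0) u" "J = comp_aux (Suc 0) v"
        using comp_aux_surj I J by metis
      then obtain b where b: "comp_of w = comp_aux (Suc 0) (u @ b # v)"
        using K ribbon_terms_comp_aux by auto
      then obtain b' w' where w: "w = b' # w'" by (cases w) (use comp_aux_not_Nil in \<open>simp_all, metis\<close>)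
      then have "w' = u @ b # v" using b comp_aux_inj by auto
      then have "(I, J) = (comp_of (take (Suc (length u)) w), comp_of (drop (Suc (length u)) w))"
        "Suc (length u) \<le> length w"
        by (auto simp: w uv)
      then show ?thesis by blast
    qed
  qed
qed

section \<open>Formal sums of ribbons as series of words\<close>

definition word_series :: "ncsf \<Rightarrow> wseries" where
  "word_series F = Wseries (\<lambda>w. F (comp_of w))"

lemma wcoeff_word_series [simp]: "wcoeff (word_series F) w = F (comp_of w)"
  by (simp add: word_series_def Wseries_inverse)

text \<open>Left pieces of different cuts have different size, so the sum over pairs of compositions
  is a sum over cuts without repetition.\<close>

lemma word_series_star: "word_series (F \<star> G) = word_series F * word_series G"
proof (rule wseries_eqI)
  fix w
  have "inj_on (\<lambda>c. (comp_of (take c w), comp_of (drop c w))) {..length w}"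
  proof (rule inj_onI)
    fix c c' assume "c \<in> {..length w}" "c' \<in> {..length w}"
      and "(comp_of (take c w), comp_of (drop c w)) = (comp_of (take c' w), comp_of (drop c' w))"
    then have "sum_list (comp_of (take c w)) = sum_list (comp_of (take c' w))" by simp
    then show "c = c'" using \<open>c \<in> _\<close> \<open>c' \<in> _\<close> by simp
  qed
  then show "wcoeff (word_series (F \<star> G)) w = wcoeff (word_series F * word_series G) w"
    by (simp add: star_def ribbon_cuts sum.reindex wcoeff_mult)
qed

lemma word_series_one: "word_series star_one = 1"
  by (rule wseries_eqI) (auto simp: star_one_def wcoeff_one comp_of_def split: list.splits)

lemma word_series_scaleQ: "word_series (scaleQ c F) = wconst c * word_series F"
  by (rule wseries_eqI) (simp add: scaleQ_def)

lemma word_series_diff: "word_series (F - G) = word_series F - word_series G"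
  by (rule wseries_eqI) simp

lemma word_series_add: "word_series (F + G) = word_series F + word_series G"
  by (rule wseries_eqI) simp

lemma word_series_pow: "word_series (star_pow F m) = word_series F ^ m"
  by (induction m) (simp_all add: word_series_one word_series_star)

lemma star_pow_comp_of: "star_pow F m (comp_of w) = wcoeff (word_series F ^ m) w"
  by (simp flip: word_series_pow)

lemma Sum_any_eq_sum:
  assumes "\<And>m. m > (N::nat) \<Longrightarrow> f m = 0"
  shows "Sum_any f = (\<Sum>m\<le>N. f m)"
  using assms by (intro Sum_any.expand_superset) (auto, meson not_less)

lemma word_series_exp:
  assumes "wcoeff (word_series F) [] = 0"
  shows "word_series (exp_star F) = ev (word_series F) (fps_exp 1)"
proof (rule wseries_eqI)
  fix w
  show "wcoeff (word_series (exp_star F)) w = wcoeff (ev (word_series F) (fps_exp 1)) w"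
    unfolding wcoeff_word_series exp_star_def star_pow_comp_of
    by (subst Sum_any_eq_sum[where N = "length w"])
       (use assms in \<open>auto simp: wcoeff_power_eq_0 wcoeff_ev\<close>)
qed

lemma word_series_log:
  assumes "wcoeff (word_series G) [] = 1"
  shows "word_series (log_star G) = ev (word_series G - 1) (fps_ln 1)"
proof (rule wseries_eqI)
  fix w
  show "wcoeff (word_series (log_star G)) w = wcoeff (ev (word_series G - 1) (fps_ln 1)) w"
    unfolding wcoeff_word_series log_star_def star_pow_comp_of
    by (subst Sum_any_eq_sum[where N = "length w"])
       (use assms in \<open>auto simp: wcoeff_power_eq_0 wcoeff_ev word_series_diff word_series_one fps_ln_nth
          intro!: sum.cong\<close>)
qed

text \<open>Logarithm and exponential are substituted into one series, so the claim reduces to an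
  identity between commutative power series.\<close>

lemma word_series_powr:
  assumes "wcoeff (word_series G) [] = 1"
  shows "word_series (star_powr G c) = ev (word_series G - 1) (fps_binomial c)"
proof -
  have "word_series (scaleQ c (log_star G)) = ev (word_series G - 1) (fps_const c * fps_ln 1)"
    using assms by (simp add: word_series_scaleQ word_series_log ev_const)
  then have "word_series (star_powr G c)
      = ev (ev (word_series G - 1) (fps_const c * fps_ln 1)) (fps_exp 1)"
    unfolding star_powr_def by (subst word_series_exp) auto
  also have "\<dots> = ev (word_series G - 1) (fps_exp 1 oo (fps_const c * fps_ln 1))"
    using assms by (intro ev_ev) auto
  also have "fps_exp 1 oo (fps_const c * fps_ln 1) = (fps_exp c oo fps_ln (1 :: rat))"
    by (rule fps_ext) (simp add: fps_compose_nth power_mult_distrib fps_const_power)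
  finally show ?thesis by (simp add: fps_exp_compose_ln)
qed

section \<open>Alternating products\<close>

lift_definition letter :: "bool \<Rightarrow> wseries" is "\<lambda>b w. if w = [b] then 1 else 0" .

lemma wcoeff_letter: "wcoeff (letter b) w = (if w = [b] then 1 else 0)"
  by transfer simp

lemma letter_Nil [simp]: "wcoeff (letter b) [] = 0"
  by (simp add: wcoeff_letter)

lemma wcoeff_mult_letter [simp]:
  "wcoeff (f * letter b) (w @ [d]) = (if d = b then wcoeff f w else 0)"
proof -
  have "wcoeff (f * letter b) (w @ [d])
      = (\<Sum>c\<in>{length w}. wcoeff f (take c (w @ [d])) * wcoeff (letter b) (drop c (w @ [d])))"
    unfolding wcoeff_mult
    by (rule sum.mono_neutral_right) (auto simp: wcoeff_letter drop_Cons' split: if_splits)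
  then show ?thesis by (auto simp: wcoeff_letter)
qed

text \<open>\<open>U False\<close> and \<open>U True\<close> are the images of \<open>V\<^sub>1\<^sup>+\<close> and \<open>V\<^sub>1\<^sup>-\<close>.\<close>

lift_definition U :: "bool \<Rightarrow> wseries" is "\<lambda>e w. if set (tl w) \<subseteq> {e} then 1 else 0" .

lemma wcoeff_U: "wcoeff (U e) w = (if set (tl w) \<subseteq> {e} then 1 else 0)"
  by transfer simp

lemma U_Nil [simp]: "wcoeff (U e) [] = 1"
  by (simp add: wcoeff_U)

text \<open>Closed form of \<open>U e\<close>: a word whose bits after the first are all
  \<open>e\<close> is a power of \<open>e\<close>, or \<open>\<not> e\<close> followed by such a
  power.\<close>

lemma U_mult: "U e * (1 - letter e) = 1 + letter (\<not> e)"
proof (rule wseries_eqI)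
  fix w
  show "wcoeff (U e * (1 - letter e)) w = wcoeff (1 + letter (\<not> e)) w"
  proof (cases w rule: rev_cases)
    case (snoc v d)
    have "wcoeff (U e * (1 - letter e)) w
        = wcoeff (U e) (v @ [d]) - (if d = e then wcoeff (U e) v else 0)"
      by (simp add: snoc right_diff_distrib)
    then show ?thesis
      unfolding snoc by (cases v) (auto simp: wcoeff_U wcoeff_letter wcoeff_one)
  qed (simp add: algebra_simps)
qed

lemma comp_aux_eq_single_iff: "(\<exists>i. comp_aux (Suc a) v = [i] \<and> Suc 0 \<le> i) \<longleftrightarrow> set v \<subseteq> {False}"
  by (induction v arbitrary: a) auto

lemma comp_aux_eq_replicate_iff: "(\<exists>i. comp_aux (Suc 0) v = replicate i (Suc 0)) \<longleftrightarrow> set v \<subseteq> {True}"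
proof (induction v)
  case (Cons b v)
  have "hd (comp_aux (Suc (Suc 0)) v) \<noteq> Suc 0"
    using hd_comp_aux_ge[of "Suc (Suc 0)" v] by linarith
  then have "comp_aux (Suc (Suc 0)) v \<noteq> replicate i (Suc 0)" for i
    by (cases i) (metis comp_aux_not_Nil replicate_0, metis hd_replicate nat.distinct(1))
  moreover have "(\<exists>i. Suc 0 # comp_aux (Suc 0) v = replicate i (Suc 0)) \<longleftrightarrow>
      (\<exists>i. comp_aux (Suc 0) v = replicate i (Suc 0))"
    by (metis list.sel(3) replicate_Suc tl_replicate)
  ultimately show ?case using Cons by auto
qed (auto intro: exI[of _ 1])

lemma word_series_V1: "word_series V1_plus = U False" "word_series V1_minus = U True"
proof -
  show "word_series V1_plus = U False"
  proof (rule wseries_eqI)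
    fix w
    show "wcoeff (word_series V1_plus) w = wcoeff (U False) w"
      using comp_aux_eq_single_iff[of 0]
      by (cases w) (auto simp: V1_plus_def wcoeff_U indicator_def)
  qed
  show "word_series V1_minus = U True"
  proof (rule wseries_eqI)
    fix w
    show "wcoeff (word_series V1_minus) w = wcoeff (U True) w"
      using comp_aux_eq_replicate_iff
      by (cases w) (auto simp: V1_minus_def wcoeff_U indicator_def)
  qed
qed

lift_definition grade_sgn :: "wseries \<Rightarrow> wseries" is "\<lambda>f w. (-1) ^ length w * f w" .

lemma wcoeff_grade_sgn: "wcoeff (grade_sgn f) w = (-1) ^ length w * wcoeff f w"
  by transfer simp

lemma grade_sgn_mult: "grade_sgn (f * g) = grade_sgn f * grade_sgn g"
proof (rule wseries_eqI)
  fix w :: "bool list"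
  have "(-1) ^ c * (-1) ^ (length w - c) = ((-1) ^ length w :: rat)" if "c \<le> length w" for c
    using that by (simp flip: power_add)
  then show "wcoeff (grade_sgn (f * g)) w = wcoeff (grade_sgn f * grade_sgn g) w"
    unfolding wcoeff_mult wcoeff_grade_sgn sum_distrib_left
    by (intro sum.cong) (auto simp: mult_ac min_def)
qed

text \<open>Noncommutative form of the relation between elementary and complete functions,
  \<open>E(x) H(-x) = 1\<close>. By \<open>U_mult\<close>, \<open>U e\<close> is
  \<open>(1 + letter (\<not> e)) / (1 - letter e)\<close> with the inverse on the right; the sign
  change turns the quotient for \<open>\<not> e\<close> into its inverse.\<close>

lemma U_grade_sgn_U: "U e * grade_sgn (U (\<not> e)) = 1"
proof -
  \<comment> \<open>Right multiplication by \<open>1 + letter b\<close> is injective: its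
    coefficient at \<open>w @ [d]\<close> involves, besides that of \<open>Z\<close> at
    \<open>w @ [d]\<close>, only the one at the shorter word \<open>w\<close>.\<close>
  have cancel: "Z = 0" if "Z * (1 + letter b) = 0" for Z b
  proof (rule wseries_eqI)
    fix w
    show "wcoeff Z w = wcoeff 0 w"
    proof (induction w rule: rev_induct)
      case Nil
      have "wcoeff (Z * (1 + letter b)) [] = 0" using that by simp
      then show ?case by (simp add: algebra_simps)
    next
      case (snoc d w)
      have "wcoeff (Z * (1 + letter b)) (w @ [d]) = 0" using that by simp
      then show ?case using snoc by (simp add: algebra_simps split: if_splits)
    qed
  qed
  have "grade_sgn (1 - letter (\<not> e)) = 1 + letter (\<not> e)" "grade_sgn (1 + letter e) = 1 - letter e"
    by (rule wseries_eqI, auto simp: wcoeff_grade_sgn wcoeff_letter wcoeff_one)+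
  then have "grade_sgn (U (\<not> e)) * (1 + letter (\<not> e)) = 1 - letter e"
    using grade_sgn_mult[of "U (\<not> e)" "1 - letter (\<not> e)"] U_mult[of "\<not> e"] by simp
  then have "U e * grade_sgn (U (\<not> e)) * (1 + letter (\<not> e)) = 1 + letter (\<not> e)"
    by (simp add: mult.assoc U_mult)
  then have "(U e * grade_sgn (U (\<not> e)) - 1) * (1 + letter (\<not> e)) = 0"
    by (simp add: algebra_simps)
  then show ?thesis using cancel by fastforce
qed

definition V2 :: "bool \<Rightarrow> wseries" where
  "V2 e = U e * U (\<not> e)"

lemma V2_Nil [simp]: "wcoeff (V2 e) [] = 1"
  by (simp add: V2_def)

lemma word_series_V2: "word_series V2_plus = V2 False" "word_series V2_minus = V2 True"
  by (simp_all add: V2_plus_def V2_minus_def word_series_star word_series_V1 V2_def)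

definition V2_powr :: "bool \<Rightarrow> rat \<Rightarrow> wseries" where
  "V2_powr e c = ev (V2 e - 1) (fps_binomial c)"

lemma V2_powr_Nil [simp]: "wcoeff (V2_powr e c) [] = 1"
  by (simp add: V2_powr_def)

lemma V2_powr_add: "V2_powr e (c + d) = V2_powr e c * V2_powr e d"
  by (simp add: V2_powr_def fps_binomial_add_mult ev_mult)

lemma V2_powr_of_nat: "V2_powr e (of_nat m) = V2 e ^ m"
proof -
  have "ev (V2 e - 1) (1 + fps_X) = V2 e"
    by (simp add: ev_add ev_X)
  then show ?thesis
    by (simp add: V2_powr_def fps_binomial_of_nat ev_power)
qed

definition log_V2 :: "bool \<Rightarrow> wseries" where
  "log_V2 e = ev (V2 e - 1) (fps_ln 1)"

lemma log_V2_Nil [simp]: "wcoeff (log_V2 e) [] = 0"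
  by (simp add: log_V2_def)

text \<open>\<open>IJ False\<close> collects the series \<open>I\<^sub>k\<^sup>\<plusminus>\<close> and \<open>IJ True\<close> the series \<open>J\<^sub>k\<^sup>\<plusminus>\<close>; the sign is \<open>-\<close> for
  \<open>e = True\<close>.\<close>

definition IJ :: "bool \<Rightarrow> bool \<Rightarrow> nat \<Rightarrow> wseries" where
  "IJ o' e k = (if o' then U e * V2_powr (\<not> e) (-1/2) * (wconst (1 / (2 ^ k * fact k)) * log_V2 (\<not> e) ^ k)
     else wconst (1 / (2 ^ k * fact k)) * log_V2 e ^ k)"

lemma word_series_I:
  "word_series (I_plus k) = IJ False False k" "word_series (I_minus k) = IJ False True k"
  by (simp_all add: I_plus_def I_minus_def I1_plus_def I1_minus_def word_series_scaleQ word_series_pow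
      word_series_log word_series_V2 IJ_def log_V2_def wconst_mult_power)
     (simp_all flip: mult.assoc wconst_hom add: power_one_over field_simps)

lemma word_series_J:
  "word_series (J_plus k) = IJ True False k" "word_series (J_minus k) = IJ True True k"
  using word_series_I(1)[of k] word_series_I(2)[of k]
  by (simp_all add: J_plus_def J_minus_def J0_plus_def J0_minus_def word_series_star word_series_V1
      word_series_powr word_series_V2 IJ_def V2_powr_def)

text \<open>The power \<open>x / 2\<close> of \<open>V2 e\<close> is the exponential of
  \<open>x\<close> times half its logarithm. The sum may stop at \<open>N\<close> because the
  logarithm has no constant term.\<close>

lemma I_expansion:
  assumes "length w \<le> N"
  shows "wcoeff (V2_powr e (x / 2)) w = wcoeff (\<Sum>k\<le>N. wconst (x ^ k) * (wconst (1 / (2 ^ k * fact k)) * log_V2 e ^ k)) w"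
proof -
  have "V2_powr e (x / 2) = ev (log_V2 e) (fps_exp (x / 2))"
    by (simp add: V2_powr_def log_V2_def ev_ev fps_exp_compose_ln)
  then have "wcoeff (V2_powr e (x / 2)) w = (\<Sum>k\<le>N. (x / 2) ^ k / fact k * wcoeff (log_V2 e ^ k) w)"
    using assms by (simp add: wcoeff_ev'[where N = N] wcoeff_sum)
  then show ?thesis
    by (simp add: wcoeff_sum power_divide)
qed

text \<open>The factor with exponent -1/2 inside \<open>IJ True e k\<close> absorbs the shift in
  \<open>(x - 1) / 2\<close>, so that the expansion is in powers of \<open>x\<close> and not of
  \<open>x - 1\<close>.\<close>

lemma J_expansion:
  assumes "length w \<le> N"
  shows "wcoeff (U e * V2_powr (\<not> e) ((x - 1) / 2)) w = wcoeff (\<Sum>k\<le>N. wconst (x ^ k) * IJ True e k) w"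
proof -
  define A where "A = U e * V2_powr (\<not> e) (-1/2)"
  define B where "B k = wconst (1 / (2 ^ k * fact k)) * log_V2 (\<not> e) ^ k" for k
  have "(x - 1) / 2 = -1/2 + x / 2" by (simp add: field_simps)
  then have "U e * V2_powr (\<not> e) ((x - 1) / 2) = A * V2_powr (\<not> e) (x / 2)"
    by (simp only: V2_powr_add A_def mult.assoc)
  then have "wcoeff (U e * V2_powr (\<not> e) ((x - 1) / 2)) w = wcoeff (A * V2_powr (\<not> e) (x / 2)) w"
    by simp
  also have "\<dots> = wcoeff (A * (\<Sum>k\<le>N. wconst (x ^ k) * B k)) w"
    unfolding B_def using assms by (intro wcoeff_mult_cong refl I_expansion) auto
  also have "A * (\<Sum>k\<le>N. wconst (x ^ k) * B k) = (\<Sum>k\<le>N. wconst (x ^ k) * (A * B k))"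
    unfolding sum_distrib_left by (intro sum.cong refl wconst_mult_left)
  finally show ?thesis by (simp add: IJ_def A_def B_def)
qed

section \<open>Alternating products and their polynomial dependence on the number of factors\<close>

primrec sign_prod :: "(nat \<Rightarrow> bool) \<Rightarrow> nat \<Rightarrow> wseries" where
  "sign_prod s 0 = 1"
| "sign_prod s (Suc k) = sign_prod s k * U (s k)"

definition alt :: "bool \<Rightarrow> nat \<Rightarrow> bool" where
  "alt e j \<longleftrightarrow> odd j \<noteq> e"

lemma sign_prod_alt_even: "sign_prod (alt e) (2 * m) = V2 e ^ m"
  by (induction m) (simp_all add: alt_def V2_def power_commutes mult.assoc flip: power_Suc2)

lemma sign_prod_alt_odd: "sign_prod (alt e) (Suc (2 * m)) = U e * V2 (\<not> e) ^ m"
proof -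
  have "V2 e ^ m * U e = U e * V2 (\<not> e) ^ m"
  proof (induction m)
    case (Suc m)
    have "V2 e ^ Suc m * U e = V2 e * (V2 e ^ m * U e)" by (simp add: mult.assoc)
    also have "\<dots> = U e * V2 (\<not> e) ^ Suc m" unfolding Suc by (simp add: V2_def mult.assoc)
    finally show ?case .
  qed simp
  then show ?thesis
    by (simp add: sign_prod_alt_even) (simp add: alt_def)
qed

lemma sign_prod_alt_expansion:
  assumes "length w \<le> N"
  shows "wcoeff (sign_prod (alt e) k) w = (\<Sum>j\<le>N. of_nat k ^ j * wcoeff (IJ (odd k) e j) w)"
proof (cases "even k")
  case True
  then obtain m where k: "k = 2 * m" by blast
  have "sign_prod (alt e) k = V2_powr e (of_nat k / 2)"
    unfolding k sign_prod_alt_even V2_powr_of_nat[symmetric] by simp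
  then show ?thesis
    using I_expansion[OF assms] True by (simp add: wcoeff_sum IJ_def)
next
  case False
  then obtain m where k: "k = Suc (2 * m)" by (metis oddE Suc_eq_plus1)
  have "sign_prod (alt e) k = U e * V2_powr (\<not> e) ((of_nat k - 1) / 2)"
    unfolding k sign_prod_alt_odd V2_powr_of_nat[symmetric] by simp
  then show ?thesis
    using J_expansion[OF assms] False by (simp add: wcoeff_sum)
qed

lemma power_sums_zero_imp_zero:
  fixes c :: "nat \<Rightarrow> rat"
  assumes "infinite A" "\<And>a. a \<in> A \<Longrightarrow> (\<Sum>k\<le>N. of_nat a ^ k * c k) = 0" "k \<le> N"
  shows "c k = 0"
proof -
  define p where "p = (\<Sum>k\<le>N. monom (c k) k)"
  have "poly p (of_nat a) = 0" if "a \<in> A" for a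
    using assms(2)[OF that] by (simp add: p_def poly_sum poly_monom mult.commute)
  then have "of_nat ` A \<subseteq> {x. poly p x = 0}" by auto
  moreover have "infinite (of_nat ` A :: rat set)"
    using assms(1) by (metis finite_imageD inj_of_nat inj_on_subset subset_UNIV)
  ultimately have "p = 0"
    using poly_roots_finite finite_subset by metis
  then have "coeff p k = 0" by simp
  then show ?thesis
    using assms(3) by (simp add: p_def coeff_sum)
qed

lemma infinite_parity: "infinite {a :: nat. odd a = b}"
  unfolding infinite_nat_iff_unbounded
proof
  fix m :: nat
  show "\<exists>a>m. a \<in> {a. odd a = b}"
    by (cases "odd (Suc m) = b") (auto intro: exI[of _ "Suc m"] exI[of _ "Suc (Suc m)"])
qed

section \<open>The internal product of alternating products\<close>

text \<open>Multiplying by \<open>1 - letter (s k)\<close> replaces the last factor by the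
  polynomial \<open>1 + letter (\<not> s k)\<close>; coefficients are then compared at
  \<open>w @ [d]\<close>. This recursion drives both the count of labellings and the generating
  function over \<open>k\<close>.\<close>

lemma sign_prod_snoc:
  "wcoeff (sign_prod s (Suc k)) (w @ [d]) =
     wcoeff (sign_prod s k) (w @ [d]) + wcoeff (sign_prod s (if s k = d then Suc k else k)) w"
proof -
  have "sign_prod s (Suc k) * (1 - letter (s k)) = sign_prod s k * (1 + letter (\<not> s k))"
    by (simp add: mult.assoc U_mult)
  then have "wcoeff (sign_prod s (Suc k) * (1 - letter (s k))) (w @ [d])
      = wcoeff (sign_prod s k * (1 + letter (\<not> s k))) (w @ [d])"
    by (rule arg_cong)
  then show ?thesis
    by (simp add: distrib_left right_diff_distrib del: sign_prod.simps split: if_splits)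
qed

definition descent_word :: "nat \<Rightarrow> (nat \<Rightarrow> nat) \<Rightarrow> bool list" where
  "descent_word n \<sigma> = map (\<lambda>i. \<sigma> (Suc i) < \<sigma> i) [0..<n]"

lemma length_descent_word [simp]: "length (descent_word n \<sigma>) = n"
  by (simp add: descent_word_def)

text \<open>The label \<open>g i\<close> is the index of the factor that contributes position
  \<open>i\<close>. The bit \<open>d 0\<close> is never consulted, in accordance with the ignored
  first bit of words.\<close>

definition admissible :: "(nat \<Rightarrow> bool) \<Rightarrow> (nat \<Rightarrow> bool) \<Rightarrow> nat \<Rightarrow> nat \<Rightarrow> (nat \<Rightarrow> nat) set" where
  "admissible s d k n = {g \<in> {1..n} \<rightarrow>\<^sub>E {..<k}.
     \<forall>i. 1 \<le> i \<and> i < n \<longrightarrow> g i < g (Suc i) \<or> g i = g (Suc i) \<and> s (g i) = d i}"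

lemma finite_admissible: "finite (admissible s d k n)"
  by (rule finite_subset[of _ "{1..n} \<rightarrow>\<^sub>E {..<k}"]) (auto simp: admissible_def intro: finite_PiE)

lemma admissible_mono:
  assumes "g \<in> admissible s d k n" "1 \<le> i" "i \<le> j" "j \<le> n"
  shows "g i \<le> g j"
  using assms(3,4)
proof (induction j rule: dec_induct)
  case (step j)
  then have "g j \<le> g (Suc j)"
    using assms(1,2) unfolding admissible_def by (auto dest!: spec[of _ j])
  with step show ?case by simp
qed simp

text \<open>Before a last label \<open>k\<close>, the label of \<open>n\<close> may equal
  \<open>k\<close> exactly when the sign of \<open>k\<close> agrees with \<open>d n\<close>. By
  monotonicity this bounds all earlier labels, by \<open>Suc k\<close> or by
  \<open>k\<close>.\<close>

lemma admissible_last: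
  assumes "n > 0"
  shows "bij_betw (\<lambda>g. g(Suc n := k)) (admissible s d (if s k = d n then Suc k else k) n)
     {g \<in> admissible s d (Suc k) (Suc n). g (Suc n) = k}"
proof (rule bij_betw_byWitness[where f' = "\<lambda>g. g(Suc n := undefined)"])
  let ?K = "if s k = d n then Suc k else k"
  show "\<forall>g\<in>admissible s d ?K n. (g(Suc n := k))(Suc n := undefined) = g"
    by (auto simp: admissible_def PiE_def extensional_def fun_eq_iff)
  show "\<forall>g\<in>{g \<in> admissible s d (Suc k) (Suc n). g (Suc n) = k}. (g(Suc n := undefined))(Suc n := k) = g"
    by auto
  show "(\<lambda>g. g(Suc n := k)) ` admissible s d ?K n \<subseteq> {g \<in> admissible s d (Suc k) (Suc n). g (Suc n) = k}"
  proof clarify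
    fix g assume g: "g \<in> admissible s d ?K n"
    then have lt: "g i < ?K" if "1 \<le> i" "i \<le> n" for i
      using that unfolding admissible_def PiE_def Pi_def by auto
    have "g i < Suc k" if "1 \<le> i" "i \<le> n" for i
      using lt[OF that] by (auto split: if_splits)
    then have "g(Suc n := k) \<in> {1..Suc n} \<rightarrow>\<^sub>E {..<Suc k}"
      using g unfolding admissible_def PiE_def extensional_def by auto
    moreover have "(g(Suc n := k)) i < (g(Suc n := k)) (Suc i) \<or>
        (g(Suc n := k)) i = (g(Suc n := k)) (Suc i) \<and> s ((g(Suc n := k)) i) = d i"
      if "1 \<le> i" "i < Suc n" for i
    proof (cases "i = n")
      case True
      then show ?thesis using lt[of n] that by (auto simp: less_Suc_eq split: if_splits)
    next
      case False
      then show ?thesis using g that unfolding admissible_def by auto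
    qed
    ultimately show "g(Suc n := k) \<in> admissible s d (Suc k) (Suc n) \<and> (g(Suc n := k)) (Suc n) = k"
      unfolding admissible_def by auto
  qed
  show "(\<lambda>g. g(Suc n := undefined)) ` {g \<in> admissible s d (Suc k) (Suc n). g (Suc n) = k}
      \<subseteq> admissible s d ?K n"
  proof (rule image_subsetI)
    fix g assume "g \<in> {g \<in> admissible s d (Suc k) (Suc n). g (Suc n) = k}"
    then have g: "g \<in> admissible s d (Suc k) (Suc n)" and k: "g (Suc n) = k" by auto
    have adj: "g i < g (Suc i) \<or> g i = g (Suc i) \<and> s (g i) = d i" if "1 \<le> i" "i < Suc n" for i
      using g that unfolding admissible_def by auto
    have "g n < ?K" using adj[of n] assms k by auto
    then have "g i < ?K" if "1 \<le> i" "i \<le> n" for i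
      using admissible_mono[OF g that] by auto
    then have "g(Suc n := undefined) \<in> {1..n} \<rightarrow>\<^sub>E {..<?K}"
      using g unfolding admissible_def PiE_def extensional_def by auto
    then show "g(Suc n := undefined) \<in> admissible s d ?K n"
      using adj unfolding admissible_def by auto
  qed
qed

text \<open>Splitting by whether the last, hence largest, label is \<open>k\<close> reproduces the
  recursion \<open>sign_prod_snoc\<close>.\<close>

lemma card_admissible:
  "of_nat (card (admissible s d k n)) = wcoeff (sign_prod s k) (map d [0..<n])"
proof (induction n arbitrary: k)
  case 0
  have "wcoeff (sign_prod s k) [] = 1" by (induction k) auto
  then show ?case by (simp add: admissible_def)
next
  case (Suc n)
  note IH = Suc
  show ?case
  proof (induction k)
    case 0
    have "admissible s d 0 (Suc n) = {}"
      by (auto simp: admissible_def)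
    then show ?case by (simp add: wcoeff_one)
  next
    case (Suc k)
    let ?L = "{g \<in> admissible s d (Suc k) (Suc n). g (Suc n) = k}"
    have split: "admissible s d (Suc k) (Suc n) = admissible s d k (Suc n) \<union> ?L"
    proof (intro equalityI subsetI)
      fix g assume g: "g \<in> admissible s d (Suc k) (Suc n)"
      show "g \<in> admissible s d k (Suc n) \<union> ?L"
      proof (cases "g (Suc n) = k")
        case False
        have "g (Suc n) < Suc k" using g unfolding admissible_def by auto
        with False have "g (Suc n) < k" by simp
        then have "g i < k" if "1 \<le> i" "i \<le> Suc n" for i
          using admissible_mono[OF g that] by auto
        then show ?thesis using g unfolding admissible_def PiE_def by auto
      qed (use g in auto)
    next
      fix g assume "g \<in> admissible s d k (Suc n) \<union> ?L"
      then show "g \<in> admissible s d (Suc k) (Suc n)"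
        unfolding admissible_def PiE_def Pi_def by (auto intro: less_SucI)
    qed
    have disj: "admissible s d k (Suc n) \<inter> ?L = {}"
      unfolding admissible_def PiE_def Pi_def by auto
    have L: "of_nat (card ?L) = wcoeff (sign_prod s (if s k = d n then Suc k else k)) (map d [0..<n])"
    proof (cases "n = 0")
      case True
      have "?L = {\<lambda>i. if i = Suc 0 then k else undefined}"
        unfolding True admissible_def PiE_def extensional_def by (auto simp: fun_eq_iff)
      moreover have "wcoeff (sign_prod s m) [] = 1" for m by (induction m) auto
      ultimately show ?thesis using True by (simp del: sign_prod.simps)
    next
      case False
      then show ?thesis
        unfolding IH[symmetric] using bij_betw_same_card[OF admissible_last[of n k s d]] by simp
    qed
    have "of_nat (card (admissible s d (Suc k) (Suc n)))
        = (of_nat (card (admissible s d k (Suc n))) + of_nat (card ?L) :: rat)"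
      by (subst split, subst card_Un_disjoint) (auto simp: finite_admissible disj simp del: Collect_conj_eq)
    also have "\<dots> = wcoeff (sign_prod s (Suc k)) (map d [0..<Suc n])"
      unfolding Suc L upt_Suc_append[OF le0] map_append list.map sign_prod_snoc by simp
    finally show ?case .
  qed
qed

text \<open>
  A pair of a permutation \<open>\<sigma>\<close> and an admissible labelling of its positions is the same as a word
  \<open>f\<close>: \<open>\<sigma>\<close> lists the positions of \<open>f\<close> by increasing letter, where positions carrying equal letters
  are listed upwards or downwards according to the sign of the letter.
\<close>

definition prec :: "(nat \<Rightarrow> bool) \<Rightarrow> (nat \<Rightarrow> nat) \<Rightarrow> nat \<Rightarrow> nat \<Rightarrow> bool" where
  "prec s f x y \<longleftrightarrow> f x < f y \<or> f x = f y \<and> (if s (f x) then y < x else x < y)"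

definition sorts :: "nat \<Rightarrow> (nat \<Rightarrow> bool) \<Rightarrow> (nat \<Rightarrow> nat) \<Rightarrow> (nat \<Rightarrow> nat) \<Rightarrow> bool" where
  "sorts n s f \<sigma> \<longleftrightarrow> (\<forall>i j. 1 \<le> i \<and> i < j \<and> j \<le> n \<longrightarrow> prec s f (\<sigma> i) (\<sigma> j))"

lemma prec_trans:
  assumes "prec s f x y" "prec s f y z"
  shows "prec s f x z"
proof -
  consider "f x < f y" | "f y < f z" | "f x = f y" "f y = f z"
    using assms unfolding prec_def by linarith
  then show ?thesis
  proof cases
    case 3
    then show ?thesis using assms unfolding prec_def by (cases "s (f z)") simp_all
  qed (use assms in \<open>unfold prec_def, linarith\<close>)+
qed

lemma prec_asym: "prec s f x y \<Longrightarrow> \<not> prec s f y x"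
  using prec_trans[of s f x y x] by (auto simp: prec_def[of s f x x])

lemma prec_total: "x \<noteq> y \<Longrightarrow> prec s f x y \<or> prec s f y x"
  unfolding prec_def by (metis linorder_neqE_nat)

lemma sorts_iff_adjacent:
  "sorts n s f \<sigma> \<longleftrightarrow> (\<forall>i. 1 \<le> i \<and> i < n \<longrightarrow> prec s f (\<sigma> i) (\<sigma> (Suc i)))"
proof
  assume adj: "\<forall>i. 1 \<le> i \<and> i < n \<longrightarrow> prec s f (\<sigma> i) (\<sigma> (Suc i))"
  have "prec s f (\<sigma> i) (\<sigma> j)" if "1 \<le> i" "i < j" "j \<le> n" for i j
    using that(2,3)
  proof (induction j)
    case (Suc j)
    then show ?case
      using adj that(1) prec_trans[of s f "\<sigma> i" "\<sigma> j" "\<sigma> (Suc j)"] by (cases "i = j") auto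
  qed simp
  then show "sorts n s f \<sigma>" by (simp add: sorts_def)
qed (simp add: sorts_def)

lemma sorts_less_iff:
  assumes "sorts n s f \<sigma>" "i \<in> {1..n}" "j \<in> {1..n}"
  shows "i < j \<longleftrightarrow> prec s f (\<sigma> i) (\<sigma> j)"
proof -
  have "prec s f (\<sigma> a) (\<sigma> b)" if "a < b" "a \<in> {1..n}" "b \<in> {1..n}" for a b
    using assms(1) that by (auto simp: sorts_def)
  moreover have "\<not> prec s f x x" for x by (simp add: prec_def)
  ultimately show ?thesis
    using assms(2,3) prec_asym linorder_neqE_nat by metis
qed

lemma card_sorts:
  assumes \<sigma>: "\<sigma> permutes {1..n}"
  shows "of_nat (card {f \<in> {1..n} \<rightarrow>\<^sub>E {..<k}. sorts n s f \<sigma>}) = wcoeff (sign_prod s k) (descent_word n \<sigma>)"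
proof -
  let ?d = "\<lambda>i. \<sigma> (Suc i) < \<sigma> i"
  have in_iff: "\<sigma> i \<in> {1..n} \<longleftrightarrow> i \<in> {1..n}" "inv \<sigma> i \<in> {1..n} \<longleftrightarrow> i \<in> {1..n}" for i
    using permutes_in_image[OF \<sigma>] permutes_in_image[OF permutes_inv[OF \<sigma>]] by auto
  have inv: "\<sigma> (inv \<sigma> i) = i" "inv \<sigma> (\<sigma> i) = i" for i
    using permutes_inverses[OF \<sigma>] by auto
  have adj: "prec s f (\<sigma> i) (\<sigma> (Suc i)) \<longleftrightarrow>
      f (\<sigma> i) < f (\<sigma> (Suc i)) \<or> f (\<sigma> i) = f (\<sigma> (Suc i)) \<and> s (f (\<sigma> i)) = ?d i" for f i
  proof -
    have "\<sigma> i \<noteq> \<sigma> (Suc i)" using permutes_inj[OF \<sigma>] by (metis injD n_not_Suc_n)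
    then show ?thesis unfolding prec_def by (metis linorder_neqE_nat less_asym)
  qed
  have "bij_betw (\<lambda>f. restrict (f \<circ> \<sigma>) {1..n}) {f \<in> {1..n} \<rightarrow>\<^sub>E {..<k}. sorts n s f \<sigma>} (admissible s ?d k n)"
  proof (rule bij_betw_byWitness[where f' = "\<lambda>g. restrict (g \<circ> inv \<sigma>) {1..n}"])
    show "(\<lambda>f. restrict (f \<circ> \<sigma>) {1..n}) ` {f \<in> {1..n} \<rightarrow>\<^sub>E {..<k}. sorts n s f \<sigma>} \<subseteq> admissible s ?d k n"
    proof (rule image_subsetI)
      fix f assume f: "f \<in> {f \<in> {1..n} \<rightarrow>\<^sub>E {..<k}. sorts n s f \<sigma>}"
      have "restrict (f \<circ> \<sigma>) {1..n} \<in> {1..n} \<rightarrow>\<^sub>E {..<k}"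
        using f in_iff(1) by (auto simp: PiE_iff)
      then show "restrict (f \<circ> \<sigma>) {1..n} \<in> admissible s ?d k n"
        using f by (simp add: admissible_def sorts_iff_adjacent adj)
    qed
    show "(\<lambda>g. restrict (g \<circ> inv \<sigma>) {1..n}) ` admissible s ?d k n \<subseteq> {f \<in> {1..n} \<rightarrow>\<^sub>E {..<k}. sorts n s f \<sigma>}"
    proof (rule image_subsetI)
      fix g assume g: "g \<in> admissible s ?d k n"
      define f where "f = restrict (g \<circ> inv \<sigma>) {1..n}"
      have "f \<in> {1..n} \<rightarrow>\<^sub>E {..<k}"
        using g in_iff(2) unfolding f_def admissible_def by (auto simp: PiE_iff)
      moreover have "f (\<sigma> i) = g i" if "i \<in> {1..n}" for i
        using in_iff(1)[of i] that unfolding f_def by (simp only: restrict_apply' o_apply inv)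
      then have "sorts n s f \<sigma>"
        using g by (simp add: admissible_def sorts_iff_adjacent adj)
      ultimately show "f \<in> {f \<in> {1..n} \<rightarrow>\<^sub>E {..<k}. sorts n s f \<sigma>}" by simp
    qed
  qed (use in_iff in \<open>auto simp: fun_eq_iff inv PiE_def extensional_def admissible_def restrict_def\<close>)
  then have "card {f \<in> {1..n} \<rightarrow>\<^sub>E {..<k}. sorts n s f \<sigma>} = card (admissible s ?d k n)"
    by (rule bij_betw_same_card)
  then show ?thesis
    by (simp add: card_admissible descent_word_def)
qed

text \<open>\<open>prec s f\<close> is a strict total order on the positions, and the sorting
  permutation is the inverse of the rank function of this order.\<close>

lemma ex1_sorting_permutation: "\<exists>!\<sigma>. \<sigma> permutes {1..n} \<and> sorts n s f \<sigma>"
proof -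
  \<comment> \<open>This set contains \<open>x\<close> itself, so that ranks run from 1 to
    \<open>n\<close>.\<close>
  define before where "before x = {y \<in> {1..n}. \<not> prec s f x y}" for x
  define rank where "rank x = (if x \<in> {1..n} then card (before x) else x)" for x
  have irrefl: "\<not> prec s f x x" for x by (simp add: prec_def)
  have fin: "finite (before x)" for x by (simp add: before_def)
  have mono: "rank x < rank y" if "prec s f x y" "x \<in> {1..n}" "y \<in> {1..n}" for x y
  proof -
    have "before x \<subset> before y"
      using that irrefl[of y] prec_trans[of s f x y] unfolding before_def by blast
    then show ?thesis using that fin by (simp add: rank_def psubset_card_mono)
  qed
  have inj: "inj_on rank {1..n}"
    by (rule inj_onI) (metis mono prec_total less_irrefl)
  have "rank x \<in> {1..n}" if x: "x \<in> {1..n}" for x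
  proof -
    have "card (before x) \<le> card {1..n}" by (rule card_mono) (auto simp: before_def)
    moreover have "x \<in> before x" using x irrefl by (simp add: before_def)
    then have "card (before x) \<noteq> 0" using fin by auto
    ultimately show ?thesis using x by (simp add: rank_def)
  qed
  then have "rank ` {1..n} = {1..n}"
    using inj by (intro endo_inj_surj) auto
  then have rank: "rank permutes {1..n}"
    using inj by (intro bij_imp_permutes) (auto simp: bij_betw_def rank_def)
  note in_iff = permutes_in_image[OF permutes_inv[OF rank]]
  have "sorts n s f (inv rank)"
    unfolding sorts_def
  proof (intro allI impI)
    fix i j assume ij: "1 \<le> i \<and> i < j \<and> j \<le> n"
    then have "inv rank i \<in> {1..n}" "inv rank j \<in> {1..n}" using in_iff by auto
    moreover have "rank (inv rank i) = i" "rank (inv rank j) = j"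
      using permutes_inverses[OF rank] by auto
    ultimately show "prec s f (inv rank i) (inv rank j)"
      using ij mono[of "inv rank j" "inv rank i"] prec_total[of "inv rank i" "inv rank j" s f]
      by (cases "inv rank i = inv rank j") auto
  qed
  moreover have "\<sigma> = inv rank" if \<sigma>: "\<sigma> permutes {1..n}" and sorts: "sorts n s f \<sigma>" for \<sigma>
  proof
    fix i
    show "\<sigma> i = inv rank i"
    proof (cases "i \<in> {1..n}")
      case True
      have "before (\<sigma> i) = \<sigma> ` {1..i}"
      proof (intro equalityI subsetI)
        fix y assume y: "y \<in> before (\<sigma> i)"
        then obtain j where j: "j \<in> {1..n}" "y = \<sigma> j"
          using permutes_image[OF \<sigma>] unfolding before_def by blast
        with y sorts_less_iff[OF sorts True j(1)] have "j \<le> i" by (auto simp: before_def)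
        with j show "y \<in> \<sigma> ` {1..i}" by auto
      next
        fix y assume "y \<in> \<sigma> ` {1..i}"
        then obtain j where j: "j \<in> {1..i}" "y = \<sigma> j" by blast
        with True have "j \<in> {1..n}" by auto
        with j sorts_less_iff[OF sorts True this] permutes_in_image[OF \<sigma>]
        show "y \<in> before (\<sigma> i)" by (auto simp: before_def)
      qed
      moreover have "card (\<sigma> ` {1..i}) = i"
        using permutes_inj[OF \<sigma>] by (simp add: card_image inj_on_subset)
      ultimately have "rank (\<sigma> i) = i"
        using True permutes_in_image[OF \<sigma>, of i] by (simp add: rank_def)
      then show ?thesis using permutes_inverses(2)[OF rank] by metis
    next
      case False
      then show ?thesis
        using permutes_not_in[OF \<sigma>] permutes_not_in[OF permutes_inv[OF rank]] by simp
    qed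
  qed
  ultimately show ?thesis using permutes_inv[OF rank] by blast
qed

text \<open>The first bit of the descent word compares with position 0 and is arbitrary; this is
  harmless because the series in question do not depend on it.\<close>

definition to_galg :: "nat \<Rightarrow> wseries \<Rightarrow> galg" where
  "to_galg n f = (\<lambda>\<sigma>. if \<sigma> permutes {1..n} then wcoeff f (descent_word n \<sigma>) else 0)"

lemma gmult_permutes:
  assumes \<sigma>: "\<sigma> permutes {1..n}"
  shows "gmult n f g \<sigma> = (\<Sum>\<alpha> | \<alpha> permutes {1..n}. f \<alpha> * g (inv \<alpha> \<circ> \<sigma>))"
proof -
  have 1: "inv \<alpha> \<circ> (\<alpha> \<circ> \<beta>) = \<beta>" "\<alpha> \<circ> (inv \<alpha> \<circ> \<beta>) = \<beta>" if "\<alpha> permutes {1..n}" for \<alpha> \<beta>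
    using permutes_inv_o[OF that] by (simp_all flip: comp_assoc)
  show ?thesis
    unfolding gmult_def
    by (rule sum.reindex_bij_witness[where i = "\<lambda>\<alpha>. (\<alpha>, inv \<alpha> \<circ> \<sigma>)" and j = fst])
       (use \<sigma> in \<open>auto simp: 1 permutes_compose permutes_inv\<close>)
qed

lemma gmult_not_permutes: "\<not> \<sigma> permutes {1..n} \<Longrightarrow> gmult n f g \<sigma> = 0"
  unfolding gmult_def by (rule sum.neutral) (use permutes_compose in blast)


text \<open>Let \<alpha> sort \<open>f\<close>, let \<beta> sort \<open>g\<close>, and let \<sigma>
  be \<open>\<alpha> \<circ> \<beta>\<close>. Then \<sigma> lists the positions \<open>x\<close> by
  the letter of \<open>g\<close> at \<open>inv \<alpha> x\<close>, and ties follow the order of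
  \<alpha> or its reverse, that is, the order given by \<open>f\<close> or its reverse. So \<sigma>
  sorts one word in \<open>a * b\<close> letters, made of blocks of size \<open>a\<close> indexed by
  the letters \<open>p\<close> of \<open>g\<close>; where \<open>T p\<close> holds, the block is
  reversed and the signs in it are flipped.\<close>

lemma gmult_sign_prod:
  assumes a: "a > 0"
    and R: "\<And>p q. p < b \<Longrightarrow> q < a \<Longrightarrow> R (a * p + (if T p then a - 1 - q else q)) = (T p \<noteq> S q)"
  shows "gmult n (to_galg n (sign_prod S a)) (to_galg n (sign_prod T b)) = to_galg n (sign_prod R (a * b))"
proof
  fix \<sigma>
  show "gmult n (to_galg n (sign_prod S a)) (to_galg n (sign_prod T b)) \<sigma> = to_galg n (sign_prod R (a * b)) \<sigma>"
  proof (cases "\<sigma> permutes {1..n}")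
    case False
    then show ?thesis by (simp add: gmult_not_permutes to_galg_def)
  next
    case \<sigma>: True
    define X where "X = {\<alpha>. \<alpha> permutes {1..n}}"
    define A where "A \<alpha> = {f \<in> {1..n} \<rightarrow>\<^sub>E {..<a}. sorts n S f \<alpha>}" for \<alpha>
    define B where "B \<alpha> = {g \<in> {1..n} \<rightarrow>\<^sub>E {..<b}. sorts n T g (inv \<alpha> \<circ> \<sigma>)}" for \<alpha>
    define Y where "Y = {u \<in> {1..n} \<rightarrow>\<^sub>E {..<a * b}. sorts n R u \<sigma>}"
    define h where "h p q = (if T p then a - 1 - q else q)" for p q
    define \<Phi> where "\<Phi> = (\<lambda>(\<alpha> :: nat \<Rightarrow> nat, f :: nat \<Rightarrow> nat, g :: nat \<Rightarrow> nat). \<lambda>x\<in>{1..n}. a * g (inv \<alpha> x) + h (g (inv \<alpha> x)) (f x))"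
    \<comment> \<open>Decoding of a word \<open>u\<close>: its low digit, un-reversed within the
      block, gives \<open>f\<close>, whose unique sorting permutation is \<alpha>. Only then can the
      high digit be read as a word \<open>g\<close>, since \<open>g\<close> is indexed by places in
      the order of \<alpha>.\<close>
    define sp where "sp f = (THE \<alpha>. \<alpha> permutes {1..n} \<and> sorts n S f \<alpha>)" for f
    define fp where "fp u = (\<lambda>x\<in>{1..n}. h (u x div a) (u x mod a))" for u :: "nat \<Rightarrow> nat"
    define gp where "gp u = (\<lambda>i\<in>{1..n}. u (sp (fp u) i) div a)" for u
    define \<Psi> where "\<Psi> u = (sp (fp u), fp u, gp u)" for u
    have fin: "finite (A \<alpha>)" "finite (B \<alpha>)" "finite X" for \<alpha>
      unfolding A_def B_def X_def by (simp_all add: finite_PiE finite_permutations)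
    have sp: "sp f permutes {1..n}" "sorts n S f (sp f)" for f
      using theI'[OF ex1_sorting_permutation[of n S f]] unfolding sp_def by auto
    have sp_eq: "sp f = \<alpha>" if "\<alpha> permutes {1..n}" "sorts n S f \<alpha>" for f \<alpha>
      unfolding sp_def using ex1_sorting_permutation[of n S f] that by (intro the1_equality) auto
    have h_lt: "h p q < a" if "q < a" for p q
      using that by (auto simp: h_def)
    have h_h: "h p (h p q) = q" if "q < a" for p q :: nat
      using that by (auto simp: h_def)
    have h_less: "h p q < h p q' \<longleftrightarrow> (if T p then q' < q else q < q')" if "q < a" "q' < a" for p q q'
      using that by (auto simp: h_def)
    \<comment> \<open>Comparing \<open>x\<close> and \<open>y\<close> by the combined word is the
      same as comparing their places under \<alpha> by \<open>g\<close>.\<close>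
    have key: "sorts n R u \<sigma> \<longleftrightarrow> sorts n T g (inv \<alpha> \<circ> \<sigma>)"
      if \<alpha>: "\<alpha> permutes {1..n}" "sorts n S f \<alpha>"
        and f: "\<And>x. x \<in> {1..n} \<Longrightarrow> f x < a" and g: "\<And>x. x \<in> {1..n} \<Longrightarrow> g (inv \<alpha> x) < b"
        and u: "\<And>x. x \<in> {1..n} \<Longrightarrow> u x = a * g (inv \<alpha> x) + h (g (inv \<alpha> x)) (f x)"
      for \<alpha> f g u
    proof -
      have "prec R u x y \<longleftrightarrow> prec T g (inv \<alpha> x) (inv \<alpha> y)"
        if xy: "x \<in> {1..n}" "y \<in> {1..n}" for x y
      proof -
        define p p' where "p = g (inv \<alpha> x)" and "p' = g (inv \<alpha> y)"
        have ux: "u x = a * p + h p (f x)" and uy: "u y = a * p' + h p' (f y)"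
          using u xy by (simp_all add: p_def p'_def)
        have lt: "f x < a" "f y < a" "p < b" "p' < b"
          using f g xy by (auto simp: p_def p'_def)
        have inv_in: "inv \<alpha> x \<in> {1..n}" "inv \<alpha> y \<in> {1..n}"
          using permutes_in_image[OF permutes_inv[OF \<alpha>(1)]] xy by auto
        have less: "inv \<alpha> x < inv \<alpha> y \<longleftrightarrow> prec S f x y" "inv \<alpha> y < inv \<alpha> x \<longleftrightarrow> prec S f y x"
          using sorts_less_iff[OF \<alpha>(2) inv_in] sorts_less_iff[OF \<alpha>(2) inv_in(2) inv_in(1)]
            permutes_inverses(1)[OF \<alpha>(1)] by auto
        have div: "u x div a = p" "u y div a = p'"
          using a h_lt[OF lt(1), of p] h_lt[OF lt(2), of p'] by (simp_all add: ux uy)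
        consider "p < p'" | "p' < p" | "p = p'" by linarith
        then show ?thesis
        proof cases
          case 1
          then have "u x < u y" using div by (metis div_le_mono not_less)
          then show ?thesis using 1 by (simp add: prec_def p_def p'_def)
        next
          case 2
          then have "u y < u x" using div by (metis div_le_mono not_less)
          then show ?thesis using 2 by (simp add: prec_def p_def p'_def)
        next
          case 3
          have "u x < u y \<longleftrightarrow> (if T p then f y < f x else f x < f y)"
            using h_less[OF lt(1,2)] by (simp add: ux uy 3)
          moreover have "u x = u y \<longleftrightarrow> f x = f y"
            using h_h[OF lt(1)] h_h[OF lt(2)] by (auto simp: ux uy 3) metis
          moreover have "R (u x) = (T p \<noteq> S (f x))"
            using R[OF lt(3,1)] by (simp add: ux h_def)
          moreover have "prec T g (inv \<alpha> x) (inv \<alpha> y) \<longleftrightarrow> (if T p then prec S f y x else prec S f x y)"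
            unfolding prec_def[of T] using 3 less by (simp add: p_def p'_def)
          ultimately show ?thesis
            unfolding prec_def[of R] prec_def[of S] by (smt (verit))
        qed
      qed
      moreover have "\<sigma> i \<in> {1..n}" if "i \<in> {1..n}" for i
        using that permutes_in_image[OF \<sigma>] by simp
      ultimately show ?thesis by (auto simp: sorts_def)
    qed
    have bij: "bij_betw \<Phi> (Sigma X (\<lambda>\<alpha>. A \<alpha> \<times> B \<alpha>)) Y"
    proof (rule bij_betw_byWitness[where f' = \<Psi>])
      have \<Phi>: "\<Phi> (\<alpha>, f, g) \<in> Y \<and> \<Psi> (\<Phi> (\<alpha>, f, g)) = (\<alpha>, f, g)"
        if \<alpha>: "\<alpha> permutes {1..n}" and f: "f \<in> A \<alpha>" and g: "g \<in> B \<alpha>" for \<alpha> f g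
      proof -
        define u where "u = \<Phi> (\<alpha>, f, g)"
        have inv_in: "inv \<alpha> x \<in> {1..n}" if "x \<in> {1..n}" for x
          using permutes_in_image[OF permutes_inv[OF \<alpha>]] that by auto
        have f_lt: "f x < a" if "x \<in> {1..n}" for x
          using f that by (auto simp: A_def)
        have g_lt: "g x < b" if "x \<in> {1..n}" for x
          using g that by (auto simp: B_def)
        have u: "u x = a * g (inv \<alpha> x) + h (g (inv \<alpha> x)) (f x)" if "x \<in> {1..n}" for x
          using that by (simp add: u_def \<Phi>_def)
        have dm: "u x div a = g (inv \<alpha> x)" "u x mod a = h (g (inv \<alpha> x)) (f x)" if "x \<in> {1..n}" for x
          using a h_lt[OF f_lt[OF that]] by (simp_all add: u[OF that])
        have "u x < a * b" if "x \<in> {1..n}" for x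
          using dm(1)[OF that] g_lt[OF inv_in[OF that]] a
          by (metis div_less_iff_less_mult mult.commute)
        then have "u \<in> {1..n} \<rightarrow>\<^sub>E {..<a * b}"
          by (auto simp: u_def \<Phi>_def)
        moreover have "sorts n R u \<sigma>"
          using key[of \<alpha> f g u] \<alpha> f g f_lt g_lt inv_in u by (simp add: A_def B_def)
        ultimately have "u \<in> Y" by (simp add: Y_def)
        have "fp u = f"
        proof
          fix x show "fp u x = f x"
            using f h_h[OF f_lt] dm[of x] by (cases "x \<in> {1..n}") (auto simp: fp_def A_def PiE_def extensional_def)
        qed
        then have sp_u: "sp (fp u) = \<alpha>"
          using sp_eq \<alpha> f by (simp add: A_def)
        have "gp u = g"
        proof
          fix x show "gp u x = g x"
            using g dm(1)[of "\<alpha> x"] permutes_in_image[OF \<alpha>, of x] permutes_inverses(2)[OF \<alpha>]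
            by (cases "x \<in> {1..n}") (auto simp: gp_def sp_u B_def PiE_def extensional_def)
        qed
        with \<open>u \<in> Y\<close> sp_u \<open>fp u = f\<close> show ?thesis by (simp add: \<Psi>_def u_def)
      qed
      have \<Psi>: "\<Psi> u \<in> Sigma X (\<lambda>\<alpha>. A \<alpha> \<times> B \<alpha>) \<and> \<Phi> (\<Psi> u) = u" if u: "u \<in> Y" for u
      proof -
        define \<alpha> where "\<alpha> = sp (fp u)"
        note \<alpha> = sp[of "fp u", folded \<alpha>_def]
        have inv_in: "inv \<alpha> x \<in> {1..n}" if "x \<in> {1..n}" for x
          using permutes_in_image[OF permutes_inv[OF \<alpha>(1)]] that by auto
        have u_lt: "u x < a * b" if "x \<in> {1..n}" for x
          using u that by (auto simp: Y_def)
        have f_lt: "fp u x < a" if "x \<in> {1..n}" for x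
          using that a by (simp add: fp_def h_lt)
        have gp: "gp u (inv \<alpha> x) = u x div a" if "x \<in> {1..n}" for x
          using inv_in[OF that] permutes_inverses(1)[OF \<alpha>(1)] by (simp add: gp_def \<alpha>_def)
        have g_lt: "gp u i < b" if "i \<in> {1..n}" for i
        proof -
          have "\<alpha> i \<in> {1..n}" using permutes_in_image[OF \<alpha>(1)] that by auto
          then show ?thesis
            using u_lt[of "\<alpha> i"] that a by (simp add: gp_def flip: \<alpha>_def) (simp add: less_mult_imp_div_less mult.commute)
        qed
        have u_eq: "u x = a * gp u (inv \<alpha> x) + h (gp u (inv \<alpha> x)) (fp u x)" if "x \<in> {1..n}" for x
          using that a by (simp add: gp fp_def h_h)
        have "sorts n T (gp u) (inv \<alpha> \<circ> \<sigma>)"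
          using key[of \<alpha> "fp u" "gp u" u] \<alpha> f_lt g_lt inv_in u_eq u by (simp add: Y_def)
        moreover have "fp u \<in> {1..n} \<rightarrow>\<^sub>E {..<a}" "gp u \<in> {1..n} \<rightarrow>\<^sub>E {..<b}"
          using f_lt g_lt by (auto simp: fp_def gp_def)
        ultimately have "\<Psi> u \<in> Sigma X (\<lambda>\<alpha>. A \<alpha> \<times> B \<alpha>)"
          using \<alpha> by (simp add: \<Psi>_def X_def A_def B_def \<alpha>_def)
        moreover have "\<Phi> (\<Psi> u) = u"
        proof
          fix x show "\<Phi> (\<Psi> u) x = u x"
            using u_eq[of x] u
            by (cases "x \<in> {1..n}") (auto simp: \<Phi>_def \<Psi>_def Y_def PiE_def extensional_def simp flip: \<alpha>_def)
        qed
        ultimately show ?thesis by blast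
      qed
      show "\<forall>z\<in>Sigma X (\<lambda>\<alpha>. A \<alpha> \<times> B \<alpha>). \<Psi> (\<Phi> z) = z" "\<Phi> ` Sigma X (\<lambda>\<alpha>. A \<alpha> \<times> B \<alpha>) \<subseteq> Y"
        using \<Phi> by (auto simp: X_def)
      show "\<forall>u\<in>Y. \<Phi> (\<Psi> u) = u" "\<Psi> ` Y \<subseteq> Sigma X (\<lambda>\<alpha>. A \<alpha> \<times> B \<alpha>)"
        using \<Psi> by blast+
    qed
    have "gmult n (to_galg n (sign_prod S a)) (to_galg n (sign_prod T b)) \<sigma>
        = (\<Sum>\<alpha>\<in>X. of_nat (card (A \<alpha>)) * of_nat (card (B \<alpha>)))"
      unfolding gmult_permutes[OF \<sigma>] X_def A_def B_def
    proof (rule sum.cong[OF refl])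
      fix \<alpha> assume "\<alpha> \<in> {\<alpha>. \<alpha> permutes {1..n}}"
      then have \<alpha>: "\<alpha> permutes {1..n}" "inv \<alpha> \<circ> \<sigma> permutes {1..n}"
        using \<sigma> by (simp_all add: permutes_compose permutes_inv)
      then show "to_galg n (sign_prod S a) \<alpha> * to_galg n (sign_prod T b) (inv \<alpha> \<circ> \<sigma>)
          = of_nat (card {f \<in> {1..n} \<rightarrow>\<^sub>E {..<a}. sorts n S f \<alpha>})
          * of_nat (card {g \<in> {1..n} \<rightarrow>\<^sub>E {..<b}. sorts n T g (inv \<alpha> \<circ> \<sigma>)})"
        by (simp only: card_sorts to_galg_def if_True)
    qed
    also have "\<dots> = of_nat (\<Sum>\<alpha>\<in>X. card (A \<alpha> \<times> B \<alpha>))"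
      by (simp add: card_cartesian_product)
    also have "(\<Sum>\<alpha>\<in>X. card (A \<alpha> \<times> B \<alpha>)) = card (Sigma X (\<lambda>\<alpha>. A \<alpha> \<times> B \<alpha>))"
      using fin by (subst card_SigmaI) auto
    also have "\<dots> = card Y" using bij by (rule bij_betw_same_card)
    also have "of_nat (card Y) = to_galg n (sign_prod R (a * b)) \<sigma>"
      using card_sorts[OF \<sigma>, of "a * b" R] \<sigma> by (simp add: Y_def to_galg_def)
    finally show ?thesis .
  qed
qed

text \<open>For odd \<open>a\<close>, reversing a block preserves the parity of its letters and
  \<open>a * p\<close> has the parity of \<open>p\<close>. For even \<open>a\<close>, reversal flips
  the parity and \<open>a * p\<close> contributes nothing, so the sign of the right factor is
  lost.\<close>

lemma gmult_sign_prod_alt: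
  assumes "a > 0"
  shows "gmult n (to_galg n (sign_prod (alt e) a)) (to_galg n (sign_prod (alt e') b))
    = to_galg n (sign_prod (alt (if odd a then e \<noteq> e' else e)) (a * b))"
proof (rule gmult_sign_prod[OF assms])
  fix p q assume "p < b" "q < a"
  then have "odd (a * p + (a - 1 - q)) \<longleftrightarrow> odd (a * p) \<noteq> (odd a = odd q)"
    by (auto simp: even_diff_nat)
  then show "alt (if odd a then e \<noteq> e' else e) (a * p + (if alt e' p then a - 1 - q else q))
      = (alt e' p \<noteq> alt e q)"
    by (cases "alt e' p") (auto simp: alt_def)
qed


lemma gmult_simps:
  "gmult n (f + f') g = gmult n f g + gmult n f' g" "gmult n f (g + g') = gmult n f g + gmult n f g'"
  "gmult n (f - f') g = gmult n f g - gmult n f' g" "gmult n f (g - g') = gmult n f g - gmult n f g'"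
  "gmult n (scaleQ c f) g = scaleQ c (gmult n f g)" "gmult n f (scaleQ c g) = scaleQ c (gmult n f g)"
  "gmult n 0 g = 0" "gmult n f 0 = 0"
  by (auto simp: gmult_def fun_eq_iff scaleQ_def algebra_simps sum.distrib sum_subtractf sum_distrib_left
      case_prod_unfold)

lemma gmult_sum_left: "gmult n (\<Sum>i\<in>X. f i) g = (\<Sum>i\<in>X. gmult n (f i) g)"
  by (induction X rule: infinite_finite_induct)
     (simp_all only: sum.infinite sum.empty sum.insert gmult_simps not_False_eq_True)

lemma gmult_sum_right: "gmult n f (\<Sum>i\<in>X. g i) = (\<Sum>i\<in>X. gmult n f (g i))"
  by (induction X rule: infinite_finite_induct)
     (simp_all only: sum.infinite sum.empty sum.insert gmult_simps not_False_eq_True)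

lemma sum_galg_apply: "(\<Sum>i\<in>X. f i) x = (\<Sum>i\<in>X. f i x :: rat)"
  by (induction X rule: infinite_finite_induct) simp_all

lemma to_galg_sign_prod_alt:
  "to_galg n (sign_prod (alt e) k) = (\<Sum>j\<le>n. scaleQ (of_nat k ^ j) (to_galg n (IJ (odd k) e j)))"
  by (auto simp: fun_eq_iff to_galg_def sum_galg_apply scaleQ_def sign_prod_alt_expansion[where N = n])

text \<open>Products of alternating products depend on \<open>a\<close> and \<open>b\<close> only
  through the powers \<open>(a * b) ^ l\<close>, so the coefficients of \<open>a ^ j * b ^ l\<close>
  with different exponents vanish. Coefficients are compared first in \<open>b\<close>, then in
  \<open>a\<close>, each ranging over the integers of one parity.\<close>

lemma gmult_IJ:
  assumes "j \<le> n" "l \<le> n"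
  shows "gmult n (to_galg n (IJ p e j)) (to_galg n (IJ p' e' l))
    = (if j = l then to_galg n (IJ (p \<and> p') (if p then e \<noteq> e' else e) j) else 0)"
proof
  fix \<sigma>
  define P where "P j l = gmult n (to_galg n (IJ p e j)) (to_galg n (IJ p' e' l)) \<sigma>" for j l
  define Q where "Q j = to_galg n (IJ (p \<and> p') (if p then e \<noteq> e' else e) j) \<sigma>" for j
  have 1: "(\<Sum>l\<le>n. of_nat b ^ l * ((\<Sum>j\<le>n. of_nat a ^ j * P j l) - of_nat a ^ l * Q l)) = 0"
    if a: "odd a = p" "a > 0" and b: "odd b = p'" for a b
  proof -
    have "(\<Sum>l\<le>n. of_nat b ^ l * (\<Sum>j\<le>n. of_nat a ^ j * P j l))
        = gmult n (to_galg n (sign_prod (alt e) a)) (to_galg n (sign_prod (alt e') b)) \<sigma>"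
      unfolding to_galg_sign_prod_alt a b gmult_sum_left gmult_sum_right gmult_simps
      unfolding sum_galg_apply scaleQ_def P_def sum_distrib_left
      by (simp add: mult.left_commute)
    also have "\<dots> = (\<Sum>l\<le>n. of_nat (a * b) ^ l * Q l)"
      unfolding gmult_sign_prod_alt[OF a(2)] unfolding to_galg_sign_prod_alt
      using a b by (simp add: sum_galg_apply scaleQ_def Q_def del: of_nat_mult)
    finally show ?thesis
      by (simp add: algebra_simps power_mult_distrib sum_subtractf)
  qed
  have 2: "(\<Sum>j\<le>n. of_nat a ^ j * P j l) - of_nat a ^ l * Q l = 0"
    if a: "odd a = p" "a > 0" and "l \<le> n" for a l
    by (rule power_sums_zero_imp_zero[OF infinite_parity[of p']]) (use 1[OF a] \<open>l \<le> n\<close> in auto)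
  have 3: "(\<Sum>j\<le>n. of_nat a ^ j * (P j l - (if j = l then Q l else 0))) = 0"
    if a: "odd a = p" "a > 0" for a
    using 2[OF a assms(2)] assms(2)
    by (simp add: algebra_simps sum_subtractf if_distrib[of "(*) _"] cong: if_cong)
  \<comment> \<open>The value 0 is removed because the product formula is available for
    \<open>a > 0\<close>.\<close>
  have "infinite ({a :: nat. odd a = p} - {0})"
    using infinite_parity[of p] by simp
  then have "P j l - (if j = l then Q l else 0) = 0"
    by (rule power_sums_zero_imp_zero[OF _ _ assms(1)]) (intro 3; simp)
  then show "gmult n (to_galg n (IJ p e j)) (to_galg n (IJ p' e' l)) \<sigma>
      = (if j = l then to_galg n (IJ (p \<and> p') (if p then e \<noteq> e' else e) j) else 0) \<sigma>"
    by (auto simp: P_def Q_def)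
qed

section \<open>Runs and peaks\<close>

text \<open>Such series factor through compositions. This is what allows bit 0 of a descent word to
  be chosen freely and what makes \<open>Gam\<close> multiplicative.\<close>

definition head_free :: "wseries \<Rightarrow> bool" where
  "head_free f \<longleftrightarrow> (\<forall>b v. wcoeff f (b # v) = wcoeff f (True # v))"

lemma head_free_Cons: "head_free f \<Longrightarrow> wcoeff f (b # v) = wcoeff f (b' # v)"
  by (metis head_free_def)

lemma head_free_mult:
  assumes "head_free f" "head_free g"
  shows "head_free (f * g)"
  unfolding head_free_def
proof (intro allI)
  fix b v
  have "wcoeff f (take c (b # v)) * wcoeff g (drop c (b # v))
      = wcoeff f (take c (True # v)) * wcoeff g (drop c (True # v))" for c
    using assms by (cases c) (simp_all, (metis head_free_def)+)
  then show "wcoeff (f * g) (b # v) = wcoeff (f * g) (True # v)"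
    by (simp add: wcoeff_mult)
qed

lemma head_free_U: "head_free (U e)"
  by (simp add: head_free_def wcoeff_U)

lemma head_free_one: "head_free 1"
  by (simp add: head_free_def wcoeff_one)

lemma head_free_sign_prod: "head_free (sign_prod s k)"
  by (induction k) (auto simp: head_free_one head_free_mult head_free_U)

lemma sign_prod_map_Not: "wcoeff (sign_prod s k) (map Not w) = wcoeff (sign_prod (Not \<circ> s) k) w"
proof (induction k arbitrary: w)
  case (Suc k)
  have "wcoeff (U e) (map Not v) = wcoeff (U (\<not> e)) v" for e v
    by (auto simp: wcoeff_U simp flip: map_tl)
  then show ?case
    by (simp add: wcoeff_mult Suc drop_map take_map)
qed (simp add: wcoeff_one)

text \<open>\<open>u = (1 + x) / (1 - x)\<close> with its even and odd parts \<open>c\<close> and \<open>s\<close>.\<close>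

definition u_fps :: "rat fps" where "u_fps = Abs_fps (\<lambda>k. if k = 0 then 1 else 2)"
definition c_fps :: "rat fps" where "c_fps = Abs_fps (\<lambda>k. if odd k then 0 else u_fps $ k)"
definition s_fps :: "rat fps" where "s_fps = Abs_fps (\<lambda>k. if odd k then u_fps $ k else 0)"

definition has_parity :: "bool \<Rightarrow> rat fps \<Rightarrow> bool" where
  "has_parity b f \<longleftrightarrow> (\<forall>k. odd k \<noteq> b \<longrightarrow> f $ k = 0)"

lemma has_parity_mult:
  assumes "has_parity a f" "has_parity b g"
  shows "has_parity (a \<noteq> b) (f * g)"
  unfolding has_parity_def fps_mult_nth
proof (intro allI impI sum.neutral ballI)
  fix k i :: nat assume k: "odd k \<noteq> (a \<noteq> b)" and i: "i \<in> {0..k}"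
  obtain j where j: "k = i + j" using i le_Suc_ex by auto
  have "odd i \<noteq> a \<or> odd (k - i) \<noteq> b" using k unfolding j by auto
  then show "f $ i * g $ (k - i) = 0"
    using assms unfolding has_parity_def by (metis mult_zero_left mult_zero_right)
qed

lemma u_fps_eq: "(1 - fps_X) * u_fps = 1 + fps_X" "u_fps = c_fps + s_fps"
  by (rule fps_ext, auto simp: u_fps_def c_fps_def s_fps_def fps_X_mult_nth left_diff_distrib fps_X_nth)+

lemma has_parity_c: "has_parity False c_fps" and has_parity_s: "has_parity True s_fps"
  by (auto simp: has_parity_def c_fps_def s_fps_def)

lemma has_parity_c_s: "has_parity (odd r) (fps_const (1/2) * c_fps ^ m * s_fps ^ r)"
proof -
  have "has_parity False (c_fps ^ m)"
    by (induction m) (use has_parity_mult[OF has_parity_c] in \<open>auto simp: has_parity_def\<close>)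
  moreover have "has_parity (odd r) (s_fps ^ r)"
    by (induction r) (use has_parity_mult[OF has_parity_s] in \<open>auto simp: has_parity_def\<close>)
  moreover have "has_parity False (fps_const (1/2))"
    by (auto simp: has_parity_def)
  ultimately show ?thesis
    using has_parity_mult[OF has_parity_mult[of False "fps_const (1/2)" False "c_fps ^ m"]] by fastforce
qed

section \<open>Coefficients of alternating products as functions of the number of runs\<close>

definition run_value :: "nat \<Rightarrow> nat \<Rightarrow> nat \<Rightarrow> rat" where
  "run_value k n r = (u_fps * (fps_const (1/2) * c_fps ^ (n - r) * s_fps ^ r)) $ k"

lemma u_fps_mult_nth:
  assumes "has_parity b f"
  shows "(u_fps * f) $ k = (if odd k = b then (c_fps * f) $ k else (s_fps * f) $ k)"
proof -
  have "has_parity b (c_fps * f)" "has_parity (\<not> b) (s_fps * f)"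
    using has_parity_mult[OF has_parity_c assms] has_parity_mult[OF has_parity_s assms] by auto
  then show ?thesis
    by (auto simp: u_fps_eq(2) distrib_right has_parity_def)
qed

text \<open>Let \<open>E\<close> be \<open>c^(n-r) s^r / 2\<close>, of the parity of
  \<open>r\<close>. At an index of the other parity, \<open>u E\<close> contributes only through
  \<open>s E\<close>, which is also \<open>c\<close> times the corresponding series for
  \<open>r + 1\<close>, the part of its \<open>u\<close>-multiple seen at that index.\<close>

lemma run_value_Suc:
  assumes "r < n" "odd k \<noteq> odd r"
  shows "run_value k n (Suc r) = run_value k n r"
proof -
  have "n - r = Suc (n - Suc r)" using assms by simp
  then have "c_fps * (fps_const (1/2) * c_fps ^ (n - Suc r) * s_fps ^ Suc r)
      = s_fps * (fps_const (1/2) * c_fps ^ (n - r) * s_fps ^ r)"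
    by (simp add: mult_ac)
  then show ?thesis
    using assms unfolding run_value_def
    by (simp only: u_fps_mult_nth[OF has_parity_c_s]) auto
qed

definition changes :: "(nat \<Rightarrow> bool) \<Rightarrow> nat \<Rightarrow> nat" where
  "changes d n = card {i. Suc i < n \<and> d i \<noteq> d (Suc i)}"

lemma changes_Suc: "changes d (Suc (Suc n)) = changes d (Suc n) + (if d n \<noteq> d (Suc n) then 1 else 0)"
proof -
  have "{i. Suc i < Suc (Suc n) \<and> d i \<noteq> d (Suc i)} =
      (if d n \<noteq> d (Suc n) then insert n {i. Suc i < Suc n \<and> d i \<noteq> d (Suc i)}
       else {i. Suc i < Suc n \<and> d i \<noteq> d (Suc i)})"
    by (auto simp: less_Suc_eq)
  then show ?thesis by (simp add: changes_def)
qed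

lemma changes_1 [simp]: "changes d (Suc 0) = 0"
  by (simp add: changes_def)

lemma changes_less: "changes d (Suc n) \<le> n"
  by (induction n) (auto simp: changes_Suc)

lemma odd_changes: "\<not> d 0 \<Longrightarrow> odd (changes d (Suc n)) = d n"
  by (induction n) (auto simp: changes_Suc)

text \<open>The generating function over \<open>k\<close> grows letter by letter: each letter
  selects the part of one parity and multiplies it by \<open>u\<close>. Multiplied out, a repeated
  bit contributes a factor \<open>c\<close> and a changed bit a factor \<open>s\<close>, so only the
  number of changes matters.\<close>

lemma sign_prod_run_value:
  assumes d0: "\<not> d 0"
  shows "wcoeff (sign_prod (alt False) k) (map d [0..<Suc n]) = run_value k (Suc n) (Suc (changes d (Suc n)))"
proof -
  define A where "A w = Abs_fps (\<lambda>k. wcoeff (sign_prod (alt False) k) w)" for w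
  define par where "par b f = Abs_fps (\<lambda>k. if odd k = b then f $ k else 0)" for b and f :: "rat fps"
  \<comment> \<open>This is \<open>sign_prod_snoc\<close> summed over \<open>k\<close>: of two
    consecutive coefficients at \<open>w\<close>, the one whose index has the parity prescribed by
    \<open>x\<close> is taken. For the empty word and a True bit the constant terms would
    differ.\<close>
  have A_snoc: "A (w @ [x]) = u_fps * par (\<not> x) (A w)" if "w = [] \<longrightarrow> \<not> x" for w x
  proof -
    have "(1 - fps_X) * A (w @ [x]) = (1 + fps_X) * par (\<not> x) (A w)"
    proof (rule fps_ext)
      fix k show "((1 - fps_X) * A (w @ [x])) $ k = ((1 + fps_X) * par (\<not> x) (A w)) $ k"
      proof (cases k)
        case 0
        then show ?thesis using that by (auto simp: A_def par_def wcoeff_one)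
      next
        case (Suc m)
        then show ?thesis
          by (auto simp: A_def par_def left_diff_distrib distrib_right fps_X_mult_nth sign_prod_snoc
              alt_def simp del: sign_prod.simps)
      qed
    qed
    also have "\<dots> = (1 - fps_X) * (u_fps * par (\<not> x) (A w))"
      by (simp flip: u_fps_eq(1) add: mult.assoc)
    finally have "(1 - fps_X) * A (w @ [x]) = (1 - fps_X) * (u_fps * par (\<not> x) (A w))" .
    moreover have "(1 - fps_X :: rat fps) \<noteq> 0"
      by (metis fps_one_nth fps_sub_nth fps_X_nth fps_zero_nth diff_zero zero_neq_one)
    ultimately show ?thesis by simp
  qed
  \<comment> \<open>Of the two parts \<open>c f\<close> and \<open>s f\<close> of
    \<open>u f\<close>, exactly one has the required parity.\<close>
  have par_u: "par (\<not> x) (u_fps * f) = (if x = b then s_fps * f else c_fps * f)" if "has_parity b f" for x b f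
  proof (rule fps_ext)
    fix k
    have "has_parity b (c_fps * f)" "has_parity (\<not> b) (s_fps * f)"
      using has_parity_mult[OF has_parity_c that] has_parity_mult[OF has_parity_s that] by auto
    then show "par (\<not> x) (u_fps * f) $ k = (if x = b then s_fps * f else c_fps * f) $ k"
      by (auto simp: par_def u_fps_mult_nth[OF that] has_parity_def)
  qed
  have "A (map d [0..<Suc n]) = u_fps * (fps_const (1/2) * c_fps ^ (n - changes d (Suc n)) * s_fps ^ Suc (changes d (Suc n)))"
  proof (induction n)
    case 0
    \<comment> \<open>The series \<open>A []\<close> is \<open>1 / (1 - x)\<close>, with odd part
      \<open>x / (1 - x^2) = s / 2\<close>. This is the origin of the factor 1/2 and of the one
      \<open>s\<close> beyond the number of changes.\<close>
    have "wcoeff (sign_prod s k) [] = 1" for s k by (induction k) auto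
    then have "par True (A []) = fps_const (1/2) * s_fps"
      by (intro fps_ext) (auto simp: par_def A_def s_fps_def u_fps_def)
    then show ?case using A_snoc[of "[]" "d 0"] d0 by simp
  next
    case (Suc n)
    define r where "r = changes d (Suc n)"
    have r: "r \<le> n" using changes_less by (simp add: r_def)
    define E where "E = fps_const (1/2) * c_fps ^ (n - r) * s_fps ^ Suc r"
    have "has_parity (odd (Suc r)) E"
      unfolding E_def by (rule has_parity_c_s)
    then have E: "has_parity (\<not> d n) E"
      using odd_changes[of d n] d0 by (simp add: r_def)
    have "A (map d [0..<Suc (Suc n)]) = u_fps * par (\<not> d (Suc n)) (A (map d [0..<Suc n]))"
      using A_snoc[of "map d [0..<Suc n]" "d (Suc n)"] by simp
    also have "\<dots> = u_fps * (if d (Suc n) = (\<not> d n) then s_fps * E else c_fps * E)"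
      using Suc par_u[OF E] by (simp add: E_def r_def)
    also have "\<dots> = u_fps * (fps_const (1/2) * c_fps ^ (Suc n - changes d (Suc (Suc n))) * s_fps ^ Suc (changes d (Suc (Suc n))))"
      using r by (auto simp: changes_Suc E_def r_def[symmetric] Suc_diff_le mult_ac)
    finally show ?case .
  qed
  then have "A (map d [0..<Suc n]) $ k = run_value k (Suc n) (Suc (changes d (Suc n)))"
    by (simp add: run_value_def)
  then show ?thesis by (simp add: A_def)
qed

definition turns :: "nat \<Rightarrow> (nat \<Rightarrow> nat) \<Rightarrow> nat" where
  "turns n \<sigma> = card {i. 1 \<le> i \<and> Suc i < n \<and> (\<sigma> (Suc i) < \<sigma> i) \<noteq> (\<sigma> (Suc (Suc i)) < \<sigma> (Suc i))}"

definition starts_down :: "(nat \<Rightarrow> nat) \<Rightarrow> bool" where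
  "starts_down \<sigma> \<longleftrightarrow> \<sigma> 2 < \<sigma> 1"

text \<open>
  For \<open>e = False\<close> the number of left runs; for \<open>e = True\<close> the number of runs of the word preceded by
  \<open>\<infinity>\<close> instead of \<open>0\<close>.
\<close>

definition run_count :: "nat \<Rightarrow> bool \<Rightarrow> (nat \<Rightarrow> nat) \<Rightarrow> nat" where
  "run_count n e \<sigma> = 1 + turns n \<sigma> + (if starts_down \<sigma> \<noteq> e then 1 else 0)"

lemma permutes_0: "\<sigma> permutes {1..n} \<Longrightarrow> \<sigma> 0 = (0::nat)"
  by (auto simp: permutes_def)

lemma changes_eq_turns:
  assumes "n \<ge> 2" and d: "\<And>i. i > 0 \<Longrightarrow> d i = ((\<sigma> (Suc i) < \<sigma> i) \<noteq> e)"
  shows "changes d n = turns n \<sigma> + (if d 0 \<noteq> d 1 then 1 else 0)"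
proof -
  let ?T = "{i. 1 \<le> i \<and> Suc i < n \<and> (\<sigma> (Suc i) < \<sigma> i) \<noteq> (\<sigma> (Suc (Suc i)) < \<sigma> (Suc i))}"
  have "{i. Suc i < n \<and> d i \<noteq> d (Suc i)} = (if d 0 \<noteq> d 1 then insert 0 ?T else ?T)"
  proof (rule set_eqI)
    fix i show "i \<in> {i. Suc i < n \<and> d i \<noteq> d (Suc i)} \<longleftrightarrow> i \<in> (if d 0 \<noteq> d 1 then insert 0 ?T else ?T)"
      using assms by (cases "i = 0") auto
  qed
  moreover have "finite ?T" by (rule finite_subset[of _ "{..<n}"]) auto
  ultimately show ?thesis by (simp add: changes_def turns_def)
qed

lemma turns_le: "n \<ge> 2 \<Longrightarrow> turns n \<sigma> + 2 \<le> n"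
proof -
  assume "n \<ge> 2"
  have "turns n \<sigma> \<le> card {1..<n - 1}"
    unfolding turns_def by (rule card_mono) auto
  then show ?thesis using \<open>n \<ge> 2\<close> by simp
qed

lemma run_count_bounds: "n \<ge> 2 \<Longrightarrow> 1 \<le> run_count n e \<sigma> \<and> run_count n e \<sigma> \<le> n"
  using turns_le[of n \<sigma>] by (auto simp: run_count_def)

text \<open>For the negative sign all bits are complemented. The ignored first bit is then set to
  False, which amounts to preceding the word by 0 or, after complementation, by infinity.\<close>

lemma sign_prod_descent_word:
  assumes "n \<ge> 2" "\<sigma> permutes {1..n}"
  shows "wcoeff (sign_prod (alt e) k) (descent_word n \<sigma>)
    = run_value k n (run_count n e \<sigma>)"
proof -
  obtain m where n: "n = Suc m" using assms(1) by (cases n) auto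
  define d where "d i = (i > 0 \<and> (\<sigma> (Suc i) < \<sigma> i) \<noteq> e)" for i
  have "alt True = Not \<circ> alt False" by (auto simp: alt_def fun_eq_iff)
  then have "wcoeff (sign_prod (alt e) k) (descent_word n \<sigma>)
      = wcoeff (sign_prod (alt False) k) (map (\<lambda>i. (\<sigma> (Suc i) < \<sigma> i) \<noteq> e) [0..<n])"
    using sign_prod_map_Not[of "alt False" k "descent_word n \<sigma>"]
    by (cases e) (simp_all add: descent_word_def o_def)
  also have "\<dots> = wcoeff (sign_prod (alt False) k) (map d [0..<n])"
  proof -
    have "map f [0..<n] = f 0 # map f [1..<n]" for f :: "nat \<Rightarrow> bool"
      using assms(1) by (simp add: upt_conv_Cons)
    moreover have "map (\<lambda>i. (\<sigma> (Suc i) < \<sigma> i) \<noteq> e) [1..<n] = map d [1..<n]"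
      by (auto simp: d_def)
    ultimately show ?thesis
      using head_free_Cons[OF head_free_sign_prod] by metis
  qed
  also have "\<dots> = run_value k n (Suc (changes d n))"
    unfolding n by (rule sign_prod_run_value) (simp add: d_def)
  also have "changes d n = turns n \<sigma> + (if starts_down \<sigma> \<noteq> e then 1 else 0)"
    using changes_eq_turns[of n d \<sigma> e] assms(1)
    by (auto simp: d_def starts_down_def numeral_2_eq_2)
  finally show ?thesis by (simp add: run_count_def)
qed

text \<open>Equal combinations of alternating products for infinitely many \<open>k\<close> force
  equality of each coefficient of their expansion in powers of \<open>k\<close>.\<close>

lemma IJ_class_function:
  assumes "n \<ge> 2" "\<sigma> permutes {1..n}" "\<tau> permutes {1..n}" "j \<le> n"
    and eq: "\<And>k. odd k = p \<Longrightarrow>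
      x * run_value k n (run_count n False \<sigma>) + y * run_value k n (run_count n True \<sigma>) =
      x * run_value k n (run_count n False \<tau>) + y * run_value k n (run_count n True \<tau>)"
  shows "x * to_galg n (IJ p False j) \<sigma> + y * to_galg n (IJ p True j) \<sigma> =
    x * to_galg n (IJ p False j) \<tau> + y * to_galg n (IJ p True j) \<tau>"
proof -
  define f where "f j \<sigma> = x * to_galg n (IJ p False j) \<sigma> + y * to_galg n (IJ p True j) \<sigma>" for j \<sigma>
  have f: "(\<Sum>j\<le>n. of_nat k ^ j * f j \<sigma>) = x * run_value k n (run_count n False \<sigma>) + y * run_value k n (run_count n True \<sigma>)"
    if "odd k = p" "\<sigma> permutes {1..n}" for k \<sigma>
  proof -
    have V: "(\<Sum>j\<le>n. of_nat k ^ j * to_galg n (IJ p e j) \<sigma>)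
        = run_value k n (run_count n e \<sigma>)" for e
      using sign_prod_descent_word[OF assms(1) that(2), of e k] that
      by (simp add: to_galg_def sign_prod_alt_expansion[where N = n])
    have "(\<Sum>j\<le>n. of_nat k ^ j * f j \<sigma>)
        = x * (\<Sum>j\<le>n. of_nat k ^ j * to_galg n (IJ p False j) \<sigma>)
        + y * (\<Sum>j\<le>n. of_nat k ^ j * to_galg n (IJ p True j) \<sigma>)"
      by (simp add: f_def sum_distrib_left sum.distrib algebra_simps)
    then show ?thesis unfolding V by simp
  qed
  have "f j \<sigma> - f j \<tau> = 0"
  proof (rule power_sums_zero_imp_zero[OF infinite_parity[of p] _ assms(4)])
    fix k :: nat assume "k \<in> {k. odd k = p}"
    then have k: "odd k = p" by simp
    have "(\<Sum>j\<le>n. of_nat k ^ j * f j \<sigma>) = (\<Sum>j\<le>n. of_nat k ^ j * f j \<tau>)"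
      unfolding f[OF k assms(2)] f[OF k assms(3)] by (rule eq[OF k])
    then show "(\<Sum>j\<le>n. of_nat k ^ j * (f j \<sigma> - f j \<tau>)) = 0"
      by (simp add: algebra_simps sum_subtractf)
  qed
  then show ?thesis by (simp add: f_def)
qed

section \<open>Ribbons and descent classes\<close>

lemma comp_descents_Cons:
  "comp_descents (a # I) = (if I = [] then {} else insert a ((+) a ` comp_descents I))"
proof (cases "I = []")
  case False
  have image: "comp_descents K = (\<lambda>j. sum_list (take j K)) ` {1..<length K}" for K
    by (auto simp: comp_descents_def)
  have "comp_descents (a # I) = (\<lambda>j. sum_list (take j (a # I))) ` {1..<Suc (length I)}"
    by (simp add: image)
  also have "{1..<Suc (length I)} = insert 1 (Suc ` {1..<length I})"
    using False by (auto simp: image_Suc_atLeastLessThan)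
  also have "(\<lambda>j. sum_list (take j (a # I))) ` \<dots> = insert a ((+) a ` comp_descents I)"
    unfolding image image_insert image_image by simp
  finally show ?thesis using False by simp
qed (auto simp: comp_descents_def)

lemma comp_descents_comp_aux: "comp_descents (comp_aux a v) = {a + i |i. i < length v \<and> v ! i}"
proof (induction v arbitrary: a)
  case Nil
  then show ?case by (simp add: comp_descents_Cons)
next
  case (Cons b v)
  have *: "{a + i |i. i < length (b # v) \<and> (b # v) ! i}
      = (if b then {a} else {}) \<union> {Suc a + i |i. i < length v \<and> v ! i}"
  proof (rule set_eqI)
    fix x
    show "x \<in> {a + i |i. i < length (b # v) \<and> (b # v) ! i} \<longleftrightarrow>
        x \<in> (if b then {a} else {}) \<union> {Suc a + i |i. i < length v \<and> v ! i}"
    proof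
      assume "x \<in> {a + i |i. i < length (b # v) \<and> (b # v) ! i}"
      then obtain i where "x = a + i" "i < length (b # v)" "(b # v) ! i" by blast
      then show "x \<in> (if b then {a} else {}) \<union> {Suc a + i |i. i < length v \<and> v ! i}"
        by (cases i) auto
    next
      assume "x \<in> (if b then {a} else {}) \<union> {Suc a + i |i. i < length v \<and> v ! i}"
      then consider "b" "x = a + 0" | i where "x = a + Suc i" "i < length v" "v ! i"
        by (auto split: if_splits)
      then show "x \<in> {a + i |i. i < length (b # v) \<and> (b # v) ! i}"
        by cases (force, metis (mono_tags, lifting) Suc_less_eq length_Cons mem_Collect_eq nth_Cons_Suc)
    qed
  qed
  show ?case
    unfolding * by (auto simp: Cons comp_descents_Cons)
qed

lemma to_descent_eq:
  assumes "n > 0"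
  shows "to_descent n F = to_galg n (word_series F)"
proof
  fix \<sigma>
  show "to_descent n F \<sigma> = to_galg n (word_series F) \<sigma>"
  proof (cases "\<sigma> permutes {1..n}")
    case True
    define v where "v = map (\<lambda>i. \<sigma> (Suc i) < \<sigma> i) [1..<n]"
    have w: "descent_word n \<sigma> = (\<sigma> 1 < \<sigma> 0) # v"
      using assms by (simp add: descent_word_def v_def upt_conv_Cons)
    have len: "length v = n - 1" by (simp add: v_def)
    have Des: "Des n \<sigma> = comp_descents (comp_aux (Suc 0) v)"
      unfolding comp_descents_comp_aux
    proof (intro set_eqI iffI)
      fix i assume "i \<in> Des n \<sigma>"
      then show "i \<in> {Suc 0 + i |i. i < length v \<and> v ! i}"
        by (auto simp: Des_def v_def intro!: exI[of _ "i - 1"])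
    qed (auto simp: Des_def v_def)
    have uniq: "I = comp_aux (Suc 0) v" if "I \<in> compositions n" "comp_descents I = Des n \<sigma>" for I
    proof -
      have "I \<in> comp_aux (Suc 0) ` {v. length v = n - 1}"
        using bij_betw_imp_surj_on[OF bij_betw_comp_aux[OF assms]] that(1) by simp
      then obtain v' where v': "length v' = n - 1" "I = comp_aux (Suc 0) v'" by auto
      then have "{Suc 0 + i |i. i < n - 1 \<and> v' ! i} = {Suc 0 + i |i. i < n - 1 \<and> v ! i}"
        using that(2) len unfolding Des v' comp_descents_comp_aux by simp
      then have "v' ! i = v ! i" if "i < n - 1" for i
        using that by auto
      then have "v' = v" using v' len by (intro nth_equalityI) auto
      then show ?thesis using v' by simp
    qed
    have "to_descent n F \<sigma> = (\<Sum>I\<in>compositions n. F I * (if Des n \<sigma> = comp_descents I then 1 else 0))"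
      unfolding to_descent_def sum_galg_apply
      by (intro sum.cong refl) (use True in \<open>simp add: scaleQ_def perm_sum_def indicator_def\<close>)
    also have "\<dots> = (\<Sum>I\<in>{comp_aux (Suc 0) v}. F I * (if Des n \<sigma> = comp_descents I then 1 else 0))"
      using comp_of_in_compositions[of "True # v"] len assms
      by (intro sum.mono_neutral_right) (auto dest: uniq)
    finally show ?thesis using True Des by (simp add: to_galg_def w)
  qed (simp add: to_descent_def sum_galg_apply scaleQ_def perm_sum_def indicator_def to_galg_def)
qed

text \<open>A final ascent leaves the new maximum in last place; a final descent raises all earlier
  values by one and puts 1 last, which is composition with the cycle \<open>t\<close>.\<close>

lemma ex_permutation_with_descents:
  "\<exists>\<sigma>. \<sigma> permutes {1..n} \<and> (\<forall>i. 1 \<le> i \<and> i < n \<longrightarrow> (\<sigma> (Suc i) < \<sigma> i) = d i)"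
proof (induction n)
  case 0
  show ?case using permutes_id by blast
next
  case (Suc n)
  then obtain \<sigma> where \<sigma>: "\<sigma> permutes {1..n}" "\<And>i. 1 \<le> i \<Longrightarrow> i < n \<Longrightarrow> (\<sigma> (Suc i) < \<sigma> i) = d i"
    by blast
  have range: "\<sigma> i \<in> {1..n}" if "i \<in> {1..n}" for i
    using that permutes_in_image[OF \<sigma>(1)] by simp
  have last: "\<sigma> (Suc n) = Suc n" using permutes_not_in[OF \<sigma>(1)] by simp
  have \<sigma>': "\<sigma> permutes {1..Suc n}" using \<sigma>(1) by (rule permutes_subset) auto
  define t where "t x = (if x = Suc n then 1 else if x \<in> {1..n} then Suc x else x)" for x :: nat
  have "bij_betw t {1..Suc n} {1..Suc n}"
    by (rule bij_betw_byWitness[where f' = "\<lambda>x. if x = 1 then Suc n else x - 1"]) (auto simp: t_def)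
  then have t: "t permutes {1..Suc n}"
    by (rule bij_imp_permutes) (auto simp: t_def)
  show ?case
  proof (cases "d n")
    case True
    have "((t \<circ> \<sigma>) (Suc i) < (t \<circ> \<sigma>) i) = d i" if "1 \<le> i" "i < Suc n" for i
    proof (cases "i = n")
      case True
      then show ?thesis using range[of n] last \<open>d n\<close> that by (simp add: t_def)
    next
      case False
      then show ?thesis using range[of i] range[of "Suc i"] \<sigma>(2)[of i] that by (auto simp: t_def)
    qed
    then show ?thesis using permutes_compose[OF \<sigma>' t] by blast
  next
    case False
    have "(\<sigma> (Suc i) < \<sigma> i) = d i" if "1 \<le> i" "i < Suc n" for i
      using range[of n] last False that \<sigma>(2)[of i] by (cases "i = n") auto
    then show ?thesis using \<sigma>' by blast
  qed
qed

text \<open>Every descent set occurs, so each coefficient of the series in degree \<open>n\<close>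
  is the value at some permutation.\<close>

lemma to_galg_eq_0_imp:
  assumes "head_free f" "to_galg n f = 0" "length w = n" "n > 0"
  shows "wcoeff f w = 0"
proof -
  obtain \<sigma> where \<sigma>: "\<sigma> permutes {1..n}" "\<And>i. 1 \<le> i \<Longrightarrow> i < n \<Longrightarrow> (\<sigma> (Suc i) < \<sigma> i) = w ! i"
    using ex_permutation_with_descents[of n "(!) w"] by auto
  have "descent_word n \<sigma> = (\<sigma> 1 < \<sigma> 0) # tl w"
  proof (rule nth_equalityI)
    fix i assume "i < length (descent_word n \<sigma>)"
    then show "descent_word n \<sigma> ! i = ((\<sigma> 1 < \<sigma> 0) # tl w) ! i"
      using \<sigma>(2)[of i] assms(3) by (cases i) (auto simp: descent_word_def nth_tl)
  qed (use assms in auto)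
  moreover have "w = hd w # tl w" using assms by (cases w) auto
  ultimately have "wcoeff f w = wcoeff f (descent_word n \<sigma>)"
    using head_free_Cons[OF assms(1)] by metis
  also have "\<dots> = to_galg n f \<sigma>" using \<sigma>(1) by (simp add: to_galg_def)
  finally show ?thesis using assms(2) by simp
qed

section \<open>Counting runs\<close>

lemma strict_mono_on_iff_Suc: "strict_mono_on {a..b} (\<sigma> :: nat \<Rightarrow> nat) \<longleftrightarrow> (\<forall>i. a \<le> i \<and> i < b \<longrightarrow> \<sigma> i < \<sigma> (Suc i))"
proof
  assume *: "\<forall>i. a \<le> i \<and> i < b \<longrightarrow> \<sigma> i < \<sigma> (Suc i)"
  have "\<sigma> i < \<sigma> j" if "a \<le> i" "i < j" "j \<le> b" for i j
    using that(2,3)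
  proof (induction j)
    case (Suc j)
    then show ?case using * that(1) by (cases "i = j") (auto intro: less_trans)
  qed simp
  then show "strict_mono_on {a..b} \<sigma>" by (auto simp: monotone_on_def)
qed (auto simp: monotone_on_def)

lemma strict_antimono_on_iff_Suc:
  "strict_antimono_on {a..b} (\<sigma> :: nat \<Rightarrow> nat) \<longleftrightarrow> (\<forall>i. a \<le> i \<and> i < b \<longrightarrow> \<sigma> (Suc i) < \<sigma> i)"
proof
  assume *: "\<forall>i. a \<le> i \<and> i < b \<longrightarrow> \<sigma> (Suc i) < \<sigma> i"
  have "\<sigma> j < \<sigma> i" if "a \<le> i" "i < j" "j \<le> b" for i j
    using that(2,3)
  proof (induction j)
    case (Suc j)
    then have "\<sigma> (Suc j) < \<sigma> j" using * that(1) by simp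
    then show ?case using Suc by (cases "i = j") auto
  qed simp
  then show "strict_antimono_on {a..b} \<sigma>" by (auto simp: monotone_on_def)
qed (auto simp: monotone_on_def)

lemma monotone_segment_iff:
  assumes "inj \<sigma>"
  shows "monotone_segment \<sigma> a b \<longleftrightarrow>
    (\<forall>i j. a \<le> i \<and> i < b \<and> a \<le> j \<and> j < b \<longrightarrow> (\<sigma> (Suc i) < \<sigma> i) = (\<sigma> (Suc j) < \<sigma> j))"
proof -
  have "\<sigma> i < \<sigma> (Suc i) \<longleftrightarrow> \<not> \<sigma> (Suc i) < \<sigma> i" for i
    using assms by (metis injD linorder_neqE_nat n_not_Suc_n not_less_iff_gr_or_eq)
  then show ?thesis
    unfolding monotone_segment_def strict_mono_on_iff_Suc strict_antimono_on_iff_Suc by metis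
qed

lemma runs_less:
  assumes "inj \<sigma>" "m < n" "(a, b) \<in> runs m n \<sigma>"
  shows "a < b"
proof (rule ccontr)
  assume "\<not> a < b"
  then have ab: "b = a" "m \<le> a" "a \<le> n" using assms(3) by (auto simp: runs_def)
  have max: "a' = a \<and> b' = b" if "m \<le> a'" "a' \<le> a" "b \<le> b'" "b' \<le> n" "monotone_segment \<sigma> a' b'" for a' b'
    using assms(3) that unfolding runs_def by blast
  have seg: "monotone_segment \<sigma> i (Suc i)" for i
    unfolding monotone_segment_iff[OF assms(1)] by (auto simp: less_Suc_eq_le)
  show False
  proof (cases "a = n")
    case True
    then obtain c where c: "n = Suc c" "m \<le> c" using assms(2) by (cases n) auto
    then show False using max[of c n] seg[of c] ab True by auto
  next
    case False
    then show False using max[of a "Suc a"] seg[of a] ab by auto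
  qed
qed

text \<open>A maximal segment starting neither at \<open>m\<close> nor just after a change of
  direction could be extended to the left. Conversely, the longest monotone segment from such a
  start is maximal on both sides.\<close>

lemma fst_runs:
  assumes inj: "inj \<sigma>" and "m < n"
  shows "fst ` runs m n \<sigma> = insert m (Suc ` {i. m \<le> i \<and> Suc i < n \<and>
    (\<sigma> (Suc i) < \<sigma> i) \<noteq> (\<sigma> (Suc (Suc i)) < \<sigma> (Suc i))})" (is "_ = insert m (Suc ` ?T)")
proof (intro equalityI subsetI)
  let ?d = "\<lambda>i. \<sigma> (Suc i) < \<sigma> i"
  fix a assume "a \<in> fst ` runs m n \<sigma>"
  then obtain b where ab: "(a, b) \<in> runs m n \<sigma>" by auto
  then have le: "m \<le> a" "b \<le> n" "monotone_segment \<sigma> a b" and lt: "a < b"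
    using runs_less[OF assms] by (auto simp: runs_def)
  have max: "a' = a \<and> b' = b" if "m \<le> a'" "a' \<le> a" "b \<le> b'" "b' \<le> n" "monotone_segment \<sigma> a' b'" for a' b'
    using ab that unfolding runs_def by blast
  show "a \<in> insert m (Suc ` ?T)"
  proof (cases "a = m")
    case False
    then obtain c where c: "a = Suc c" "m \<le> c" using le by (cases a) auto
    have "?d c \<noteq> ?d a"
    proof
      assume eq: "?d c = ?d a"
      have "monotone_segment \<sigma> c b"
        unfolding monotone_segment_iff[OF inj]
      proof (intro allI impI)
        fix i j assume ij: "c \<le> i \<and> i < b \<and> c \<le> j \<and> j < b"
        have in_run: "?d i = ?d a" if "a \<le> i" "i < b" for i
          using le(3) that lt unfolding monotone_segment_iff[OF inj] by blast
        have "?d i = ?d a" if "c \<le> i" "i < b" for i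
        proof (cases "i = c")
          case True
          then show ?thesis using eq by (simp only:)
        next
          case False
          then have "a \<le> i" using that c by simp
          then show ?thesis using that(2) by (rule in_run)
        qed
        from this[of i] this[of j] show "?d i = ?d j" using ij by (simp only:)
      qed
      then show False using max[of c b] le c by auto
    qed
    then show ?thesis using c lt le by auto
  qed simp
next
  let ?d = "\<lambda>i. \<sigma> (Suc i) < \<sigma> i"
  fix a assume a: "a \<in> insert m (Suc ` ?T)"
  then have a_lt: "a < n" "m \<le> a" using assms(2) by auto
  have a_turn: "?d (a - 1) \<noteq> ?d a" if "a \<noteq> m" using a that by auto
  define B where "B = {b. Suc a \<le> b \<and> b \<le> n \<and> monotone_segment \<sigma> a b}"
  have "Suc a \<in> B"
    using a_lt unfolding B_def monotone_segment_iff[OF inj] by (auto simp: less_Suc_eq_le)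
  moreover have "finite B" by (simp add: B_def)
  ultimately have b: "Max B \<in> B" "\<And>b. b \<in> B \<Longrightarrow> b \<le> Max B"
    using Max_in[of B] Max_ge[of B] by blast+
  have "(a, Max B) \<in> runs m n \<sigma>"
    unfolding runs_def
  proof (clarify, intro conjI allI impI)
    fix a' b' assume *: "m \<le> a' \<and> a' \<le> a \<and> Max B \<le> b' \<and> b' \<le> n \<and> monotone_segment \<sigma> a' b'"
    then have "b' \<in> B"
      using b(1) unfolding B_def monotone_segment_iff[OF inj] by (smt (verit) le_trans mem_Collect_eq)
    then show "b' = Max B" using b(2) * by (simp add: le_antisym)
    show "a' = a"
    proof (rule ccontr)
      assume "a' \<noteq> a"
      then have "a' < a" using * by simp
      then have "?d (a - 1) \<noteq> ?d a" using a_turn * by auto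
      moreover have "a < b'" using \<open>b' \<in> B\<close> by (simp add: B_def)
      moreover have "a' \<le> a - 1 \<and> a - 1 < b' \<and> a' \<le> a \<and> a < b'"
        using \<open>a' < a\<close> \<open>a < b'\<close> by auto
      ultimately show False
        using * unfolding monotone_segment_iff[OF inj] by blast
    qed
  qed (use b(1) a_lt in \<open>auto simp: B_def\<close>)
  then show "a \<in> fst ` runs m n \<sigma>" by force
qed

lemma card_runs:
  assumes "inj \<sigma>" "m < n"
  shows "card (runs m n \<sigma>) = Suc (card {i. m \<le> i \<and> Suc i < n \<and>
    (\<sigma> (Suc i) < \<sigma> i) \<noteq> (\<sigma> (Suc (Suc i)) < \<sigma> (Suc i))})" (is "_ = Suc (card ?T)")
proof -
  have "inj_on fst (runs m n \<sigma>)"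
  proof (rule inj_onI, clarify, simp)
    fix a b b' assume "(a, b) \<in> runs m n \<sigma>" "(a, b') \<in> runs m n \<sigma>"
    then show "b = b'" unfolding runs_def
      by (cases "b \<le> b'") (simp, metis order_refl, simp, metis order_refl linorder_le_cases)
  qed
  then have "card (runs m n \<sigma>) = card (insert m (Suc ` ?T))"
    using fst_runs[OF assms] by (metis card_image)
  moreover have "finite ?T" by (rule finite_subset[of _ "{..<n}"]) auto
  moreover have "m \<notin> Suc ` ?T" by auto
  ultimately show ?thesis by (simp add: card_image)
qed

lemma card_runs_1:
  assumes "n \<ge> 2" "\<sigma> permutes {1..n}"
  shows "card (runs 1 n \<sigma>) = 1 + turns n \<sigma>"
  using card_runs[OF permutes_inj[OF assms(2)], of 1 n] assms(1) by (simp add: turns_def)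

lemma changes_permutes:
  assumes "n \<ge> 2" "\<sigma> permutes {1..n}"
  shows "changes (\<lambda>i. \<sigma> (Suc i) < \<sigma> i) n = turns n \<sigma> + (if starts_down \<sigma> then 1 else 0)"
  using changes_eq_turns[of n "\<lambda>i. \<sigma> (Suc i) < \<sigma> i" \<sigma> False] assms permutes_0[OF assms(2)]
  by (simp add: starts_down_def numeral_2_eq_2)

lemma card_runs_0:
  assumes "n \<ge> 2" "\<sigma> permutes {1..n}"
  shows "card (runs 0 n \<sigma>) = run_count n False \<sigma>"
  using card_runs[OF permutes_inj[OF assms(2)], of 0 n] changes_permutes[OF assms] assms(1)
  by (simp add: changes_def run_count_def)

lemma first_run_direction:
  assumes "n \<ge> 2" "\<sigma> permutes {1..n}"
  shows "(\<exists>b. (1, b) \<in> runs 1 n \<sigma> \<and> strict_mono_on {1..b} \<sigma>) \<longleftrightarrow> \<not> starts_down \<sigma>"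
    and "(\<exists>b. (1, b) \<in> runs 1 n \<sigma> \<and> strict_antimono_on {1..b} \<sigma>) \<longleftrightarrow> starts_down \<sigma>"
proof -
  note inj = permutes_inj[OF assms(2)]
  have "(1 :: nat) \<in> fst ` runs 1 n \<sigma>"
    using fst_runs[OF inj, of 1 n] assms(1) by simp
  then obtain b where b: "(1, b) \<in> runs 1 n \<sigma>" by force
  have lt: "1 < b'" if "(1, b') \<in> runs 1 n \<sigma>" for b'
    using runs_less[OF inj _ that] assms(1) by simp
  have up: "\<not> starts_down \<sigma>" if "(1, b') \<in> runs 1 n \<sigma>" "strict_mono_on {1..b'} \<sigma>" for b'
    using that(2) lt[OF that(1)] unfolding strict_mono_on_iff_Suc starts_down_def
    by (auto simp: numeral_2_eq_2 dest!: spec[of _ 1])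
  have down: "starts_down \<sigma>" if "(1, b') \<in> runs 1 n \<sigma>" "strict_antimono_on {1..b'} \<sigma>" for b'
    using that(2) lt[OF that(1)] unfolding strict_antimono_on_iff_Suc starts_down_def
    by (auto simp: numeral_2_eq_2 dest!: spec[of _ 1])
  have "strict_mono_on {1..b} \<sigma> \<or> strict_antimono_on {1..b} \<sigma>"
    using b by (auto simp: runs_def monotone_segment_def)
  then show "(\<exists>b. (1, b) \<in> runs 1 n \<sigma> \<and> strict_mono_on {1..b} \<sigma>) \<longleftrightarrow> \<not> starts_down \<sigma>"
    "(\<exists>b. (1, b) \<in> runs 1 n \<sigma> \<and> strict_antimono_on {1..b} \<sigma>) \<longleftrightarrow> starts_down \<sigma>"
    using b up down by blast+
qed

text \<open>Rises and falls of \<open>d\<close> alternate and a rise comes first, so the rises are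
  the changes of odd rank.\<close>

lemma card_rises:
  assumes "\<not> d 0"
  shows "card {i. Suc i < Suc n \<and> \<not> d i \<and> d (Suc i)} = Suc (changes d (Suc n)) div 2"
proof (induction n)
  case (Suc n)
  have "{i. Suc i < Suc (Suc n) \<and> \<not> d i \<and> d (Suc i)} =
      (if \<not> d n \<and> d (Suc n) then insert n {i. Suc i < Suc n \<and> \<not> d i \<and> d (Suc i)}
       else {i. Suc i < Suc n \<and> \<not> d i \<and> d (Suc i)})"
    by (auto simp: less_Suc_eq)
  then have "card {i. Suc i < Suc (Suc n) \<and> \<not> d i \<and> d (Suc i)}
      = Suc (changes d (Suc n)) div 2 + (if \<not> d n \<and> d (Suc n) then 1 else 0)"
    using Suc by simp
  moreover have "odd (changes d (Suc n)) = d n" using odd_changes[of d n] assms by simp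
  ultimately show ?case
    by (cases "d n"; cases "d (Suc n)"; simp add: changes_Suc; presburger)
qed simp

text \<open>A left peak is an ascent followed by a descent, hence a rise of the descent indicator;
  the convention \<sigma> 0 = 0 makes the first bit False.\<close>

lemma card_left_peaks:
  assumes "n \<ge> 2" "\<sigma> permutes {1..n}"
  shows "card (left_peaks n \<sigma>) = run_count n False \<sigma> div 2"
proof -
  let ?d = "\<lambda>i. \<sigma> (Suc i) < \<sigma> i"
  have d: "\<sigma> i < \<sigma> (Suc i) \<longleftrightarrow> \<not> ?d i" for i
    using permutes_inj[OF assms(2)] by (metis injD linorder_neqE_nat n_not_Suc_n not_less_iff_gr_or_eq)
  have mem: "Suc i \<in> left_peaks n \<sigma> \<longleftrightarrow> Suc i < n \<and> \<not> ?d i \<and> ?d (Suc i)" "0 \<notin> left_peaks n \<sigma>" for i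
    by (simp_all add: left_peaks_def d)
  have "left_peaks n \<sigma> = Suc ` {i. Suc i < n \<and> \<not> ?d i \<and> ?d (Suc i)}"
  proof (rule set_eqI)
    fix i show "i \<in> left_peaks n \<sigma> \<longleftrightarrow> i \<in> Suc ` {i. Suc i < n \<and> \<not> ?d i \<and> ?d (Suc i)}"
      by (cases i) (auto simp: mem)
  qed
  then have "card (left_peaks n \<sigma>) = card {i. Suc i < n \<and> \<not> ?d i \<and> ?d (Suc i)}"
    by (simp add: card_image)
  also have "\<dots> = Suc (changes ?d n) div 2"
    using card_rises[of ?d "n - 1"] assms permutes_0[OF assms(2)] by simp
  finally show ?thesis using changes_permutes[OF assms] by (simp add: run_count_def)
qed

text \<open>The only possible extra left peak is position 1, present exactly when the word starts
  with a descent. The two run counts differ by one, in a direction governed by the same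
  condition.\<close>

lemma card_peaks:
  assumes "n \<ge> 2" "\<sigma> permutes {1..n}"
  shows "card (peaks n \<sigma>) = (run_count n True \<sigma> - 1) div 2"
proof -
  have eq: "left_peaks n \<sigma> = (if starts_down \<sigma> then insert 1 (peaks n \<sigma>) else peaks n \<sigma>)"
  proof (intro set_eqI iffI)
    fix i assume i: "i \<in> left_peaks n \<sigma>"
    then show "i \<in> (if starts_down \<sigma> then insert 1 (peaks n \<sigma>) else peaks n \<sigma>)"
      by (cases "i = 1") (auto simp: left_peaks_def peaks_def starts_down_def numeral_2_eq_2)
  next
    fix i assume i: "i \<in> (if starts_down \<sigma> then insert 1 (peaks n \<sigma>) else peaks n \<sigma>)"
    have "\<sigma> 1 \<in> {1..n}" using permutes_in_image[OF assms(2), of 1] assms(1) by simp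
    with i show "i \<in> left_peaks n \<sigma>"
      using assms(1) permutes_0[OF assms(2)]
      by (auto simp: left_peaks_def peaks_def starts_down_def numeral_2_eq_2 split: if_splits)
  qed
  have fin: "finite (peaks n \<sigma>)" by (rule finite_subset[of _ "{..<n}"]) (auto simp: peaks_def)
  have "1 \<notin> peaks n \<sigma>" by (simp add: peaks_def)
  then have "card (left_peaks n \<sigma>) = card (peaks n \<sigma>) + (if starts_down \<sigma> then 1 else 0)"
    using fin by (simp add: eq)
  then show ?thesis using card_left_peaks[OF assms] by (auto simp: run_count_def split: if_splits)
qed

section \<open>Bases of orthogonal idempotents\<close>

lemma class_function_in_span:
  fixes lab :: "(nat \<Rightarrow> nat) \<Rightarrow> 'b"
  assumes "\<And>\<sigma>. \<not> \<sigma> permutes {1..n} \<Longrightarrow> f \<sigma> = 0"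
    and "\<And>\<sigma> \<tau>. \<sigma> permutes {1..n} \<Longrightarrow> \<tau> permutes {1..n} \<Longrightarrow> lab \<sigma> = lab \<tau> \<Longrightarrow> f \<sigma> = f \<tau>"
    and "finite C" "\<And>\<sigma>. \<sigma> permutes {1..n} \<Longrightarrow> lab \<sigma> \<in> C"
  shows "f \<in> ratfun.span ((\<lambda>c. perm_sum n (\<lambda>\<sigma>. lab \<sigma> = c)) ` C)"
proof -
  define val where "val c = f (SOME \<sigma>. \<sigma> permutes {1..n} \<and> lab \<sigma> = c)" for c
  have val: "val (lab \<sigma>) = f \<sigma>" if "\<sigma> permutes {1..n}" for \<sigma>
    using someI[of "\<lambda>\<tau>. \<tau> permutes {1..n} \<and> lab \<tau> = lab \<sigma>" \<sigma>] that
    unfolding val_def by (intro assms(2)) auto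
  have "f = (\<Sum>c\<in>C. scaleQ (val c) (perm_sum n (\<lambda>\<sigma>. lab \<sigma> = c)))"
  proof
    fix \<sigma>
    show "f \<sigma> = (\<Sum>c\<in>C. scaleQ (val c) (perm_sum n (\<lambda>\<sigma>. lab \<sigma> = c))) \<sigma>"
    proof (cases "\<sigma> permutes {1..n}")
      case True
      then have "(\<Sum>c\<in>C. scaleQ (val c) (perm_sum n (\<lambda>\<sigma>. lab \<sigma> = c))) \<sigma>
          = (\<Sum>c\<in>C. if lab \<sigma> = c then val c else 0)"
        unfolding sum_galg_apply by (intro sum.cong) (auto simp: scaleQ_def perm_sum_def)
      also have "\<dots> = f \<sigma>"
        using True assms(3,4) val by simp
      finally show ?thesis ..
    next
      case False
      then show ?thesis
        using assms(1) by (simp add: sum_galg_apply scaleQ_def perm_sum_def)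
    qed
  qed
  then show ?thesis
    by (simp only:) (intro ratfun.span_sum ratfun.span_scale ratfun.span_base imageI)
qed

text \<open>Multiplying a linear relation by one of the idempotents isolates its coefficient, so
  nonzero orthogonal idempotents are independent. The classes span the algebra and are no more
  numerous than the idempotents, which forces spanning.\<close>

lemma orthogonal_idempotent_basisI:
  fixes lab :: "(nat \<Rightarrow> nat) \<Rightarrow> 'b" and e :: "'i \<Rightarrow> galg"
  assumes A: "A = ratfun.span ((\<lambda>c. perm_sum n (\<lambda>\<sigma>. lab \<sigma> = c)) ` C)"
    and C: "finite C" "\<And>\<sigma>. \<sigma> permutes {1..n} \<Longrightarrow> lab \<sigma> \<in> C"
    and X: "finite X" "card C \<le> card X"
    and supp: "\<And>i \<sigma>. i \<in> X \<Longrightarrow> \<not> \<sigma> permutes {1..n} \<Longrightarrow> e i \<sigma> = 0"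
    and cls: "\<And>i \<sigma> \<tau>. i \<in> X \<Longrightarrow> \<sigma> permutes {1..n} \<Longrightarrow> \<tau> permutes {1..n} \<Longrightarrow> lab \<sigma> = lab \<tau> \<Longrightarrow> e i \<sigma> = e i \<tau>"
    and nz: "\<And>i. i \<in> X \<Longrightarrow> e i \<noteq> 0"
    and mult: "\<And>i j. i \<in> X \<Longrightarrow> j \<in> X \<Longrightarrow> gmult n (e i) (e j) = (if i = j then e i else 0)"
  shows "orthogonal_idempotent_basis n A X e"
proof -
  have in_A: "e i \<in> A" if "i \<in> X" for i
    unfolding A
    by (rule class_function_in_span[OF supp[OF that] cls[OF that] C(1) C(2)])
  have inj: "inj_on e X"
  proof (rule inj_onI, rule ccontr)
    fix i j assume ij: "i \<in> X" "j \<in> X" "e i = e j" "i \<noteq> j"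
    have "gmult n (e i) (e i) = e i" using mult[of i i] ij by simp
    moreover have "gmult n (e i) (e j) = 0" using mult[of i j] ij by simp
    ultimately show False using nz ij by simp
  qed
  have indep: "ratfun.independent (e ` X)"
    unfolding ratfun.dependent_finite[OF finite_imageI[OF X(1)]]
  proof
    assume "\<exists>u. (\<exists>v\<in>e ` X. u v \<noteq> 0) \<and> (\<Sum>v\<in>e ` X. scaleQ (u v) v) = 0"
    then obtain u j where u: "j \<in> X" "u (e j) \<noteq> 0" "(\<Sum>v\<in>e ` X. scaleQ (u v) v) = 0" by auto
    then have "(\<Sum>i\<in>X. scaleQ (u (e i)) (e i)) = 0"
      using inj by (simp add: sum.reindex)
    then have "0 = gmult n (\<Sum>i\<in>X. scaleQ (u (e i)) (e i)) (e j)"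
      by (simp only: gmult_simps)
    also have "\<dots> = (\<Sum>i\<in>X. if i = j then scaleQ (u (e i)) (e i) else 0)"
      unfolding gmult_sum_left gmult_simps
      by (intro sum.cong refl) (use mult u(1) in \<open>auto simp: scaleQ_def fun_eq_iff\<close>)
    also have "\<dots> = scaleQ (u (e j)) (e j)" using X(1) u(1) by (simp only: sum.delta if_True)
    finally show False using u nz by (auto simp: scaleQ_def fun_eq_iff)
  qed
  have "ratfun.span (e ` X) = A"
  proof
    show "ratfun.span (e ` X) \<subseteq> A"
      using in_A unfolding A by (intro ratfun.span_minimal ratfun.subspace_span) auto
    show "A \<subseteq> ratfun.span (e ` X)"
    proof (rule subsetI, rule ccontr)
      fix x assume x: "x \<in> A" "x \<notin> ratfun.span (e ` X)"
      then have notin: "x \<notin> e ` X" using ratfun.span_base by blast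
      have "ratfun.independent (insert x (e ` X))"
        using x indep notin by (simp add: ratfun.independent_insert)
      moreover have "insert x (e ` X) \<subseteq> ratfun.span ((\<lambda>c. perm_sum n (\<lambda>\<sigma>. lab \<sigma> = c)) ` C)"
        using x(1) in_A unfolding A by auto
      ultimately have "card (insert x (e ` X)) \<le> card ((\<lambda>c. perm_sum n (\<lambda>\<sigma>. lab \<sigma> = c)) ` C)"
        using ratfun.independent_span_bound C(1) by blast
      also have "\<dots> \<le> card X" using X(2) card_image_le[OF C(1)] le_trans by blast
      finally show False using notin X(1) inj by (simp add: card_image)
    qed
  qed
  with inj indep mult show ?thesis
    by (simp add: orthogonal_idempotent_basis_def)
qed

section \<open>Symmetric functions\<close>

lemma pcoeff_simps [simp]:
  "pcoeff 0 m = 0" "pcoeff (f + g) m = pcoeff f m + pcoeff g m"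
  "pcoeff (f - g) m = pcoeff f m - pcoeff g m" "pcoeff (- f) m = - pcoeff f m"
  "pcoeff (ps_scale c f) m = c * pcoeff f m"
  by (transfer; simp)+

lemma pcoeff_sum: "pcoeff (\<Sum>x\<in>X. f x) m = (\<Sum>x\<in>X. pcoeff (f x) m)"
  by (induction X rule: infinite_finite_induct) auto

lemma ps_scale_mult_left: "ps_scale c f * g = ps_scale c (f * g)"
  by (rule pseries_eqI) (simp add: times_pseries.rep_eq ps_scale.rep_eq sum_distrib_left case_prod_unfold mult.assoc)

definition ps_const :: "rat \<Rightarrow> pseries" where
  "ps_const c = ps_scale c 1"

lemma ps_scale_eq: "ps_scale c f = ps_const c * f"
  by (simp add: ps_const_def ps_scale_mult_left)

lemma ps_const_hom [simp]: "ps_const 0 = 0" "ps_const 1 = 1"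
  "ps_const (a + b) = ps_const a + ps_const b" "ps_const (a - b) = ps_const a - ps_const b"
  "ps_const (- a) = - ps_const a"
  by (rule pseries_eqI, simp add: ps_const_def algebra_simps)+

lemma ps_const_mult: "ps_const (a * b) = ps_const a * ps_const b"
  unfolding ps_scale_eq[of a, symmetric] by (rule pseries_eqI) (simp add: ps_const_def)

lemma ps_const_sum: "ps_const (\<Sum>x\<in>X. f x) = (\<Sum>x\<in>X. ps_const (f x))"
  by (induction X rule: infinite_finite_induct) auto

lemma ps_const_of_nat: "ps_const (of_nat n) = of_nat n"
  by (induction n) auto

lemma of_nat_mult_cancel_pseries:
  assumes "of_nat n * f = of_nat n * (g :: pseries)" "n > 0"
  shows "f = g"
proof (rule pseries_eqI)
  fix m
  have "pcoeff (ps_scale (of_nat n) f) m = pcoeff (ps_scale (of_nat n) g) m"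
    using assms(1) by (simp only: ps_scale_eq ps_const_of_nat)
  then show "pcoeff f m = pcoeff g m" using assms(2) by simp
qed

subsection \<open>Ribbon functions\<close>

text \<open>The ribbon function of \<open>comp_aux a w\<close>, computed by peeling off the first
  part: \<open>complete_hom a\<close> times a ribbon is the ribbon with a new part \<open>a\<close>
  in front plus the one with \<open>a\<close> added to its first part.\<close>

fun rib :: "nat \<Rightarrow> bool list \<Rightarrow> pseries" where
  "rib a [] = complete_hom a"
| "rib a (b # w) = (if b then complete_hom a * rib (Suc 0) w - rib (Suc a) w else rib (Suc a) w)"

lemma rib_mult: "rib a u * rib (Suc 0) v = rib a (u @ True # v) + rib a (u @ False # v)"
  by (induction a u rule: rib.induct) (auto simp: algebra_simps)

lemma length_comp_aux: "length (comp_aux a w) = Suc (length (filter id w))"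
  by (induction w arbitrary: a) auto

definition subwords :: "bool list \<Rightarrow> bool list set" where
  "subwords v = {w. list_all2 (\<longrightarrow>) w v}"

text \<open>Passing to a coarser composition deletes descents, that is, clears bits of the
  word.\<close>

lemma coarser_comp_aux:
  assumes "a > 0"
  shows "{J. J \<in> compositions (sum_list (comp_aux a v)) \<and> comp_descents J \<subseteq> comp_descents (comp_aux a v)}
    = comp_aux a ` subwords v"
proof (intro equalityI subsetI)
  fix J assume "J \<in> comp_aux a ` subwords v"
  then obtain w where w: "J = comp_aux a w" "list_all2 (\<longrightarrow>) w v" by (auto simp: subwords_def)
  then have "length w = length v" "\<And>i. i < length v \<Longrightarrow> w ! i \<Longrightarrow> v ! i"
    by (auto simp: list_all2_conv_all_nth)
  then show "J \<in> {J. J \<in> compositions (sum_list (comp_aux a v)) \<and> comp_descents J \<subseteq> comp_descents (comp_aux a v)}"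
    using assms unfolding w(1) by (auto simp: compositions_def is_composition_comp_aux comp_descents_comp_aux)
next
  fix J assume "J \<in> {J. J \<in> compositions (sum_list (comp_aux a v)) \<and> comp_descents J \<subseteq> comp_descents (comp_aux a v)}"
  then have J: "J \<in> compositions (a + length v)" "comp_descents J \<subseteq> comp_descents (comp_aux a v)" by auto
  have "J \<in> comp_aux (Suc 0) ` {w. length w = a + length v - 1}"
    using bij_betw_imp_surj_on[OF bij_betw_comp_aux[of "a + length v"]] J(1) assms by simp
  then obtain w where w: "length w = a + length v - 1" "J = comp_aux (Suc 0) w" by auto
  have sub: "\<exists>j<length v. Suc i = a + j \<and> v ! j" if "i < length w" "w ! i" for i
    using J(2) that unfolding w(2) comp_descents_comp_aux by auto
  \<comment> \<open>The coarser composition has no descent below \<open>a\<close>, so its first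
    \<open>a - 1\<close> bits only build up the accumulated part.\<close>
  have "take (a - 1) w = replicate (a - 1) False"
  proof (rule nth_equalityI)
    fix i assume "i < length (take (a - 1) w)"
    then show "take (a - 1) w ! i = replicate (a - 1) False ! i"
      using sub[of i] by auto
  qed (use w assms in auto)
  then have "w = replicate (a - 1) False @ drop (a - 1) w"
    by (metis append_take_drop_id)
  then have "J = comp_aux (Suc 0) (replicate (a - 1) False @ drop (a - 1) w)"
    using w(2) by simp
  then have "J = comp_aux a (drop (a - 1) w)"
    using assms by (simp add: comp_aux_replicate)
  moreover have "drop (a - 1) w \<in> subwords v"
    unfolding subwords_def mem_Collect_eq list_all2_conv_all_nth
  proof (intro conjI allI impI)
    fix i assume "i < length (drop (a - 1) w)" "drop (a - 1) w ! i"
    then show "v ! i" using sub[of "a - 1 + i"] assms by auto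
  qed (use w assms in auto)
  ultimately show "J \<in> comp_aux a ` subwords v" by blast
qed

lemma inj_on_comp_aux: "inj_on (comp_aux a) A"
  using comp_aux_inj by (auto intro: inj_onI)

lemma subwords_Nil: "subwords [] = {[]}"
  by (auto simp: subwords_def)

lemma subwords_Cons: "subwords (b # v) = (#) False ` subwords v \<union> (if b then (#) True ` subwords v else {})"
  by (auto simp: subwords_def list_all2_Cons2)

lemma finite_subwords [simp]: "finite (subwords v)"
  by (induction v) (auto simp: subwords_Nil subwords_Cons)

lemma subwords_length_filter: "w \<in> subwords v \<Longrightarrow> length (filter id w) \<le> length (filter id v)"
  by (induction v arbitrary: w) (auto simp: subwords_Nil subwords_Cons split: if_splits intro: le_SucI)

text \<open>The alternating sum splits at the first True bit: keeping it splits off a factor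
  \<open>complete_hom a\<close>, clearing it costs a sign and enlarges the first part.\<close>

lemma ribbon_schur_comp_aux:
  assumes "a > 0"
  shows "ribbon_schur (comp_aux a v) = rib a v"
proof -
  define S where "S a v = (\<Sum>w\<in>subwords v. (-1) ^ (length (filter id v) - length (filter id w)) * h_comp (comp_aux a w))" for a v
  have "ribbon_schur (comp_aux a v) = S a v"
    using assms by (simp add: ribbon_schur_def coarser_comp_aux sum.reindex inj_on_comp_aux length_comp_aux S_def
        del: sum_list_comp_aux)
  moreover have "S a v = rib a v"
  proof (induction v arbitrary: a)
    case Nil
    show ?case by (simp add: S_def subwords_Nil h_comp_def)
  next
    case (Cons b v)
    have F: "(\<Sum>w\<in>(#) False ` subwords v. (-1) ^ (k - length (filter id w)) * h_comp (comp_aux a w))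
        = (\<Sum>w\<in>subwords v. (-1) ^ (k - length (filter id w)) * h_comp (comp_aux (Suc a) w))" for k
      by (simp add: sum.reindex)
    show ?case
    proof (cases b)
      case False
      then show ?thesis
        using Cons[of "Suc a"] F[of "length (filter id v)"] by (simp add: S_def subwords_Cons)
    next
      case True
      have "S a (True # v) = (\<Sum>w\<in>(#) False ` subwords v. (-1) ^ (Suc (length (filter id v)) - length (filter id w)) * h_comp (comp_aux a w))
          + (\<Sum>w\<in>(#) True ` subwords v. (-1) ^ (Suc (length (filter id v)) - length (filter id w)) * h_comp (comp_aux a w))"
        unfolding S_def subwords_Cons by (simp, subst sum.union_disjoint) auto
      also have "\<dots> = (\<Sum>w\<in>subwords v. - ((-1) ^ (length (filter id v) - length (filter id w)) * h_comp (comp_aux (Suc a) w)))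
          + (\<Sum>w\<in>subwords v. (-1) ^ (length (filter id v) - length (filter id w)) * (complete_hom a * h_comp (comp_aux (Suc 0) w)))"
      proof (rule arg_cong2[where f = "(+)"])
        show "(\<Sum>w\<in>(#) False ` subwords v. (-1) ^ (Suc (length (filter id v)) - length (filter id w)) * h_comp (comp_aux a w))
            = (\<Sum>w\<in>subwords v. - ((-1) ^ (length (filter id v) - length (filter id w)) * h_comp (comp_aux (Suc a) w)))"
          unfolding F by (intro sum.cong refl) (simp add: Suc_diff_le subwords_length_filter)
      qed (simp add: sum.reindex h_comp_def)
      also have "\<dots> = - S (Suc a) v + complete_hom a * S (Suc 0) v"
        by (simp add: S_def sum_negf sum_distrib_left mult.left_commute)
      finally show ?thesis using True Cons by simp
    qed
  qed
  ultimately show ?thesis by simp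
qed

subsection \<open>The map to symmetric functions\<close>

text \<open>Gamma on the completion, as a generating function whose coefficient at \<open>n\<close>
  is the image of the degree-\<open>n\<close> component. Each composition is represented by its word
  with first bit True, which suits head-free series.\<close>

definition Gam :: "wseries \<Rightarrow> pseries fps" where
  "Gam f = Abs_fps (\<lambda>n. if n = 0 then ps_const (wcoeff f [])
     else (\<Sum>v | length v = n - 1. ps_const (wcoeff f (True # v)) * rib (Suc 0) v))"

lemma finite_words [simp]: "finite {v :: bool list. length v = n}"
  using finite_lists_length_eq[of "UNIV :: bool set" n] by simp

lemma Gam_nth_0 [simp]: "Gam f $ 0 = ps_const (wcoeff f [])"
  by (simp add: Gam_def)

lemma Gam_nth_Suc: "Gam f $ Suc n = (\<Sum>v | length v = n. ps_const (wcoeff f (True # v)) * rib (Suc 0) v)"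
  by (simp add: Gam_def)

lemma Gam_nth_cong:
  assumes "\<And>w. length w \<le> N \<Longrightarrow> wcoeff f w = wcoeff g w" "n \<le> N"
  shows "Gam f $ n = Gam g $ n"
  using assms by (cases n) (auto simp: Gam_nth_Suc intro!: sum.cong)

lemma Gam_add: "Gam (f + g) = Gam f + Gam g"
  by (rule fps_ext) (simp add: Gam_def sum.distrib algebra_simps)

lemma Gam_diff: "Gam (f - g) = Gam f - Gam g"
  by (rule fps_ext) (simp add: Gam_def sum_subtractf algebra_simps)

lemma Gam_wconst: "Gam (wconst c * f) = fps_const (ps_const c) * Gam f"
  by (rule fps_ext) (simp add: Gam_def ps_const_mult sum_distrib_left mult.assoc)

lemma Gam_zero [simp]: "Gam 0 = 0"
  by (rule fps_ext) (simp add: Gam_def)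

lemma Gam_sum: "Gam (\<Sum>x\<in>X. f x) = (\<Sum>x\<in>X. Gam (f x))"
  by (induction X rule: infinite_finite_induct) (auto simp: Gam_add)

lemma Gam_one [simp]: "Gam 1 = 1"
  by (rule fps_ext) (simp add: Gam_def wcoeff_one)

lemma sum_words_split:
  fixes F :: "bool list \<Rightarrow> pseries"
  assumes "c < m"
  shows "(\<Sum>v | length v = m. F v) = (\<Sum>u | length u = c. \<Sum>v | length v = m - Suc c. F (u @ True # v) + F (u @ False # v))"
proof -
  have "(\<Sum>u | length u = c. \<Sum>v | length v = m - Suc c. F (u @ True # v) + F (u @ False # v))
      = (\<Sum>(u, b, v)\<in>{u. length u = c} \<times> UNIV \<times> {v. length v = m - Suc c}. F (u @ b # v))"
    by (simp add: sum.cartesian_product[symmetric] UNIV_bool sum.distrib algebra_simps)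
  also have "\<dots> = (\<Sum>v | length v = m. F v)"
    by (rule sum.reindex_bij_witness[where i = "\<lambda>w. (take c w, w ! c, drop (Suc c) w)" and j = "\<lambda>(u, b, v). u @ b # v"])
       (use assms in \<open>auto simp: id_take_nth_drop[symmetric] nth_append\<close>)
  finally show ?thesis ..
qed

text \<open>At an interior cut the right factor does not depend on the bit at the cut; summing over
  its two values gives the two ribbons of \<open>rib_mult\<close>, hence a product.\<close>

lemma Gam_mult:
  assumes "head_free f" "head_free g"
  shows "Gam (f * g) = Gam f * Gam g"
proof (rule fps_ext)
  fix n
  show "Gam (f * g) $ n = (Gam f * Gam g) $ n"
  proof (cases n)
    case 0
    then show ?thesis by (simp add: ps_const_mult)
  next
    case (Suc m)
    define T where "T c v = ps_const (wcoeff f (True # take c v)) * ps_const (wcoeff g (drop c v)) * rib (Suc 0) v" for c v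
    have "Gam (f * g) $ n = (\<Sum>v | length v = m. ps_const (wcoeff f []) * (ps_const (wcoeff g (True # v)) * rib (Suc 0) v)
        + (\<Sum>c\<le>m. T c v))"
      unfolding Suc Gam_nth_Suc
    proof (intro sum.cong refl)
      fix v :: "bool list" assume "v \<in> {v. length v = m}"
      then have "wcoeff (f * g) (True # v) = wcoeff f [] * wcoeff g (True # v)
          + (\<Sum>c\<le>m. wcoeff f (True # take c v) * wcoeff g (drop c v))"
        unfolding wcoeff_mult by (simp add: sum.atMost_Suc_shift del: sum.atMost_Suc)
      then show "ps_const (wcoeff (f * g) (True # v)) * rib (Suc 0) v
          = ps_const (wcoeff f []) * (ps_const (wcoeff g (True # v)) * rib (Suc 0) v) + (\<Sum>c\<le>m. T c v)"
        by (simp add: T_def ps_const_mult ps_const_sum distrib_right sum_distrib_right mult.assoc)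
    qed
    also have "\<dots> = Gam f $ 0 * Gam g $ n + (\<Sum>c\<le>m. \<Sum>v | length v = m. T c v)"
      unfolding sum.distrib by (subst sum.swap) (simp add: Suc Gam_nth_Suc sum_distrib_left)
    also have "(\<Sum>c\<le>m. \<Sum>v | length v = m. T c v) = (\<Sum>c\<le>m. Gam f $ Suc c * Gam g $ (m - c))"
    proof (intro sum.cong refl)
      fix c assume c: "c \<in> {..m}"
      show "(\<Sum>v | length v = m. T c v) = Gam f $ Suc c * Gam g $ (m - c)"
      proof (cases "c = m")
        case True
        then show ?thesis
          by (simp add: Gam_nth_Suc T_def sum_distrib_left mult_ac)
      next
        case False
        with c have lt: "c < m" by simp
        then have mc: "m - c = Suc (m - Suc c)" by simp
        have "(\<Sum>v | length v = m. T c v) = (\<Sum>u | length u = c. \<Sum>v | length v = m - Suc c. T c (u @ True # v) + T c (u @ False # v))"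
          using sum_words_split[OF lt] .
        also have "\<dots> = (\<Sum>u | length u = c. \<Sum>v | length v = m - Suc c.
            (ps_const (wcoeff f (True # u)) * rib (Suc 0) u) * (ps_const (wcoeff g (True # v)) * rib (Suc 0) v))"
        proof (intro sum.cong refl)
          fix u v :: "bool list" assume "u \<in> {u. length u = c}" "v \<in> {v. length v = m - Suc c}"
          then have "T c (u @ b # v) = ps_const (wcoeff f (True # u)) * ps_const (wcoeff g (True # v)) * rib (Suc 0) (u @ b # v)" for b
            using head_free_Cons[OF assms(2), of b v True] by (simp add: T_def)
          then have "T c (u @ True # v) + T c (u @ False # v) = ps_const (wcoeff f (True # u)) * ps_const (wcoeff g (True # v))
              * (rib (Suc 0) u * rib (Suc 0) v)"
            unfolding rib_mult by (simp add: distrib_left)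
          then show "T c (u @ True # v) + T c (u @ False # v) =
              (ps_const (wcoeff f (True # u)) * rib (Suc 0) u) * (ps_const (wcoeff g (True # v)) * rib (Suc 0) v)"
            by (simp add: mult_ac)
        qed
        also have "\<dots> = Gam f $ Suc c * Gam g $ (m - c)"
          unfolding mc Gam_nth_Suc by (simp add: sum_product)
        finally show ?thesis .
      qed
    qed
    also have "Gam f $ 0 * Gam g $ n + (\<Sum>c\<le>m. Gam f $ Suc c * Gam g $ (m - c)) = (Gam f * Gam g) $ n"
      unfolding fps_mult_nth Suc atLeast0AtMost sum.atMost_Suc_shift by simp
    finally show ?thesis .
  qed
qed

lemma head_free_diff: "head_free f \<Longrightarrow> head_free g \<Longrightarrow> head_free (f - g)"
  by (auto simp: head_free_def) metis

lemma head_free_wconst: "head_free f \<Longrightarrow> head_free (wconst c * f)"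
  by (auto simp: head_free_def)

lemma head_free_power: "head_free f \<Longrightarrow> head_free (f ^ m)"
  by (induction m) (auto simp: head_free_one head_free_mult)

lemma head_free_ev: "head_free f \<Longrightarrow> head_free (ev f p)"
  using head_free_Cons[OF head_free_power[of f]] unfolding head_free_def wcoeff_ev
  by (auto intro!: sum.cong simp del: sum.atMost_Suc)

lemma head_free_grade_sgn: "head_free f \<Longrightarrow> head_free (grade_sgn f)"
  by (simp add: head_free_def wcoeff_grade_sgn)

lemma Gam_power:
  assumes "head_free f"
  shows "Gam (f ^ m) = Gam f ^ m"
  by (induction m) (use assms in \<open>auto simp: Gam_mult head_free_power\<close>)

text \<open>The chain rule, available because the target is commutative. In each degree only
  finitely many powers of \<open>f\<close> contribute, so it reduces to the polynomials
  \<open>P\<close>.\<close>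

lemma fps_deriv_Gam_ev:
  assumes "head_free f" "wcoeff f [] = 0"
  shows "fps_deriv (Gam (ev f p)) = Gam (ev f (fps_deriv p)) * fps_deriv (Gam f)"
proof (rule fps_ext)
  fix n
  define P where "P q N = (\<Sum>m\<le>N. fps_const (ps_const (q $ m)) * Gam f ^ m)" for q N
  have P: "Gam (ev f q) $ i = P q N $ i" if "i \<le> N" for q i N
  proof -
    have "Gam (ev f q) $ i = Gam (\<Sum>m\<le>N. wconst (q $ m) * f ^ m) $ i"
      by (rule Gam_nth_cong[OF _ that]) (rule wcoeff_ev'[OF assms(2)])
    then show ?thesis
      by (simp add: P_def Gam_sum Gam_wconst Gam_power[OF assms(1)])
  qed
  have "fps_deriv (Gam (ev f p)) $ n = fps_deriv (P p (Suc n)) $ n"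
    using P[of "Suc n" "Suc n" p] by simp
  also have "fps_deriv (P p (Suc n)) = P (fps_deriv p) n * fps_deriv (Gam f)"
  proof -
    have "fps_deriv (fps_const (ps_const (p $ Suc i)) * Gam f ^ Suc i)
        = fps_const (ps_const (fps_deriv p $ i)) * Gam f ^ i * fps_deriv (Gam f)" for i
      unfolding fps_deriv_mult fps_deriv_power fps_deriv_nth ps_const_mult
      by (simp add: ps_const_of_nat mult_ac del: of_nat_Suc power_Suc flip: fps_const_mult)
    then show ?thesis
      unfolding P_def sum.atMost_Suc_shift fps_deriv_add fps_deriv_sum sum_distrib_right by simp
  qed
  also have "(P (fps_deriv p) n * fps_deriv (Gam f)) $ n = (Gam (ev f (fps_deriv p)) * fps_deriv (Gam f)) $ n"
    unfolding fps_mult_nth by (intro sum.cong refl) (simp add: P[of _ n])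
  finally show "fps_deriv (Gam (ev f p)) $ n = (Gam (ev f (fps_deriv p)) * fps_deriv (Gam f)) $ n" .
qed

lemma Gamma_map_homog:
  assumes "n > 0"
  shows "Gamma_map (homog n F) = Gam (word_series F) $ n"
proof -
  have "Gamma_map (homog n F) = (\<Sum>I\<in>compositions n. ps_scale (homog n F I) (ribbon_schur I))"
    unfolding Gamma_map_def
  proof (rule sum.mono_neutral_left)
    show "{I. is_composition I \<and> homog n F I \<noteq> 0} \<subseteq> compositions n"
      by (auto simp: homog_def)
    show "\<forall>I\<in>compositions n - {I. is_composition I \<and> homog n F I \<noteq> 0}. ps_scale (homog n F I) (ribbon_schur I) = 0"
      by (auto simp: compositions_def ps_scale_eq)
  qed simp
  also have "\<dots> = (\<Sum>I\<in>compositions n. ps_const (F I) * ribbon_schur I)"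
    by (intro sum.cong refl) (simp add: homog_def ps_scale_eq)
  also have "\<dots> = (\<Sum>v | length v = n - 1. ps_const (F (comp_aux (Suc 0) v)) * ribbon_schur (comp_aux (Suc 0) v))"
    by (rule sum.reindex_bij_betw[OF bij_betw_comp_aux[OF assms], symmetric])
  also have "\<dots> = Gam (word_series F) $ n"
    using assms by (simp add: Gam_def ribbon_schur_comp_aux)
  finally show ?thesis .
qed

subsection \<open>Newton's identities\<close>

lemma monom_degree_add: "monom_degree (a + b) = monom_degree a + monom_degree b"
proof -
  have deg: "monom_degree c = (\<Sum>i\<in>A. Poly_Mapping.lookup c i)" if "finite A" "Poly_Mapping.keys c \<subseteq> A" for A c
    unfolding monom_degree_def using that by (intro sum.mono_neutral_left) (auto simp: in_keys_iff)
  let ?A = "Poly_Mapping.keys a \<union> Poly_Mapping.keys b"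
  show ?thesis
    using deg[of ?A a] deg[of ?A b] deg[of ?A "a + b"] Poly_Mapping.keys_add[of a b]
    by (simp add: lookup_add sum.distrib)
qed

lemma monom_degree_single: "monom_degree (Poly_Mapping.single i r) = r"
  by (cases "r = 0") (simp_all add: monom_degree_def)

lemma pcoeff_power_sum_mult_complete_hom:
  assumes "r > 0"
  shows "pcoeff (power_sum r * complete_hom s) m =
    (if monom_degree m = r + s then of_nat (card {i \<in> Poly_Mapping.keys m. r \<le> Poly_Mapping.lookup m i}) else 0)"
proof -
  define D where "D = {(a, b). a + b = m}"
  define I where "I = {i \<in> Poly_Mapping.keys m. r \<le> Poly_Mapping.lookup m i}"
  define B where "B = {(a, b) \<in> D. (\<exists>i. a = Poly_Mapping.single i r) \<and> monom_degree b = s}"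
  have fin: "finite D" unfolding D_def by (rule finite_add_decompositions)
  have split: "Poly_Mapping.single i r + (m - Poly_Mapping.single i r) = m" if "r \<le> Poly_Mapping.lookup m i" for i
    using that by (intro poly_mapping_eqI) (auto simp: lookup_add lookup_minus lookup_single when_def)
  have "pcoeff (power_sum r * complete_hom s) m = (\<Sum>p\<in>D. if p \<in> B then 1 else 0)"
    unfolding times_pseries.rep_eq power_sum.rep_eq complete_hom.rep_eq D_def[symmetric]
    by (intro sum.cong refl) (auto simp: B_def split: if_splits)
  also have "\<dots> = of_nat (card B)"
    using fin by (subst sum.inter_filter[symmetric]) (auto simp: B_def intro!: arg_cong[of _ _ card])
  also have "card B = (if monom_degree m = r + s then card I else 0)"
  proof (cases "monom_degree m = r + s")
    case True
    have "bij_betw (\<lambda>i. (Poly_Mapping.single i r, m - Poly_Mapping.single i r)) I B"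
    proof (rule bij_betw_imageI)
      show "inj_on (\<lambda>i. (Poly_Mapping.single i r, m - Poly_Mapping.single i r)) I"
        using assms by (intro inj_onI) (metis Pair_inject lookup_single_eq lookup_single_not_eq less_irrefl)
      show "(\<lambda>i. (Poly_Mapping.single i r, m - Poly_Mapping.single i r)) ` I = B"
      proof (intro equalityI subsetI)
        fix p assume "p \<in> (\<lambda>i. (Poly_Mapping.single i r, m - Poly_Mapping.single i r)) ` I"
        then obtain i where i: "i \<in> I" "p = (Poly_Mapping.single i r, m - Poly_Mapping.single i r)" by auto
        then have *: "Poly_Mapping.single i r + (m - Poly_Mapping.single i r) = m"
          by (intro split) (simp add: I_def)
        then have "monom_degree m = r + monom_degree (m - Poly_Mapping.single i r)"
          by (metis monom_degree_add monom_degree_single)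
        with * i True show "p \<in> B" by (auto simp: B_def D_def)
      next
        fix p assume "p \<in> B"
        then obtain i b where p: "p = (Poly_Mapping.single i r, b)" "Poly_Mapping.single i r + b = m"
          by (auto simp: B_def D_def)
        then have "r \<le> Poly_Mapping.lookup m i" by (auto simp: lookup_add)
        then have "i \<in> I" using assms by (auto simp: I_def in_keys_iff)
        moreover have "b = m - Poly_Mapping.single i r" using p by auto
        ultimately show "p \<in> (\<lambda>i. (Poly_Mapping.single i r, m - Poly_Mapping.single i r)) ` I" using p by auto
      qed
    qed
    then show ?thesis using True bij_betw_same_card by fastforce
  next
    case False
    then have "B = {}"
      by (auto simp: B_def D_def monom_degree_add monom_degree_single)
    then show ?thesis using False by simp
  qed
  finally show ?thesis by (simp add: I_def)
qed

text \<open>On a monomial of degree \<open>n\<close>, the \<open>r\<close>-th summand counts the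
  variables with exponent at least \<open>r\<close>; a variable is thus counted as often as its
  exponent says, in total \<open>n\<close> times.\<close>

lemma newton_complete_hom: "of_nat n * complete_hom n = (\<Sum>r\<in>{1..n}. power_sum r * complete_hom (n - r))"
proof (rule pseries_eqI)
  fix m
  have lhs: "pcoeff (of_nat n * complete_hom n) m = (if monom_degree m = n then of_nat n else 0)"
    unfolding ps_const_of_nat[symmetric] ps_scale_eq[symmetric] by (simp add: complete_hom.rep_eq)
  have "pcoeff (\<Sum>r\<in>{1..n}. power_sum r * complete_hom (n - r)) m =
      (\<Sum>r\<in>{1..n}. if monom_degree m = n then of_nat (card {i \<in> Poly_Mapping.keys m. r \<le> Poly_Mapping.lookup m i}) else 0)"
    unfolding pcoeff_sum by (intro sum.cong refl) (subst pcoeff_power_sum_mult_complete_hom, auto)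
  also have "\<dots> = (if monom_degree m = n then of_nat n else 0)"
  proof (cases "monom_degree m = n")
    case True
    have le: "Poly_Mapping.lookup m i \<le> n" if "i \<in> Poly_Mapping.keys m" for i
      using that True member_le_sum[of i "Poly_Mapping.keys m" "Poly_Mapping.lookup m"] by (simp add: monom_degree_def)
    have "(\<Sum>r\<in>{1..n}. card {i \<in> Poly_Mapping.keys m. r \<le> Poly_Mapping.lookup m i})
        = (\<Sum>r\<in>{1..n}. \<Sum>i\<in>Poly_Mapping.keys m. if r \<le> Poly_Mapping.lookup m i then 1 else 0)"
      by (intro sum.cong refl) (simp add: sum.If_cases Int_def conj_commute)
    also have "\<dots> = (\<Sum>i\<in>Poly_Mapping.keys m. \<Sum>r\<in>{1..n}. if r \<le> Poly_Mapping.lookup m i then 1 else 0)"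
      by (rule sum.swap)
    also have "\<dots> = (\<Sum>i\<in>Poly_Mapping.keys m. Poly_Mapping.lookup m i)"
    proof (intro sum.cong refl)
      fix i assume "i \<in> Poly_Mapping.keys m"
      then have "{1..n} \<inter> {r. r \<le> Poly_Mapping.lookup m i} = {1..Poly_Mapping.lookup m i}"
        using le by force
      then show "(\<Sum>r\<in>{1..n}. if r \<le> Poly_Mapping.lookup m i then 1 else 0) = Poly_Mapping.lookup m i"
        by (simp add: sum.If_cases)
    qed
    also have "\<dots> = n" using True by (simp add: monom_degree_def)
    finally show ?thesis using True by (simp flip: of_nat_sum)
  qed simp
  finally show "pcoeff (of_nat n * complete_hom n) m = pcoeff (\<Sum>r\<in>{1..n}. power_sum r * complete_hom (n - r)) m"
    unfolding lhs ..
qed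

text \<open>The logarithmic derivative of the generating function of the complete functions, whence
  the index shift. Because of it \<open>p_odd\<close> has only even powers, and changing the sign of
  the variable negates \<open>p_even\<close> but not \<open>p_odd\<close>.\<close>

definition p_fps :: "pseries fps" where "p_fps = Abs_fps (\<lambda>n. power_sum (Suc n))"
definition p_odd :: "pseries fps" where "p_odd = Abs_fps (\<lambda>n. if odd (Suc n) then power_sum (Suc n) else 0)"
definition p_even :: "pseries fps" where "p_even = Abs_fps (\<lambda>n. if even (Suc n) then power_sum (Suc n) else 0)"

definition sgn_fps :: "pseries fps \<Rightarrow> pseries fps" where
  "sgn_fps f = Abs_fps (\<lambda>n. (-1) ^ n * f $ n)"

lemma sgn_fps_mult: "sgn_fps (f * g) = sgn_fps f * sgn_fps g"
proof (rule fps_ext)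
  fix n
  show "sgn_fps (f * g) $ n = (sgn_fps f * sgn_fps g) $ n"
    unfolding sgn_fps_def fps_mult_nth fps_nth_Abs_fps sum_distrib_left
  proof (rule sum.cong[OF refl])
    fix i assume "i \<in> {0..n}"
    then have "(-1) ^ n = (-1) ^ i * (-1) ^ (n - i) * (1 :: pseries)" by (simp flip: power_add)
    then show "(-1) ^ n * (f $ i * g $ (n - i)) = (-1) ^ i * f $ i * ((-1) ^ (n - i) * g $ (n - i))"
      by (simp only: mult_1_left mult_1_right mult_ac)
  qed
qed

lemma fps_deriv_sgn_fps: "fps_deriv (sgn_fps f) = - sgn_fps (fps_deriv f)"
  by (rule fps_ext) (simp add: sgn_fps_def algebra_simps)

lemma p_fps_parts: "p_fps = p_odd + p_even" "sgn_fps p_fps = p_odd - p_even"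
  by (rule fps_ext, simp add: p_fps_def p_odd_def p_even_def sgn_fps_def)+

lemma Gam_grade_sgn: "Gam (grade_sgn f) = sgn_fps (Gam f)"
proof (rule fps_ext)
  fix n
  have "ps_const ((-1) ^ m * c) = (-1) ^ m * ps_const c" for m c
    by (induction m) (auto simp: ps_const_mult mult.assoc)
  then show "Gam (grade_sgn f) $ n = sgn_fps (Gam f) $ n"
    by (cases n) (simp_all add: Gam_nth_Suc sgn_fps_def wcoeff_grade_sgn sum_distrib_left sum_negf mult.assoc)
qed

lemma rib_replicate_False: "rib a (replicate m False) = complete_hom (a + m)"
  by (induction m arbitrary: a) auto

lemma complete_hom_0: "complete_hom 0 = 1"
proof (rule pseries_eqI)
  fix m
  have "monom_degree m = 0 \<longleftrightarrow> m = 0"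
    by (auto simp: monom_degree_def in_keys_iff intro: poly_mapping_eqI)
  then show "pcoeff (complete_hom 0) m = pcoeff 1 m"
    by (simp add: complete_hom.rep_eq one_pseries.rep_eq)
qed

lemma Gam_U_False: "Gam (U False) $ n = complete_hom n"
proof (cases n)
  case 0
  then show ?thesis by (simp add: complete_hom_0)
next
  case (Suc m)
  have "Gam (U False) $ n = (\<Sum>v\<in>{replicate m False}. ps_const (wcoeff (U False) (True # v)) * rib (Suc 0) v)"
    unfolding Suc Gam_nth_Suc
  proof (rule sum.mono_neutral_right)
    show "\<forall>v\<in>{v. length v = m} - {replicate m False}. ps_const (wcoeff (U False) (True # v)) * rib (Suc 0) v = 0"
    proof
      fix v :: "bool list" assume v: "v \<in> {v. length v = m} - {replicate m False}"
      then have "\<not> set v \<subseteq> {False}" by (auto intro: replicate_eqI dest: sym)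
      then show "ps_const (wcoeff (U False) (True # v)) * rib (Suc 0) v = 0" by (simp add: wcoeff_U)
    qed
  qed auto
  also have "\<dots> = complete_hom n"
    by (simp add: wcoeff_U rib_replicate_False Suc set_replicate_conv_if)
  finally show ?thesis .
qed

text \<open>The positive sign is Newton's identity. The negative one follows by differentiating
  \<open>E(x) H(-x) = 1\<close>, the image of \<open>U_grade_sgn_U\<close>.\<close>

lemma fps_deriv_Gam_U: "fps_deriv (Gam (U e)) = (if e then p_odd - p_even else p_odd + p_even) * Gam (U e)"
proof -
  have False_case: "fps_deriv (Gam (U False)) = p_fps * Gam (U False)"
  proof (rule fps_ext)
    fix n
    have "fps_deriv (Gam (U False)) $ n = of_nat (Suc n) * complete_hom (Suc n)"
      by (simp add: Gam_U_False)
    also have "\<dots> = (\<Sum>r\<in>{1..Suc n}. power_sum r * complete_hom (Suc n - r))"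
      by (rule newton_complete_hom)
    also have "\<dots> = (\<Sum>i=0..n. power_sum (Suc i) * complete_hom (n - i))"
      by (rule sum.reindex_bij_witness[where i = Suc and j = "\<lambda>r. r - 1"]) auto
    also have "\<dots> = (p_fps * Gam (U False)) $ n"
      by (simp add: fps_mult_nth p_fps_def Gam_U_False)
    finally show "fps_deriv (Gam (U False)) $ n = (p_fps * Gam (U False)) $ n" .
  qed
  show ?thesis
  proof (cases e)
    case False
    then show ?thesis using False_case by (simp add: p_fps_parts)
  next
    case True
    define H E where "H = sgn_fps (Gam (U False))" and "E = Gam (U True)"
    have EH: "E * H = 1"
      using arg_cong[OF U_grade_sgn_U[of True], of Gam]
      by (simp add: Gam_mult head_free_U head_free_grade_sgn Gam_grade_sgn E_def H_def)
    have DH: "fps_deriv H = - (sgn_fps p_fps * H)"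
      by (simp add: H_def fps_deriv_sgn_fps False_case sgn_fps_mult)
    have "fps_deriv (E * H) = 0" using EH by simp
    then have "fps_deriv E * H = E * (sgn_fps p_fps * H)"
      by (simp add: DH)
    then have "fps_deriv E * (E * H) = sgn_fps p_fps * E * (E * H)"
      by (metis mult.assoc mult.commute mult.left_commute)
    then have "fps_deriv E = sgn_fps p_fps * E" by (simp add: EH)
    then show ?thesis using True p_fps_parts(2) by (simp add: E_def)
  qed
qed

section \<open>Logarithmic derivatives of the series I and J\<close>

lemma head_free_V2: "head_free (V2 e)"
  by (simp add: V2_def head_free_mult head_free_U)

lemma head_free_V2_1: "head_free (V2 e - 1)"
  by (simp add: head_free_diff head_free_V2 head_free_one)

text \<open>The even power sums of the two factors cancel; this is why the series I end up supported
  on partitions into odd parts.\<close>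

lemma fps_deriv_Gam_V2: "fps_deriv (Gam (V2 e)) = 2 * p_odd * Gam (V2 e)"
  by (cases e) (simp_all add: V2_def Gam_mult head_free_U fps_deriv_Gam_U algebra_simps)

text \<open>Substitution turns \<open>1 + X\<close> into \<open>V2 e\<close>, so the factor
  \<open>V2 e\<close> in the derivative cancels the denominator. Logarithm and binomial series are
  the instances needed.\<close>

lemma fps_deriv_Gam_ev_V2:
  assumes "fps_deriv p = q * inverse (1 + fps_X)"
  shows "fps_deriv (Gam (ev (V2 e - 1) p)) = Gam (ev (V2 e - 1) q) * (2 * p_odd)"
proof -
  have "ev (V2 e - 1) (1 + fps_X) = V2 e"
    by (simp add: ev_add ev_X)
  then have "ev (V2 e - 1) (fps_deriv p) * V2 e = ev (V2 e - 1) (fps_deriv p * (1 + fps_X))"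
    by (simp add: ev_mult)
  also have "fps_deriv p * (1 + fps_X) = q"
    unfolding assms mult.assoc by (simp add: inverse_mult_eq_1)
  finally have 1: "ev (V2 e - 1) (fps_deriv p) * V2 e = ev (V2 e - 1) q" .
  have "fps_deriv (Gam (ev (V2 e - 1) p)) = Gam (ev (V2 e - 1) (fps_deriv p)) * (Gam (V2 e) * (2 * p_odd))"
    by (subst fps_deriv_Gam_ev) (simp_all add: head_free_V2_1 Gam_diff fps_deriv_Gam_V2 mult_ac)
  also have "\<dots> = Gam (ev (V2 e - 1) (fps_deriv p) * V2 e) * (2 * p_odd)"
    by (simp add: Gam_mult head_free_ev head_free_V2_1 head_free_V2 mult.assoc)
  finally show ?thesis by (simp add: 1)
qed

lemma fps_deriv_Gam_log_V2: "fps_deriv (Gam (log_V2 e)) = 2 * p_odd"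
  unfolding log_V2_def by (subst fps_deriv_Gam_ev_V2[where q = 1]) (simp_all add: fps_ln_deriv)

lemma fps_deriv_Gam_V2_powr: "fps_deriv (Gam (V2_powr e c)) = fps_const (ps_const c) * Gam (V2_powr e c) * (2 * p_odd)"
  unfolding V2_powr_def
  by (subst fps_deriv_Gam_ev_V2[where q = "fps_const c * fps_binomial c"])
     (simp_all add: fps_binomial_deriv fps_divide_unit ev_const Gam_wconst)

lemma Gam_IJ_nth_0: "Gam (IJ p e k) $ 0 = (if k = 0 then 1 else 0)"
  by (cases k) (simp_all add: IJ_def)

definition even_sign :: "bool \<Rightarrow> bool \<Rightarrow> rat" where
  "even_sign p e = (if p then if e then -1 else 1 else 0)"

text \<open>Differentiating a divided power of half the logarithm lowers \<open>k\<close> and yields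
  \<open>p_odd\<close>. In the prefactor of J the odd power sums of \<open>U e\<close> and of the
  inverse square root cancel, leaving the even ones with the sign of \<open>U e\<close>.\<close>

lemma fps_deriv_Gam_IJ:
  "fps_deriv (Gam (IJ p e k)) = fps_const (ps_const (even_sign p e)) * p_even * Gam (IJ p e k)
     + (if k = 0 then 0 else p_odd * Gam (IJ p e (k - 1)))"
proof -
  define Y where "Y e k = fps_const (ps_const (1 / (2 ^ k * fact k))) * Gam (log_V2 e) ^ k" for e k
  have hf: "head_free (log_V2 e)" "head_free (V2_powr e c)" for e c
    by (simp_all add: log_V2_def V2_powr_def head_free_ev head_free_V2_1)
  have I: "Gam (IJ False e k) = Y e k" for e k
    by (simp add: IJ_def Y_def Gam_wconst Gam_power hf)
  have J: "Gam (IJ True e k) = Gam (U e) * Gam (V2_powr (\<not> e) (-1/2)) * Y (\<not> e) k" for k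
    by (simp add: IJ_def Y_def Gam_mult Gam_wconst Gam_power hf head_free_U head_free_mult head_free_wconst
        head_free_power)
  have DY: "fps_deriv (Y e k) = (if k = 0 then 0 else p_odd * Y e (k - 1))" for e
  proof (cases k)
    case (Suc m)
    have "1 / (2 ^ Suc m * fact (Suc m)) * of_nat (Suc m) * 2 = (1 / (2 ^ m * fact m) :: rat)"
      by (simp add: field_simps del: of_nat_Suc)
    then have "ps_const (1 / (2 ^ Suc m * fact (Suc m))) * of_nat (Suc m) * ps_const 2 = ps_const (1 / (2 ^ m * fact m))"
      by (simp only: ps_const_of_nat[symmetric] ps_const_mult[symmetric])
    moreover have "fps_const (ps_const 2) = 2"
      using ps_const_of_nat[of 2] by (simp add: numeral_fps_const)
    ultimately have "fps_const (ps_const (1 / (2 ^ Suc m * fact (Suc m)))) * fps_const (of_nat (Suc m)) * 2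
        = fps_const (ps_const (1 / (2 ^ m * fact m)))"
      by (metis fps_const_mult)
    then have c: "fps_const (ps_const (1 / (2 ^ m * fact m)))
        = fps_const (ps_const (1 / (2 ^ Suc m * fact (Suc m)))) * fps_const (of_nat (Suc m)) * 2" ..
    have "fps_deriv (Y e k) = fps_const (ps_const (1 / (2 ^ Suc m * fact (Suc m))))
        * (fps_const (of_nat (Suc m)) * (2 * p_odd) * Gam (log_V2 e) ^ m)"
      unfolding Suc Y_def fps_deriv_mult fps_deriv_power fps_deriv_Gam_log_V2 by simp
    also have "\<dots> = p_odd * Y e m"
      unfolding Y_def c by (simp only: mult_ac)
    finally show ?thesis by (simp add: Suc)
  qed (simp add: Y_def)
  show ?thesis
  proof (cases p)
    case False
    then show ?thesis using DY by (simp add: even_sign_def I)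
  next
    case True
    define K where "K = Gam (U e) * Gam (V2_powr (\<not> e) (-1/2))"
    have half: "fps_const (ps_const (-1/2)) * 2 = (- 1 :: pseries fps)"
    proof -
      have "fps_const (ps_const (-1/2)) * fps_const (ps_const 2) = (- 1 :: pseries fps)"
        by (simp flip: ps_const_mult add: fps_eq_iff)
      then show ?thesis using ps_const_of_nat[of 2] by (simp add: numeral_fps_const)
    qed
    have DV: "fps_deriv (Gam (V2_powr (\<not> e) (-1/2))) = - (p_odd * Gam (V2_powr (\<not> e) (-1/2)))"
    proof -
      have "fps_deriv (Gam (V2_powr (\<not> e) (-1/2)))
          = (fps_const (ps_const (-1/2)) * 2) * (p_odd * Gam (V2_powr (\<not> e) (-1/2)))"
        unfolding fps_deriv_Gam_V2_powr by (simp only: mult_ac)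
      then show ?thesis unfolding half by simp
    qed
    have minus_one: "fps_const (- 1) = (- 1 :: pseries fps)" by (simp add: fps_eq_iff)
    have DK: "fps_deriv K = fps_const (ps_const (even_sign True e)) * p_even * K"
      unfolding K_def fps_deriv_mult fps_deriv_Gam_U DV using minus_one
      by (simp add: even_sign_def algebra_simps)
    have "fps_deriv (K * Y (\<not> e) k) = fps_const (ps_const (even_sign True e)) * p_even * (K * Y (\<not> e) k)
        + (if k = 0 then 0 else p_odd * (K * Y (\<not> e) (k - 1)))"
      unfolding fps_deriv_mult DK DY by (simp add: algebra_simps)
    then show ?thesis using True J K_def by simp
  qed
qed

subsection \<open>Power sums over partitions\<close>

definition weighted_p_sum :: "nat \<Rightarrow> (nat multiset \<Rightarrow> rat) \<Rightarrow> pseries" where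
  "weighted_p_sum n w = (\<Sum>\<mu>\<in>partitions n. ps_const (w \<mu> / of_nat (z_part \<mu>)) * p_part \<mu>)"

lemma finite_partitions [simp]: "finite (partitions n)"
proof (rule finite_subset)
  show "partitions n \<subseteq> mset ` compositions n"
  proof
    fix \<mu> assume "\<mu> \<in> partitions n"
    moreover obtain I where "\<mu> = mset I" using ex_mset by metis
    ultimately show "\<mu> \<in> mset ` compositions n"
      by (auto simp: partitions_def compositions_def is_composition_def sum_mset_sum_list)
  qed
qed simp

lemma z_part_eq:
  assumes "finite A" "set_mset \<mu> \<subseteq> A"
  shows "z_part \<mu> = (\<Prod>r\<in>A. r ^ count \<mu> r * fact (count \<mu> r))"
  unfolding z_part_def using assms
  by (intro prod.mono_neutral_left) (auto simp: not_in_iff)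

lemma z_part_add_mset: "z_part (add_mset r \<nu>) = r * Suc (count \<nu> r) * z_part \<nu>"
proof -
  let ?A = "insert r (set_mset \<nu>)"
  have "z_part (add_mset r \<nu>) = (r ^ Suc (count \<nu> r) * fact (Suc (count \<nu> r)))
      * (\<Prod>q\<in>?A - {r}. q ^ count (add_mset r \<nu>) q * fact (count (add_mset r \<nu>) q))"
    by (subst z_part_eq[of ?A]) (auto simp: prod.remove[of ?A r])
  also have "(\<Prod>q\<in>?A - {r}. q ^ count (add_mset r \<nu>) q * fact (count (add_mset r \<nu>) q))
      = (\<Prod>q\<in>?A - {r}. q ^ count \<nu> q * fact (count \<nu> q))"
    by (intro prod.cong) auto
  also have "(r ^ Suc (count \<nu> r) * fact (Suc (count \<nu> r))) * \<dots>
      = r * Suc (count \<nu> r) * (\<Prod>q\<in>?A. q ^ count \<nu> q * fact (count \<nu> q))"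
    by (simp add: prod.remove[of ?A r] algebra_simps)
  also have "(\<Prod>q\<in>?A. q ^ count \<nu> q * fact (count \<nu> q)) = z_part \<nu>"
    by (rule z_part_eq[symmetric]) auto
  finally show ?thesis .
qed

lemma z_part_pos: "0 \<notin># \<mu> \<Longrightarrow> z_part \<mu> > 0"
  unfolding z_part_def by (intro prod_pos) (metis fact_gt_zero gr0I nat_0_less_mult_iff zero_less_power)

lemma sum_mset_eq_sum_count: "sum_mset \<mu> = (\<Sum>r\<in>set_mset \<mu>. r * count \<mu> r)" for \<mu> :: "nat multiset"
proof -
  \<comment> \<open>The index set is frozen at \<open>\<mu>\<close> while \<open>\<nu>\<close>
    grows, so that the induction does not have to enlarge it.\<close>
  have "sum_mset \<nu> = (\<Sum>r\<in>set_mset \<mu>. r * count \<nu> r)" if "\<nu> \<subseteq># \<mu>" for \<nu>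
    using that
  proof (induction \<nu>)
    case (add r \<nu>)
    then have "r \<in># \<mu>" "\<nu> \<subseteq># \<mu>"
      by (meson mset_subset_eqD union_single_eq_member, meson subset_mset.trans mset_subset_eq_add_right subset_mset.dual_order.trans mset_subset_eq_insertD subset_mset.less_imp_le)
    then have "(\<Sum>q\<in>set_mset \<mu>. q * count (add_mset r \<nu>) q) = (\<Sum>q\<in>set_mset \<mu>. q * count \<nu> q + (if q = r then r else 0))"
      by (intro sum.cong) auto
    then show ?case using add \<open>r \<in># \<mu>\<close> \<open>\<nu> \<subseteq># \<mu>\<close> by (simp add: sum.distrib)
  qed simp
  then show ?thesis by simp
qed

text \<open>Write \<open>n\<close> as the sum of \<open>r * count \<mu> r\<close>. Removing one part
  \<open>r\<close> divides \<open>z_part \<mu>\<close> by exactly this number and takes a factor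
  \<open>power_sum r\<close> out of \<open>p_part \<mu>\<close>.\<close>

lemma weighted_p_sum_recurrence:
  "of_nat n * weighted_p_sum n w = (\<Sum>r\<in>{1..n}. power_sum r * weighted_p_sum (n - r) (\<lambda>\<nu>. w (add_mset r \<nu>)))"
proof -
  have "of_nat n * weighted_p_sum n w
      = (\<Sum>\<mu>\<in>partitions n. \<Sum>r\<in>set_mset \<mu>. ps_const (of_nat (r * count \<mu> r) * w \<mu> / of_nat (z_part \<mu>)) * p_part \<mu>)"
    unfolding weighted_p_sum_def sum_distrib_left
  proof (intro sum.cong refl)
    fix \<mu> assume "\<mu> \<in> partitions n"
    then have "of_nat n = (\<Sum>r\<in>set_mset \<mu>. of_nat (r * count \<mu> r) :: rat)"
      by (simp add: partitions_def sum_mset_eq_sum_count flip: of_nat_sum of_nat_mult)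
    then have "of_nat n = (\<Sum>r\<in>set_mset \<mu>. ps_const (of_nat (r * count \<mu> r)))"
      by (simp only: ps_const_sum[symmetric] ps_const_of_nat[symmetric])
    then show "of_nat n * (ps_const (w \<mu> / of_nat (z_part \<mu>)) * p_part \<mu>)
        = (\<Sum>r\<in>set_mset \<mu>. ps_const (of_nat (r * count \<mu> r) * w \<mu> / of_nat (z_part \<mu>)) * p_part \<mu>)"
      by (simp add: sum_distrib_right ps_const_mult[symmetric] mult.assoc[symmetric] del: of_nat_mult)
  qed
  also have "\<dots> = (\<Sum>(\<mu>, r)\<in>Sigma (partitions n) set_mset.
      ps_const (of_nat (r * count \<mu> r) * w \<mu> / of_nat (z_part \<mu>)) * p_part \<mu>)"
    by (rule sum.Sigma) auto
  also have "\<dots> = (\<Sum>(r, \<nu>)\<in>Sigma {1..n} (\<lambda>r. partitions (n - r)).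
      power_sum r * (ps_const (w (add_mset r \<nu>) / of_nat (z_part \<nu>)) * p_part \<nu>))"
  proof (rule sum.reindex_bij_witness[where i = "\<lambda>(r, \<nu>). (add_mset r \<nu>, r)" and j = "\<lambda>(\<mu>, r). (r, \<mu> - {#r#})"])
    fix x assume x: "x \<in> Sigma (partitions n) set_mset"
    then obtain r \<nu> where [simp]: "x = (add_mset r \<nu>, r)" by (cases x) (metis SigmaE2 insert_DiffM)
    have r: "r > 0" "sum_mset \<nu> + r = n" "0 \<notin># \<nu>" using x by (auto simp: partitions_def)
    show "(case case x of (\<mu>, r) \<Rightarrow> (r, \<mu> - {#r#}) of (r, \<nu>) \<Rightarrow> (add_mset r \<nu>, r)) = x" by simp
    show "(case x of (\<mu>, r) \<Rightarrow> (r, \<mu> - {#r#})) \<in> Sigma {1..n} (\<lambda>r. partitions (n - r))"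
      using r by (auto simp: partitions_def)
    have "of_nat (r * count (add_mset r \<nu>) r) * w (add_mset r \<nu>) / of_nat (z_part (add_mset r \<nu>))
        = w (add_mset r \<nu>) / of_nat (z_part \<nu>)"
      unfolding z_part_add_mset of_nat_mult[of "r * Suc (count \<nu> r)"] using r
      by (simp del: of_nat_Suc of_nat_mult)
    then show "(case case x of (\<mu>, r) \<Rightarrow> (r, \<mu> - {#r#}) of (r, \<nu>) \<Rightarrow>
          power_sum r * (ps_const (w (add_mset r \<nu>) / of_nat (z_part \<nu>)) * p_part \<nu>)) =
        (case x of (\<mu>, r) \<Rightarrow> ps_const (of_nat (r * count \<mu> r) * w \<mu> / of_nat (z_part \<mu>)) * p_part \<mu>)"
      by (simp add: p_part_def mult.left_commute del: count_add_mset)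
  next
    fix y assume "y \<in> Sigma {1..n} (\<lambda>r. partitions (n - r))"
    then show "(case y of (r, \<nu>) \<Rightarrow> (add_mset r \<nu>, r)) \<in> Sigma (partitions n) set_mset"
      by (auto simp: partitions_def)
    show "(case case y of (r, \<nu>) \<Rightarrow> (add_mset r \<nu>, r) of (\<mu>, r) \<Rightarrow> (r, \<mu> - {#r#})) = y"
      by (cases y) simp
  qed
  also have "\<dots> = (\<Sum>r\<in>{1..n}. \<Sum>\<nu>\<in>partitions (n - r).
      power_sum r * (ps_const (w (add_mset r \<nu>) / of_nat (z_part \<nu>)) * p_part \<nu>))"
    by (rule sum.Sigma[symmetric]) auto
  finally show ?thesis
    unfolding weighted_p_sum_def sum_distrib_left .
qed

text \<open>With \<open>s = 0\<close> the convention \<open>0 ^ 0 = 1\<close> selects the partitions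
  without even parts, so one formula covers I and J.\<close>

definition parity_weight :: "rat \<Rightarrow> nat \<Rightarrow> nat multiset \<Rightarrow> rat" where
  "parity_weight s k \<mu> = (if odd_parts \<mu> = k then s ^ even_parts \<mu> else 0)"

lemma parity_weight_add_mset:
  "parity_weight s k (add_mset r \<nu>) =
     (if odd r then if k = 0 then 0 else parity_weight s (k - 1) \<nu> else s * parity_weight s k \<nu>)"
  by (auto simp: parity_weight_def odd_parts_def even_parts_def)

lemma weighted_p_sum_scale: "weighted_p_sum n (\<lambda>\<mu>. c * w \<mu>) = ps_const c * weighted_p_sum n w"
  by (simp add: weighted_p_sum_def sum_distrib_left ps_const_mult[symmetric] mult.assoc[symmetric])

lemma weighted_p_sum_zero: "weighted_p_sum n (\<lambda>\<mu>. 0) = 0"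
  by (simp add: weighted_p_sum_def)

lemma weighted_p_sum_add: "weighted_p_sum n (\<lambda>\<mu>. v \<mu> + w \<mu>) = weighted_p_sum n v + weighted_p_sum n w"
  by (simp add: weighted_p_sum_def sum.distrib[symmetric] add_divide_distrib distrib_right)

text \<open>Both sides obey the same recursion in \<open>n\<close>. In the differential equation a
  power sum of odd index lowers \<open>k\<close> and one of even index carries
  \<open>even_sign p e\<close>, just as adding a part changes \<open>parity_weight\<close>.\<close>

lemma Gam_IJ: "Gam (IJ p e k) $ n = weighted_p_sum n (parity_weight (even_sign p e) k)"
proof (induction n arbitrary: k rule: less_induct)
  case (less n)
  show ?case
  proof (cases n)
    case 0
    have part: "partitions 0 = {{#}}"
      by (auto simp: partitions_def) (metis multiset_nonemptyE)
    show ?thesis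
      unfolding 0 Gam_IJ_nth_0 weighted_p_sum_def part
      by (simp add: parity_weight_def odd_parts_def even_parts_def z_part_def p_part_def)
  next
    case (Suc m)
    let ?w = "parity_weight (even_sign p e)"
    have "of_nat n * Gam (IJ p e k) $ n = fps_deriv (Gam (IJ p e k)) $ m"
      by (simp add: Suc)
    also have "\<dots> = (\<Sum>i=0..m. ps_const (even_sign p e) * p_even $ i * Gam (IJ p e k) $ (m - i)
        + (if k = 0 then 0 else p_odd $ i * Gam (IJ p e (k - 1)) $ (m - i)))"
      unfolding fps_deriv_Gam_IJ
      by (simp add: fps_mult_nth[of p_even] fps_mult_nth[of p_odd] sum_distrib_left sum.distrib mult.assoc)
    also have "\<dots> = (\<Sum>i=0..m. power_sum (Suc i) * weighted_p_sum (m - i) (\<lambda>\<nu>. ?w k (add_mset (Suc i) \<nu>)))"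
    proof (intro sum.cong refl)
      fix i assume "i \<in> {0..m}"
      then have "Gam (IJ p e j) $ (m - i) = weighted_p_sum (m - i) (?w j)" for j
        by (intro less) (simp add: Suc)
      then show "ps_const (even_sign p e) * p_even $ i * Gam (IJ p e k) $ (m - i)
          + (if k = 0 then 0 else p_odd $ i * Gam (IJ p e (k - 1)) $ (m - i))
          = power_sum (Suc i) * weighted_p_sum (m - i) (\<lambda>\<nu>. ?w k (add_mset (Suc i) \<nu>))"
        by (simp add: p_even_def p_odd_def parity_weight_add_mset weighted_p_sum_scale weighted_p_sum_zero mult_ac)
    qed
    also have "\<dots> = (\<Sum>r\<in>{1..n}. power_sum r * weighted_p_sum (n - r) (\<lambda>\<nu>. ?w k (add_mset r \<nu>)))"
      by (rule sum.reindex_bij_witness[where j = Suc and i = "\<lambda>r. r - 1"]) (auto simp: Suc)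
    also have "\<dots> = of_nat n * weighted_p_sum n (?w k)"
      by (rule weighted_p_sum_recurrence[symmetric])
    finally show ?thesis by (rule of_nat_mult_cancel_pseries) (simp add: Suc)
  qed
qed

lemma p_sum_eq: "p_sum n P = weighted_p_sum n (\<lambda>\<mu>. if P \<mu> then 1 else 0)"
proof -
  have "weighted_p_sum n (\<lambda>\<mu>. if P \<mu> then 1 else 0)
      = (\<Sum>\<mu>\<in>partitions n. if P \<mu> then ps_scale (1 / of_nat (z_part \<mu>)) (p_part \<mu>) else 0)"
    unfolding weighted_p_sum_def by (intro sum.cong refl) (simp add: ps_scale_eq)
  then show ?thesis
    by (simp add: p_sum_def sum.inter_filter)
qed

lemma pcoeff_p_part:
  assumes "0 \<notin># \<mu>"
  shows "pcoeff (p_part \<mu>) (Poly_Mapping.single 0 (sum_mset \<mu>)) = 1"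
  using assms
proof (induction \<mu>)
  case empty
  then show ?case by (simp add: p_part_def one_pseries.rep_eq)
next
  case (add r \<nu>)
  then have r: "r > 0" by auto
  let ?m = "Poly_Mapping.single (0 :: nat) (sum_mset (add_mset r \<nu>))"
  let ?a = "Poly_Mapping.single (0 :: nat) r" and ?b = "Poly_Mapping.single (0 :: nat) (sum_mset \<nu>)"
  have m: "?a + ?b = ?m" by (simp add: single_add)
  have "pcoeff (p_part (add_mset r \<nu>)) ?m = (\<Sum>(a, b) | a + b = ?m. pcoeff (power_sum r) a * pcoeff (p_part \<nu>) b)"
    by (simp add: p_part_def times_pseries.rep_eq)
  also have "\<dots> = (\<Sum>(a, b)\<in>{(?a, ?b)}. pcoeff (power_sum r) a * pcoeff (p_part \<nu>) b)"
  proof (rule sum.mono_neutral_right)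
    show "\<forall>x\<in>{(a, b). a + b = ?m} - {(?a, ?b)}. (case x of (a, b) \<Rightarrow> pcoeff (power_sum r) a * pcoeff (p_part \<nu>) b) = 0"
    proof
      fix x assume x: "x \<in> {(a, b). a + b = ?m} - {(?a, ?b)}"
      obtain a b where ab': "x = (a, b)" by (cases x)
      with x have ab: "a + b = ?m" "\<not> (a = ?a \<and> b = ?b)" by auto
      have "a \<noteq> Poly_Mapping.single i r" for i
      proof
        assume a: "a = Poly_Mapping.single i r"
        have "Poly_Mapping.lookup ?m i \<ge> r" unfolding ab(1)[symmetric] a by (simp add: lookup_add)
        then have "i = 0" using r by (metis lookup_single_not_eq not_le)
        then have "a = ?a" using a by simp
        then have "b = ?b" using ab(1) m by (metis add_left_cancel)
        with \<open>a = ?a\<close> ab show False by simp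
      qed
      then show "(case x of (a, b) \<Rightarrow> pcoeff (power_sum r) a * pcoeff (p_part \<nu>) b) = 0"
        by (simp add: ab' power_sum.rep_eq)
    qed
  qed (use m finite_add_decompositions in auto)
  also have "\<dots> = 1" using add by (auto simp: power_sum.rep_eq)
  finally show ?case .
qed

text \<open>Each product of power sums contributes 1 to the coefficient of \<open>x_0^n\<close>, so
  this coefficient is a nonempty sum of positive numbers \<open>1 / z\<close>.\<close>

lemma p_sum_nonzero:
  assumes "\<exists>\<mu>\<in>partitions n. P \<mu>"
  shows "p_sum n P \<noteq> 0"
proof -
  have "pcoeff (p_sum n P) (Poly_Mapping.single 0 n)
      = (\<Sum>\<mu> | \<mu> \<in> partitions n \<and> P \<mu>. 1 / of_nat (z_part \<mu>))"
    unfolding p_sum_def pcoeff_sum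
  proof (intro sum.cong refl)
    fix \<mu> assume "\<mu> \<in> {\<mu>. \<mu> \<in> partitions n \<and> P \<mu>}"
    then have "pcoeff (p_part \<mu>) (Poly_Mapping.single 0 n) = 1"
      using pcoeff_p_part[of \<mu>] by (auto simp: partitions_def)
    then show "pcoeff (ps_scale (1 / of_nat (z_part \<mu>)) (p_part \<mu>)) (Poly_Mapping.single 0 n) = 1 / of_nat (z_part \<mu>)"
      by simp
  qed
  also have "\<dots> > 0"
  proof (rule sum_pos)
    fix \<mu> assume "\<mu> \<in> {\<mu>. \<mu> \<in> partitions n \<and> P \<mu>}"
    then show "0 < (1 / of_nat (z_part \<mu>) :: rat)" by (simp add: partitions_def z_part_pos)
  qed (use assms in auto)
  finally show ?thesis by auto
qed

section \<open>The idempotents\<close>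

definition IJ_comb :: "rat \<Rightarrow> rat \<Rightarrow> rat \<Rightarrow> rat \<Rightarrow> nat \<Rightarrow> ncsf" where
  "IJ_comb a b c d k = scaleQ a (I_plus k) + scaleQ b (I_minus k) + scaleQ c (J_plus k) + scaleQ d (J_minus k)"

lemma word_series_IJ_comb:
  "word_series (IJ_comb a b c d k) = wconst a * IJ False False k + wconst b * IJ False True k
     + wconst c * IJ True False k + wconst d * IJ True True k"
  unfolding IJ_comb_def word_series_add word_series_scaleQ word_series_I word_series_J ..

lemma head_free_word_series: "head_free (word_series F)"
  by (simp add: head_free_def)

lemma to_galg_linear:
  "to_galg n (f + g) = to_galg n f + to_galg n g" "to_galg n (wconst c * f) = scaleQ c (to_galg n f)"
  by (auto simp: to_galg_def scaleQ_def fun_eq_iff)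

lemma to_descent_IJ_comb:
  assumes "n > 0"
  shows "to_descent n (homog n (IJ_comb a b c d k)) =
    scaleQ a (to_galg n (IJ False False k)) + scaleQ b (to_galg n (IJ False True k))
    + scaleQ c (to_galg n (IJ True False k)) + scaleQ d (to_galg n (IJ True True k))"
proof -
  have "to_galg n (word_series (homog n F)) = to_galg n (word_series F)" for F
  proof
    fix \<sigma>
    show "to_galg n (word_series (homog n F)) \<sigma> = to_galg n (word_series F) \<sigma>"
      using comp_of_in_compositions[of "descent_word n \<sigma>"] by (simp add: to_galg_def homog_def)
  qed
  then have "to_descent n (homog n (IJ_comb a b c d k)) = to_galg n (word_series (IJ_comb a b c d k))"
    using assms by (simp add: to_descent_eq)
  then show ?thesis
    unfolding word_series_IJ_comb to_galg_linear .
qed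

text \<open>For equal index, a left factor \<open>I\<close> of either sign reproduces itself against
  all four elements, \<open>J_plus\<close> is a left unit, and \<open>J_minus\<close> on the left
  exchanges the signs.\<close>

lemma gmult_IJ_comb:
  assumes "n > 0" "j \<le> n" "l \<le> n"
  shows "gmult n (to_descent n (homog n (IJ_comb a b c d j))) (to_descent n (homog n (IJ_comb a' b' c' d' l))) =
    (if j = l then to_descent n (homog n (IJ_comb (a * (a' + b' + c' + d') + c * a' + d * b')
        (b * (a' + b' + c' + d') + c * b' + d * a') (c * c' + d * d') (c * d' + d * c') j)) else 0)"
  unfolding to_descent_IJ_comb[OF assms(1)] gmult_simps gmult_IJ[OF assms(2,3)]
  by (auto simp: fun_eq_iff scaleQ_def algebra_simps)

lemma Gamma_map_IJ_comb:
  assumes "n > 0"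
  shows "Gamma_map (homog n (IJ_comb a b c d k)) = weighted_p_sum n (\<lambda>\<mu>. if odd_parts \<mu> = k
    then (a + b) * 0 ^ even_parts \<mu> + c + d * (-1) ^ even_parts \<mu> else 0)"
proof -
  have "Gamma_map (homog n (IJ_comb a b c d k)) =
      ps_const a * weighted_p_sum n (parity_weight 0 k) + ps_const b * weighted_p_sum n (parity_weight 0 k)
      + ps_const c * weighted_p_sum n (parity_weight 1 k) + ps_const d * weighted_p_sum n (parity_weight (-1) k)"
    using assms
    by (simp add: Gamma_map_homog word_series_IJ_comb Gam_add Gam_wconst Gam_IJ even_sign_def)
  also have "\<dots> = weighted_p_sum n (\<lambda>\<mu>. a * parity_weight 0 k \<mu> + b * parity_weight 0 k \<mu>
      + c * parity_weight 1 k \<mu> + d * parity_weight (-1) k \<mu>)"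
    by (simp add: weighted_p_sum_add weighted_p_sum_scale)
  also have "\<dots> = weighted_p_sum n (\<lambda>\<mu>. if odd_parts \<mu> = k
      then (a + b) * 0 ^ even_parts \<mu> + c + d * (-1) ^ even_parts \<mu> else 0)"
    by (intro arg_cong[of _ _ "weighted_p_sum n"]) (auto simp: parity_weight_def fun_eq_iff algebra_simps)
  finally show ?thesis .
qed

lemma Gamma_map_IJ_comb_eq_p_sum:
  assumes "n > 0" "\<And>m. (a + b) * 0 ^ m + c + d * (-1) ^ m = (if P m then 1 else 0)"
  shows "Gamma_map (homog n (IJ_comb a b c d k)) = p_sum n (\<lambda>\<mu>. odd_parts \<mu> = k \<and> P (even_parts \<mu>))"
  unfolding Gamma_map_IJ_comb[OF assms(1)] p_sum_eq assms(2)
  by (intro arg_cong[of _ _ "weighted_p_sum n"]) auto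

text \<open>The identification with the descent algebra is injective in degree \<open>n\<close>, so
  a nonzero image under Gamma certifies a nonzero group algebra element.\<close>

lemma to_descent_nonzero:
  assumes "n > 0" "Gamma_map (homog n F) \<noteq> 0"
  shows "to_descent n (homog n F) \<noteq> 0"
proof
  assume "to_descent n (homog n F) = 0"
  then have "to_galg n (word_series (homog n F)) = 0"
    using assms(1) by (simp add: to_descent_eq)
  then have z: "wcoeff (word_series (homog n F)) w = 0" if "length w = n" for w
    using to_galg_eq_0_imp[OF head_free_word_series] that assms(1) by blast
  have "F (comp_of w) = 0" if "length w = n" for w
    using z[OF that] comp_of_in_compositions[of w] that by (simp add: homog_def)
  moreover obtain m where m: "n = Suc m" using assms(1) by (cases n) auto
  ultimately have "F (comp_aux (Suc 0) v) = 0" if "length v = m" for v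
    using that by (metis comp_of_simps(2) length_Cons)
  then have "Gam (word_series F) $ n = 0"
    unfolding m Gam_nth_Suc by (intro sum.neutral) auto
  then show False using assms by (simp add: Gamma_map_homog)
qed

section \<open>Partitions with prescribed numbers of odd and even parts, and counts of
  indices\<close>

lemma replicate_partition:
  assumes "0 \<notin># \<nu>" "sum_mset \<nu> + m = n"
  shows "replicate_mset m 1 + \<nu> \<in> partitions n"
    "odd_parts (replicate_mset m 1 + \<nu>) = m + odd_parts \<nu>" "even_parts (replicate_mset m 1 + \<nu>) = even_parts \<nu>"
proof -
  show "replicate_mset m 1 + \<nu> \<in> partitions n"
    using assms by (auto simp: partitions_def)
  have "filter_mset odd (replicate_mset m (1::nat)) = replicate_mset m 1"
    "filter_mset even (replicate_mset m (1::nat)) = {#}"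
    by (induction m) auto
  then show "odd_parts (replicate_mset m 1 + \<nu>) = m + odd_parts \<nu>"
    "even_parts (replicate_mset m 1 + \<nu>) = even_parts \<nu>"
    by (simp_all add: odd_parts_def even_parts_def)
qed

lemma index_set_iff: "k \<in> index_set n a d \<longleftrightarrow> a \<le> k \<and> k + d \<le> n \<and> even (n - k)"
proof -
  have "k mod 2 = n mod 2 \<longleftrightarrow> even (n - k)" if "k \<le> n"
    using mod_eq_dvd_iff_nat[OF that, of 2] by metis
  moreover have "k + d \<le> n \<Longrightarrow> k \<le> n" by simp
  ultimately show ?thesis unfolding index_set_def by blast
qed

lemma ex_partition_odd:
  assumes "k \<in> index_set n 1 0"
  shows "\<exists>\<mu>\<in>partitions n. odd_parts \<mu> = k \<and> even_parts \<mu> = 0"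
proof -
  have k: "1 \<le> k" "k \<le> n" "even (n - k)"
    using assms unfolding index_set_iff by auto
  \<comment> \<open>This part is odd because \<open>n - k\<close> is even; \<open>k - 1\<close> ones
    complete the partition.\<close>
  let ?\<nu> = "{#n - k + 1#}"
  have "0 \<notin># ?\<nu>" "sum_mset ?\<nu> + (k - 1) = n" using k by auto
  note replicate_partition[OF this]
  moreover have "odd_parts ?\<nu> = 1" "even_parts ?\<nu> = 0" using k by (auto simp: odd_parts_def even_parts_def)
  ultimately show ?thesis using k by (intro bexI[of _ "replicate_mset (k - 1) 1 + ?\<nu>"]) auto
qed

lemma ex_partition_even_parts:
  assumes "k \<in> index_set n 0 (2 * m)" "m > 0"
  shows "\<exists>\<mu>\<in>partitions n. odd_parts \<mu> = k \<and> even_parts \<mu> = m"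
proof -
  have k: "k + 2 * m \<le> n" "even (n - k)"
    using assms unfolding index_set_iff by auto
  \<comment> \<open>One large even part and \<open>m - 1\<close> twos; \<open>k\<close> ones
    complete the partition. The bound \<open>k + 2 * m \<le> n\<close> makes the large part at least
    2.\<close>
  let ?\<nu> = "add_mset (n - k - 2 * (m - 1)) (replicate_mset (m - 1) 2)"
  have "0 \<notin># ?\<nu>" "sum_mset ?\<nu> + k = n" using k assms(2) by auto
  note replicate_partition[OF this]
  moreover have "filter_mset odd (replicate_mset j (2::nat)) = {#}" "filter_mset even (replicate_mset j (2::nat)) = replicate_mset j 2" for j
    by (induction j) auto
  then have "odd_parts ?\<nu> = 0" "even_parts ?\<nu> = m"
    using k assms(2) by (auto simp: odd_parts_def even_parts_def)
  ultimately show ?thesis by (intro bexI[of _ "replicate_mset k 1 + ?\<nu>"]) auto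
qed

lemma card_index_set:
  assumes "a \<le> 1" "n \<ge> 1"
  shows "finite (index_set n a (2 * h))" "card (index_set n a (2 * h)) = Suc ((n - a) div 2) - h"
proof -
  have eq: "index_set n a (2 * h) = (\<lambda>i. n - 2 * i) ` {h..(n - a) div 2}"
  proof (intro equalityI subsetI)
    fix k assume "k \<in> index_set n a (2 * h)"
    then have k: "a \<le> k" "k + 2 * h \<le> n" "even (n - k)" by (auto simp: index_set_iff)
    then obtain i where "n - k = 2 * i" by blast
    then have "k = n - 2 * i" "i \<in> {h..(n - a) div 2}" using k by auto
    then show "k \<in> (\<lambda>i. n - 2 * i) ` {h..(n - a) div 2}" by blast
  next
    fix k assume "k \<in> (\<lambda>i. n - 2 * i) ` {h..(n - a) div 2}"
    then obtain i where i: "h \<le> i" "i \<le> (n - a) div 2" "k = n - 2 * i" by auto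
    then have "2 * i \<le> n - a" by linarith
    then have "n - k = 2 * i" "a \<le> k" "k + 2 * h \<le> n" using i assms by auto
    then show "k \<in> index_set n a (2 * h)" by (simp add: index_set_iff)
  qed
  show "finite (index_set n a (2 * h))" by (simp add: eq)
  have "inj_on (\<lambda>i. n - 2 * i) {h..(n - a) div 2}"
    by (rule inj_onI) auto
  then show "card (index_set n a (2 * h)) = Suc ((n - a) div 2) - h"
    by (simp add: eq card_image)
qed

lemma finite_index_sets [simp]:
  assumes "n \<ge> 2"
  shows "finite (index_set n (Suc 0) 0)" "finite (index_set n 0 2)" "finite (index_set n 0 4)" "finite (index_set n 0 0)"
  using card_index_set(1)[of 1 n 0] card_index_set(1)[of 0 n 1] card_index_set(1)[of 0 n 2] card_index_set(1)[of 0 n 0] assms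
  by auto

lemma card_index_sets:
  assumes "n \<ge> 2"
  shows "card (index_set n (Suc 0) 0) = (n + 1) div 2" "card (index_set n 0 2) = n div 2"
    "card (index_set n 0 4) = n div 2 - 1" "card (index_set n 0 0) = n div 2 + 1"
  using card_index_set(2)[of 1 n 0] card_index_set(2)[of 0 n 1] card_index_set(2)[of 0 n 2] card_index_set(2)[of 0 n 0] assms
  by auto

text \<open>For odd \<open>k\<close> the counts \<open>2q\<close> and \<open>2q + 1\<close> cannot
  be told apart; for left runs, \<open>r div 2\<close> is the number of left peaks.\<close>

lemma run_value_odd_cong:
  assumes "odd k" "r div 2 = r' div 2" "r \<le> n" "r' \<le> n"
  shows "run_value k n r = run_value k n r'"
proof -
  have "run_value k n r = run_value k n r'" if "r < r'" "r div 2 = r' div 2" "r' \<le> n" for r r'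
  proof -
    have "r' = Suc r \<and> r mod 2 = 0"
      using that(1,2) div_mult_mod_eq[of r 2] div_mult_mod_eq[of r' 2] mod_less_divisor[of 2 r] mod_less_divisor[of 2 r']
      by linarith
    then have "r' = Suc r" "even r" by auto
    then show ?thesis using run_value_Suc[of r n k] that assms(1) by simp
  qed
  from this[of r r'] this[of r' r] show ?thesis
    using assms by (metis linorder_neqE_nat)
qed

text \<open>For even \<open>k\<close> the counts \<open>2q + 1\<close> and \<open>2q + 2\<close>
  cannot be told apart; for runs after a leading infinity, \<open>(r - 1) div 2\<close> is the
  number of peaks.\<close>

lemma run_value_even_cong:
  assumes "even k" "(r - 1) div 2 = (r' - 1) div 2" "1 \<le> r" "r \<le> n" "1 \<le> r'" "r' \<le> n"
  shows "run_value k n r = run_value k n r'"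
proof -
  have "run_value k n (Suc q) = run_value k n (Suc q')" if "q < q'" "q div 2 = q' div 2" "q' < n" for q q'
  proof -
    have "q' = Suc q \<and> q mod 2 = 0"
      using that(1,2) div_mult_mod_eq[of q 2] div_mult_mod_eq[of q' 2] mod_less_divisor[of 2 q] mod_less_divisor[of 2 q']
      by linarith
    then show ?thesis using run_value_Suc[of "Suc q" n k] that assms(1) by auto
  qed
  note suc = this[of "r - 1" "r' - 1"] this[of "r' - 1" "r - 1"]
  consider "r = r'" | "r - 1 < r' - 1" | "r' - 1 < r - 1" using assms by linarith
  then show ?thesis using suc assms by cases auto
qed

lemma perm_sum_cong:
  assumes "\<And>\<sigma>. \<sigma> permutes {1..n} \<Longrightarrow> P \<sigma> = Q \<sigma>"
  shows "perm_sum n P = perm_sum n Q"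
  using assms by (auto simp: perm_sum_def intro!: arg_cong[of _ _ indicator])

lemma perm_sum_eq_0:
  assumes "\<And>\<sigma>. \<sigma> permutes {1..n} \<Longrightarrow> \<not> P \<sigma>"
  shows "perm_sum n P = 0"
  using assms by (auto simp: perm_sum_def fun_eq_iff indicator_def)

lemma span_eq_upto_zero:
  assumes "T \<subseteq> S" "S \<subseteq> insert 0 T"
  shows "ratfun.span S = ratfun.span T"
  using ratfun.span_mono[OF assms(1)] ratfun.span_mono[OF assms(2)] ratfun.span_insert_0 by blast

lemma span_perm_sums:
  assumes "C \<subseteq> D" "\<And>\<sigma>. \<sigma> permutes {1..n} \<Longrightarrow> lab \<sigma> \<in> C"
  shows "ratfun.span {perm_sum n (\<lambda>\<sigma>. lab \<sigma> = c) |c. c \<in> D} = ratfun.span ((\<lambda>c. perm_sum n (\<lambda>\<sigma>. lab \<sigma> = c)) ` C)"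
proof (rule span_eq_upto_zero)
  show "{perm_sum n (\<lambda>\<sigma>. lab \<sigma> = c) |c. c \<in> D} \<subseteq> insert 0 ((\<lambda>c. perm_sum n (\<lambda>\<sigma>. lab \<sigma> = c)) ` C)"
  proof clarify
    fix c assume "perm_sum n (\<lambda>\<sigma>. lab \<sigma> = c) \<notin> (\<lambda>c. perm_sum n (\<lambda>\<sigma>. lab \<sigma> = c)) ` C"
    then have "c \<notin> C" by blast
    then show "perm_sum n (\<lambda>\<sigma>. lab \<sigma> = c) = 0" using assms(2) by (intro perm_sum_eq_0) auto
  qed
qed (use assms(1) in blast)

type_synonym coeffs = "rat \<times> rat \<times> rat \<times> rat"

text \<open>The multiplication of \<open>gmult_IJ_comb\<close> for equal index, on coefficients of
  \<open>I_plus\<close>, \<open>I_minus\<close>, \<open>J_plus\<close>, \<open>J_minus\<close> in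
  this order.\<close>

definition coeff_mult :: "coeffs \<Rightarrow> coeffs \<Rightarrow> coeffs" where
  "coeff_mult = (\<lambda>(a, b, c, d) (a', b', c', d').
     (a * (a' + b' + c' + d') + c * a' + d * b', b * (a' + b' + c' + d') + c * b' + d * a',
      c * c' + d * d', c * d' + d * c'))"

text \<open>
  The values of \<open>x V\<^sub>k\<^sup>+ + y V\<^sub>k\<^sup>-\<close>, for all \<open>k\<close> that are odd resp. even, depend only on the label of a
  permutation.
\<close>

definition label_determines :: "nat \<Rightarrow> ((nat \<Rightarrow> nat) \<Rightarrow> 'b) \<Rightarrow> bool \<Rightarrow> rat \<Rightarrow> rat \<Rightarrow> bool" where
  "label_determines n lab p x y \<longleftrightarrow> (\<forall>\<sigma> \<tau> k. \<sigma> permutes {1..n} \<and> \<tau> permutes {1..n} \<and> lab \<sigma> = lab \<tau> \<and> odd k = p \<longrightarrow>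
     x * run_value k n (run_count n False \<sigma>) + y * run_value k n (run_count n True \<sigma>) =
     x * run_value k n (run_count n False \<tau>) + y * run_value k n (run_count n True \<tau>))"

definition IJ_elem :: "nat \<Rightarrow> coeffs \<Rightarrow> nat \<Rightarrow> ncsf" where
  "IJ_elem n q k = homog n (case q of (a, b, c, d) \<Rightarrow> IJ_comb a b c d k)"

text \<open>Common frame of the five cases: what remains for each is a label describing the
  generators of the algebra, a count of its values, and arithmetic with quadruples.\<close>

lemma orthogonal_idempotent_basis_IJ_elem:
  fixes lab :: "(nat \<Rightarrow> nat) \<Rightarrow> 'b" and cf :: "'i \<Rightarrow> coeffs" and ix :: "'i \<Rightarrow> nat"
  assumes n: "n \<ge> 2"
    and A: "A = ratfun.span ((\<lambda>c. perm_sum n (\<lambda>\<sigma>. lab \<sigma> = c)) ` C)"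
    and C: "finite C" "\<And>\<sigma>. \<sigma> permutes {1..n} \<Longrightarrow> lab \<sigma> \<in> C"
    and X: "finite X" "card C \<le> card X" "\<And>i. i \<in> X \<Longrightarrow> ix i \<le> n"
    and e: "\<And>i. i \<in> X \<Longrightarrow> e i = to_descent n (IJ_elem n (cf i) (ix i))"
    and cls: "\<And>i. i \<in> X \<Longrightarrow>
      case cf i of (a, b, c, d) \<Rightarrow> label_determines n lab False a b \<and> label_determines n lab True c d"
    and nz: "\<And>i. i \<in> X \<Longrightarrow> Gamma_map (IJ_elem n (cf i) (ix i)) \<noteq> 0"
    and mult: "\<And>i j. i \<in> X \<Longrightarrow> j \<in> X \<Longrightarrow> ix i = ix j \<Longrightarrow>
      coeff_mult (cf i) (cf j) = (if i = j then cf i else (0, 0, 0, 0))"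
  shows "orthogonal_idempotent_basis n A X e"
proof (rule orthogonal_idempotent_basisI[OF A C X(1,2)])
  have n0: "n > 0" using n by simp
  fix i assume i: "i \<in> X"
  obtain a b c d where cf: "cf i = (a, b, c, d)" by (cases "cf i")
  have ei: "e i = scaleQ a (to_galg n (IJ False False (ix i))) + scaleQ b (to_galg n (IJ False True (ix i)))
    + scaleQ c (to_galg n (IJ True False (ix i))) + scaleQ d (to_galg n (IJ True True (ix i)))"
    unfolding e[OF i] IJ_elem_def cf prod.case to_descent_IJ_comb[OF n0] ..
  show "e i \<sigma> = 0" if "\<not> \<sigma> permutes {1..n}" for \<sigma>
    unfolding ei using that by (simp add: to_galg_def scaleQ_def)
  show "e i \<sigma> = e i \<tau>" if "\<sigma> permutes {1..n}" "\<tau> permutes {1..n}" "lab \<sigma> = lab \<tau>" for \<sigma> \<tau>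
  proof -
    have "label_determines n lab False a b" "label_determines n lab True c d"
      using cls[OF i] by (auto simp: cf)
    then have "a * to_galg n (IJ False False (ix i)) \<sigma> + b * to_galg n (IJ False True (ix i)) \<sigma> =
        a * to_galg n (IJ False False (ix i)) \<tau> + b * to_galg n (IJ False True (ix i)) \<tau>"
      "c * to_galg n (IJ True False (ix i)) \<sigma> + d * to_galg n (IJ True True (ix i)) \<sigma> =
        c * to_galg n (IJ True False (ix i)) \<tau> + d * to_galg n (IJ True True (ix i)) \<tau>"
      using that unfolding label_determines_def
      by (intro IJ_class_function[OF n that(1,2) X(3)[OF i]]; blast)+
    then show ?thesis by (simp add: ei scaleQ_def)
  qed
  show "e i \<noteq> 0"
    unfolding e[OF i] IJ_elem_def using nz[OF i] unfolding IJ_elem_def by (rule to_descent_nonzero[OF n0])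
  fix j assume j: "j \<in> X"
  obtain a' b' c' d' where cf': "cf j = (a', b', c', d')" by (cases "cf j")
  have zero: "to_descent n (homog n (IJ_comb 0 0 0 0 k)) = 0" for k
    unfolding to_descent_IJ_comb[OF n0] by (simp add: scaleQ_def fun_eq_iff)
  show "gmult n (e i) (e j) = (if i = j then e i else 0)"
  proof (cases "ix i = ix j")
    case True
    then have "gmult n (e i) (e j) = to_descent n (IJ_elem n (coeff_mult (cf i) (cf j)) (ix i))"
      unfolding e[OF i] e[OF j] IJ_elem_def cf cf' prod.case coeff_mult_def
      using X(3)[OF i] X(3)[OF j] by (simp only: gmult_IJ_comb[OF n0] simp_thms if_True)
    also have "\<dots> = (if i = j then e i else 0)"
      unfolding mult[OF i j True] using zero by (simp add: e[OF i] e[OF j] IJ_elem_def)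
    finally show ?thesis .
  next
    case False
    then show ?thesis
      using X(3)[OF i] X(3)[OF j]
      unfolding e[OF i] e[OF j] IJ_elem_def cf cf' prod.case
      by (auto simp: gmult_IJ_comb[OF n0])
  qed
qed

text \<open>In the fourth identity the coefficient is 1 and not 1/2: \<open>J_plus\<close> is a unit
  for \<open>I_plus\<close> on both sides, so the difference is already idempotent, whereas half of
  it would square to half of itself.\<close>

lemma idempotents_eq_IJ_elem:
  "scaleQ (1/2) (I_plus_deg k n + I_minus_deg k n) = IJ_elem n (1/2, 1/2, 0, 0) k"
  "scaleQ (1/2) (J_plus_deg k n + J_minus_deg k n - I_plus_deg k n - I_minus_deg k n) = IJ_elem n (-1/2, -1/2, 1/2, 1/2) k"
  "I_plus_deg k n = IJ_elem n (1, 0, 0, 0) k"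
  "J_plus_deg k n - I_plus_deg k n = IJ_elem n (-1, 0, 1, 0) k"
  "scaleQ (1/2) (J_plus_deg k n - J_minus_deg k n) = IJ_elem n (0, 0, 1/2, -1/2) k"
  "I_minus_deg k n = IJ_elem n (0, 1, 0, 0) k"
  "J_plus_deg k n = IJ_elem n (0, 0, 1, 0) k"
  by (auto simp: fun_eq_iff homog_def IJ_elem_def IJ_comb_def scaleQ_def field_simps)

text \<open>Each quadruple makes \<open>(a + b) * 0 ^ m + c + d * (-1) ^ m\<close>, the weight of
  \<open>m\<close> even parts, an indicator function. In the second case the terms from I cancel
  those from J at \<open>m = 0\<close>, whence the condition of a positive even number.\<close>

lemma Gamma_map_idempotents:
  assumes "n > 0"
  shows "Gamma_map (IJ_elem n (1/2, 1/2, 0, 0) k) = p_sum n (\<lambda>\<mu>. odd_parts \<mu> = k \<and> even_parts \<mu> = 0)"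
    "Gamma_map (IJ_elem n (-1/2, -1/2, 1/2, 1/2) k) = p_sum n (\<lambda>\<mu>. odd_parts \<mu> = k \<and> even_parts \<mu> > 0 \<and> even (even_parts \<mu>))"
    "Gamma_map (IJ_elem n (1, 0, 0, 0) k) = p_sum n (\<lambda>\<mu>. odd_parts \<mu> = k \<and> even_parts \<mu> = 0)"
    "Gamma_map (IJ_elem n (-1, 0, 1, 0) k) = p_sum n (\<lambda>\<mu>. odd_parts \<mu> = k \<and> even_parts \<mu> > 0)"
    "Gamma_map (IJ_elem n (0, 0, 1/2, -1/2) k) = p_sum n (\<lambda>\<mu>. odd_parts \<mu> = k \<and> even_parts \<mu> > 0 \<and> odd (even_parts \<mu>))"
    "Gamma_map (IJ_elem n (0, 1, 0, 0) k) = p_sum n (\<lambda>\<mu>. odd_parts \<mu> = k \<and> even_parts \<mu> = 0)"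
    "Gamma_map (IJ_elem n (0, 0, 1, 0) k) = p_sum n (\<lambda>\<mu>. odd_parts \<mu> = k)"
proof -
  note G = Gamma_map_IJ_comb_eq_p_sum[OF assms]
  show "Gamma_map (IJ_elem n (1/2, 1/2, 0, 0) k) = p_sum n (\<lambda>\<mu>. odd_parts \<mu> = k \<and> even_parts \<mu> = 0)"
    unfolding IJ_elem_def prod.case
    by (rule G[where P = "\<lambda>m. m = 0"]) (auto simp: power_0_left minus_one_power_iff odd_pos)
  show "Gamma_map (IJ_elem n (-1/2, -1/2, 1/2, 1/2) k) = p_sum n (\<lambda>\<mu>. odd_parts \<mu> = k \<and> even_parts \<mu> > 0 \<and> even (even_parts \<mu>))"
    unfolding IJ_elem_def prod.case
    by (rule G[where P = "\<lambda>m. m > 0 \<and> even m"]) (auto simp: power_0_left minus_one_power_iff odd_pos)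
  show "Gamma_map (IJ_elem n (1, 0, 0, 0) k) = p_sum n (\<lambda>\<mu>. odd_parts \<mu> = k \<and> even_parts \<mu> = 0)"
    unfolding IJ_elem_def prod.case
    by (rule G[where P = "\<lambda>m. m = 0"]) (auto simp: power_0_left minus_one_power_iff odd_pos)
  show "Gamma_map (IJ_elem n (-1, 0, 1, 0) k) = p_sum n (\<lambda>\<mu>. odd_parts \<mu> = k \<and> even_parts \<mu> > 0)"
    unfolding IJ_elem_def prod.case
    by (rule G[where P = "\<lambda>m. m > 0"]) (auto simp: power_0_left minus_one_power_iff odd_pos)
  show "Gamma_map (IJ_elem n (0, 0, 1/2, -1/2) k) = p_sum n (\<lambda>\<mu>. odd_parts \<mu> = k \<and> even_parts \<mu> > 0 \<and> odd (even_parts \<mu>))"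
    unfolding IJ_elem_def prod.case
    by (rule G[where P = "\<lambda>m. m > 0 \<and> odd m"]) (auto simp: power_0_left minus_one_power_iff odd_pos)
  show "Gamma_map (IJ_elem n (0, 1, 0, 0) k) = p_sum n (\<lambda>\<mu>. odd_parts \<mu> = k \<and> even_parts \<mu> = 0)"
    unfolding IJ_elem_def prod.case
    by (rule G[where P = "\<lambda>m. m = 0"]) (auto simp: power_0_left minus_one_power_iff odd_pos)
  show "Gamma_map (IJ_elem n (0, 0, 1, 0) k) = p_sum n (\<lambda>\<mu>. odd_parts \<mu> = k)"
    using G[of 0 0 1 0 "\<lambda>_. True" k] by (simp add: IJ_elem_def)
qed

lemma Gamma_map_idempotents_nonzero:
  assumes "n > 0"
  shows "k \<in> index_set n 1 0 \<Longrightarrow> Gamma_map (IJ_elem n (1/2, 1/2, 0, 0) k) \<noteq> 0"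
    "k \<in> index_set n 0 4 \<Longrightarrow> Gamma_map (IJ_elem n (-1/2, -1/2, 1/2, 1/2) k) \<noteq> 0"
    "k \<in> index_set n 1 0 \<Longrightarrow> Gamma_map (IJ_elem n (1, 0, 0, 0) k) \<noteq> 0"
    "k \<in> index_set n 0 2 \<Longrightarrow> Gamma_map (IJ_elem n (-1, 0, 1, 0) k) \<noteq> 0"
    "k \<in> index_set n 0 2 \<Longrightarrow> Gamma_map (IJ_elem n (0, 0, 1/2, -1/2) k) \<noteq> 0"
    "k \<in> index_set n 1 0 \<Longrightarrow> Gamma_map (IJ_elem n (0, 1, 0, 0) k) \<noteq> 0"
    "k \<in> index_set n 0 0 \<Longrightarrow> Gamma_map (IJ_elem n (0, 0, 1, 0) k) \<noteq> 0"
proof -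
  note G = Gamma_map_idempotents[OF assms]
  show "Gamma_map (IJ_elem n (1/2, 1/2, 0, 0) k) \<noteq> 0" if "k \<in> index_set n 1 0"
    unfolding G using ex_partition_odd[OF that] by (rule p_sum_nonzero)
  show "Gamma_map (IJ_elem n (-1/2, -1/2, 1/2, 1/2) k) \<noteq> 0" if k: "k \<in> index_set n 0 4"
    unfolding G
  proof (rule p_sum_nonzero)
    obtain \<mu> where "\<mu> \<in> partitions n" "odd_parts \<mu> = k" "even_parts \<mu> = 2"
      using ex_partition_even_parts[of k n 2] k by auto
    then show "\<exists>\<mu>\<in>partitions n. odd_parts \<mu> = k \<and> even_parts \<mu> > 0 \<and> even (even_parts \<mu>)"
      by (intro bexI[of _ \<mu>]) auto
  qed
  show "Gamma_map (IJ_elem n (1, 0, 0, 0) k) \<noteq> 0" if "k \<in> index_set n 1 0"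
    unfolding G using ex_partition_odd[OF that] by (rule p_sum_nonzero)
  show "Gamma_map (IJ_elem n (-1, 0, 1, 0) k) \<noteq> 0" if k: "k \<in> index_set n 0 2"
    unfolding G
  proof (rule p_sum_nonzero)
    obtain \<mu> where "\<mu> \<in> partitions n" "odd_parts \<mu> = k" "even_parts \<mu> = 1"
      using ex_partition_even_parts[of k n 1] k by auto
    then show "\<exists>\<mu>\<in>partitions n. odd_parts \<mu> = k \<and> even_parts \<mu> > 0"
      by (intro bexI[of _ \<mu>]) auto
  qed
  show "Gamma_map (IJ_elem n (0, 0, 1/2, -1/2) k) \<noteq> 0" if k: "k \<in> index_set n 0 2"
    unfolding G
  proof (rule p_sum_nonzero)
    obtain \<mu> where "\<mu> \<in> partitions n" "odd_parts \<mu> = k" "even_parts \<mu> = 1"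
      using ex_partition_even_parts[of k n 1] k by auto
    then show "\<exists>\<mu>\<in>partitions n. odd_parts \<mu> = k \<and> even_parts \<mu> > 0 \<and> odd (even_parts \<mu>)"
      by (intro bexI[of _ \<mu>]) auto
  qed
  show "Gamma_map (IJ_elem n (0, 1, 0, 0) k) \<noteq> 0" if "k \<in> index_set n 1 0"
    unfolding G using ex_partition_odd[OF that] by (rule p_sum_nonzero)
  show "Gamma_map (IJ_elem n (0, 0, 1, 0) k) \<noteq> 0" if k: "k \<in> index_set n 0 0"
    unfolding G
  proof (cases "k = 0")
    case False
    then have "k \<in> index_set n 1 0" using k by (auto simp: index_set_iff)
    then show "p_sum n (\<lambda>\<mu>. odd_parts \<mu> = k) \<noteq> 0"
      using ex_partition_odd by (intro p_sum_nonzero) blast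
  next
    case True
    \<comment> \<open>Here \<open>n\<close> is even and positive, so the partition with the single
      part \<open>n\<close> serves as witness.\<close>
    then have "k \<in> index_set n 0 (2 * 1)"
      using k assms by (cases "n = 1") (auto simp: index_set_iff)
    then show "p_sum n (\<lambda>\<mu>. odd_parts \<mu> = k) \<noteq> 0"
      using ex_partition_even_parts[of k n 1] by (intro p_sum_nonzero) auto
  qed
qed

text \<open>There are \<open>n - 1\<close> possible numbers of runs, and equally many idempotents:
  \<open>(n + 1) div 2\<close> and \<open>n div 2 - 1\<close>.\<close>

lemma basis_W:
  assumes n: "n \<ge> 2"
  shows "orthogonal_idempotent_basis n (W_alg n) (index_set n 1 0 <+> index_set n 0 4) (to_descent n \<circ> case_sum (IJ_elem n (1/2, 1/2, 0, 0)) (IJ_elem n (-1/2, -1/2, 1/2, 1/2)))"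
proof -
  let ?e = "to_descent n \<circ> case_sum (IJ_elem n (1/2, 1/2, 0, 0)) (IJ_elem n (-1/2, -1/2, 1/2, 1/2))"
  let ?X = "index_set n 1 0 <+> index_set n 0 4"
  define lab where "lab \<sigma> = card (runs 1 n \<sigma>)" for \<sigma>
  define C where "C = {1..n - 1}"
  define cf :: "nat + nat \<Rightarrow> coeffs" where "cf = (case_sum (\<lambda>_. (1/2, 1/2, 0, 0)) (\<lambda>_. (-1/2, -1/2, 1/2, 1/2)))"
  define ix :: "nat + nat \<Rightarrow> nat" where "ix = case_sum id id"
  have lab: "lab \<sigma> \<in> C" if "\<sigma> permutes {1..n}" for \<sigma>
      using card_runs_1[OF n that] turns_le[OF n, of \<sigma>] by (auto simp: lab_def C_def)
  show ?thesis
  proof (rule orthogonal_idempotent_basis_IJ_elem[OF n, where lab = lab and C = C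
      and cf = cf and ix = ix])
    show "W_alg n = ratfun.span ((\<lambda>c. perm_sum n (\<lambda>\<sigma>. lab \<sigma> = c)) ` C)"
      using span_perm_sums[of C "{1..}" n lab] lab by (simp add: W_alg_def W_def lab_def C_def)
    show "card C \<le> card ?X"
      using n by (simp add: C_def card_Plus card_index_sets finite_index_sets)
    show "finite ?X" using n by (simp add: finite_index_sets)
    show "finite C" by (simp add: C_def)
    show "lab \<sigma> \<in> C" if "\<sigma> permutes {1..n}" for \<sigma> using that by (rule lab)
    fix i assume i: "i \<in> ?X"
    show "ix i \<le> n" using i by (auto simp: ix_def index_set_iff)
    show "?e i = to_descent n (IJ_elem n (cf i) (ix i))"
      using i by (auto simp: cf_def ix_def)
    show "Gamma_map (IJ_elem n (cf i) (ix i)) \<noteq> 0"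
      using i n Gamma_map_idempotents_nonzero[of n] by (auto simp: cf_def ix_def)
    show "coeff_mult (cf i) (cf j) = (if i = j then cf i else (0, 0, 0, 0))"
      if "j \<in> ?X" "ix i = ix j" for j
      using i that by (auto simp: cf_def ix_def coeff_mult_def)
    \<comment> \<open>A leading 0 or infinity adds a change of direction in exactly one of the two
      cases, so the two run counts are \<open>1 + turns\<close> and \<open>2 + turns\<close> in some
      order, and equal weights hide the order.\<close>
    have "label_determines n lab p x x" for p x
      using card_runs_1[OF n] by (auto simp: label_determines_def lab_def run_count_def add.commute)
    then show "case cf i of (a, b, c, d) \<Rightarrow> label_determines n lab False a b \<and> label_determines n lab True c d"
      by (cases i) (auto simp: cf_def)
  qed
qed

text \<open>Only the positive sign occurs in these idempotents, and its coefficients depend on the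
  number of left runs alone.\<close>

lemma basis_W_left:
  assumes n: "n \<ge> 2"
  shows "orthogonal_idempotent_basis n (W_left_alg n) (index_set n 1 0 <+> index_set n 0 2) (to_descent n \<circ> case_sum (IJ_elem n (1, 0, 0, 0)) (IJ_elem n (-1, 0, 1, 0)))"
proof -
  let ?e = "to_descent n \<circ> case_sum (IJ_elem n (1, 0, 0, 0)) (IJ_elem n (-1, 0, 1, 0))"
  let ?X = "index_set n 1 0 <+> index_set n 0 2"
  define lab where "lab \<sigma> = card (runs 0 n \<sigma>)" for \<sigma>
  define C where "C = {1..n}"
  define cf :: "nat + nat \<Rightarrow> coeffs" where "cf = (case_sum (\<lambda>_. (1, 0, 0, 0)) (\<lambda>_. (-1, 0, 1, 0)))"
  define ix :: "nat + nat \<Rightarrow> nat" where "ix = case_sum id id"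
  have lab: "lab \<sigma> \<in> C" if "\<sigma> permutes {1..n}" for \<sigma>
      using card_runs_0[OF n that] run_count_bounds[OF n, of False \<sigma>] by (auto simp: lab_def C_def)
  show ?thesis
  proof (rule orthogonal_idempotent_basis_IJ_elem[OF n, where lab = lab and C = C
      and cf = cf and ix = ix])
    show "W_left_alg n = ratfun.span ((\<lambda>c. perm_sum n (\<lambda>\<sigma>. lab \<sigma> = c)) ` C)"
      using span_perm_sums[of C "{1..}" n lab] lab by (simp add: W_left_alg_def W_left_def lab_def C_def)
    show "card C \<le> card ?X"
      using n by (simp add: C_def card_Plus card_index_sets finite_index_sets)
    show "finite ?X" using n by (simp add: finite_index_sets)
    show "finite C" by (simp add: C_def)
    show "lab \<sigma> \<in> C" if "\<sigma> permutes {1..n}" for \<sigma> using that by (rule lab)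
    fix i assume i: "i \<in> ?X"
    show "ix i \<le> n" using i by (auto simp: ix_def index_set_iff)
    show "?e i = to_descent n (IJ_elem n (cf i) (ix i))"
      using i by (auto simp: cf_def ix_def)
    show "Gamma_map (IJ_elem n (cf i) (ix i)) \<noteq> 0"
      using i n Gamma_map_idempotents_nonzero[of n] by (auto simp: cf_def ix_def)
    show "coeff_mult (cf i) (cf j) = (if i = j then cf i else (0, 0, 0, 0))"
      if "j \<in> ?X" "ix i = ix j" for j
      using i that by (auto simp: cf_def ix_def coeff_mult_def)
    have "label_determines n lab p x 0" for p x
      using card_runs_0[OF n] by (auto simp: label_determines_def lab_def)
    then show "case cf i of (a, b, c, d) \<Rightarrow> label_determines n lab False a b \<and> label_determines n lab True c d"
      by (cases i) (auto simp: cf_def)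
  qed
qed

text \<open>Only products of negative sign with an even number of factors enter; by
  \<open>run_value_even_cong\<close> they see just the number of peaks.\<close>

lemma basis_P:
  assumes n: "n \<ge> 2"
  shows "orthogonal_idempotent_basis n (P_alg n) (index_set n 1 0) (to_descent n \<circ> (IJ_elem n (0, 1, 0, 0)))"
proof -
  let ?e = "to_descent n \<circ> (IJ_elem n (0, 1, 0, 0))"
  let ?X = "index_set n 1 0"
  define lab where "lab \<sigma> = card (peaks n \<sigma>)" for \<sigma>
  define C where "C = {..(n - 1) div 2}"
  define cf :: "nat \<Rightarrow> coeffs" where "cf = (\<lambda>_. (0, 1, 0, 0))"
  define ix :: "nat \<Rightarrow> nat" where "ix = id"
  have lab: "lab \<sigma> \<in> C" if "\<sigma> permutes {1..n}" for \<sigma>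
      using card_peaks[OF n that] run_count_bounds[OF n, of True \<sigma>] by (auto simp: lab_def C_def intro!: div_le_mono diff_le_mono)
  show ?thesis
  proof (rule orthogonal_idempotent_basis_IJ_elem[OF n, where lab = lab and C = C
      and cf = cf and ix = ix])
    show "P_alg n = ratfun.span ((\<lambda>c. perm_sum n (\<lambda>\<sigma>. lab \<sigma> = c)) ` C)"
      using span_perm_sums[of C UNIV n lab] lab by (simp add: P_alg_def lab_def C_def)
    show "card C \<le> card ?X"
      using n by (simp add: C_def card_Plus card_index_sets finite_index_sets)
    show "finite ?X" using n by (simp add: finite_index_sets)
    show "finite C" by (simp add: C_def)
    show "lab \<sigma> \<in> C" if "\<sigma> permutes {1..n}" for \<sigma> using that by (rule lab)
    fix i assume i: "i \<in> ?X"
    show "ix i \<le> n" using i by (auto simp: ix_def index_set_iff)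
    show "?e i = to_descent n (IJ_elem n (cf i) (ix i))"
      using i by (auto simp: cf_def ix_def)
    show "Gamma_map (IJ_elem n (cf i) (ix i)) \<noteq> 0"
      using i n Gamma_map_idempotents_nonzero[of n] by (auto simp: cf_def ix_def)
    show "coeff_mult (cf i) (cf j) = (if i = j then cf i else (0, 0, 0, 0))"
      if "j \<in> ?X" "ix i = ix j" for j
      using i that by (auto simp: cf_def ix_def coeff_mult_def)
    have "label_determines n lab False 0 y" for y
      unfolding label_determines_def
    proof (intro allI impI)
      fix \<sigma> \<tau> and k :: nat
      assume *: "\<sigma> permutes {1..n} \<and> \<tau> permutes {1..n} \<and> lab \<sigma> = lab \<tau> \<and> odd k = False"
      have "lab \<rho> = (run_count n True \<rho> - 1) div 2" if "\<rho> permutes {1..n}" for \<rho>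
        using card_peaks[OF n that] unfolding lab_def .
      then have "run_value k n (run_count n True \<sigma>) = run_value k n (run_count n True \<tau>)"
        using * run_count_bounds[OF n] by (intro run_value_even_cong) metis+
      then show "0 * run_value k n (run_count n False \<sigma>) + y * run_value k n (run_count n True \<sigma>) =
          0 * run_value k n (run_count n False \<tau>) + y * run_value k n (run_count n True \<tau>)"
        by simp
    qed
    moreover have "label_determines n lab True 0 0" by (simp add: label_determines_def)
    ultimately show "case cf i of (a, b, c, d) \<Rightarrow> label_determines n lab False a b \<and> label_determines n lab True c d"
      by (simp add: cf_def)
  qed
qed

text \<open>Only products of positive sign with an odd number of factors enter; by
  \<open>run_value_odd_cong\<close> they see just the number of left peaks.\<close>

lemma basis_P_left:
  assumes n: "n \<ge> 2"
  shows "orthogonal_idempotent_basis n (P_left_alg n) (index_set n 0 0) (to_descent n \<circ> (IJ_elem n (0, 0, 1, 0)))"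
proof -
  let ?e = "to_descent n \<circ> (IJ_elem n (0, 0, 1, 0))"
  let ?X = "index_set n 0 0"
  define lab where "lab \<sigma> = card (left_peaks n \<sigma>)" for \<sigma>
  define C where "C = {..n div 2}"
  define cf :: "nat \<Rightarrow> coeffs" where "cf = (\<lambda>_. (0, 0, 1, 0))"
  define ix :: "nat \<Rightarrow> nat" where "ix = id"
  have lab: "lab \<sigma> \<in> C" if "\<sigma> permutes {1..n}" for \<sigma>
      using card_left_peaks[OF n that] run_count_bounds[OF n, of False \<sigma>] by (auto simp: lab_def C_def intro!: div_le_mono diff_le_mono)
  show ?thesis
  proof (rule orthogonal_idempotent_basis_IJ_elem[OF n, where lab = lab and C = C
      and cf = cf and ix = ix])
    show "P_left_alg n = ratfun.span ((\<lambda>c. perm_sum n (\<lambda>\<sigma>. lab \<sigma> = c)) ` C)"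
      using span_perm_sums[of C UNIV n lab] lab by (simp add: P_left_alg_def lab_def C_def)
    show "card C \<le> card ?X"
      using n by (simp add: C_def card_Plus card_index_sets finite_index_sets)
    show "finite ?X" using n by (simp add: finite_index_sets)
    show "finite C" by (simp add: C_def)
    show "lab \<sigma> \<in> C" if "\<sigma> permutes {1..n}" for \<sigma> using that by (rule lab)
    fix i assume i: "i \<in> ?X"
    show "ix i \<le> n" using i by (auto simp: ix_def index_set_iff)
    show "?e i = to_descent n (IJ_elem n (cf i) (ix i))"
      using i by (auto simp: cf_def ix_def)
    show "Gamma_map (IJ_elem n (cf i) (ix i)) \<noteq> 0"
      using i n Gamma_map_idempotents_nonzero[of n] by (auto simp: cf_def ix_def)
    show "coeff_mult (cf i) (cf j) = (if i = j then cf i else (0, 0, 0, 0))"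
      if "j \<in> ?X" "ix i = ix j" for j
      using i that by (auto simp: cf_def ix_def coeff_mult_def)
    have "label_determines n lab True x 0" for x
      unfolding label_determines_def
    proof (intro allI impI)
      fix \<sigma> \<tau> and k :: nat
      assume *: "\<sigma> permutes {1..n} \<and> \<tau> permutes {1..n} \<and> lab \<sigma> = lab \<tau> \<and> odd k = True"
      have "lab \<rho> = run_count n False \<rho> div 2" if "\<rho> permutes {1..n}" for \<rho>
        using card_left_peaks[OF n that] unfolding lab_def .
      then have "run_value k n (run_count n False \<sigma>) = run_value k n (run_count n False \<tau>)"
        using * run_count_bounds[OF n] by (intro run_value_odd_cong) metis+
      then show "x * run_value k n (run_count n False \<sigma>) + 0 * run_value k n (run_count n True \<sigma>) =
          x * run_value k n (run_count n False \<tau>) + 0 * run_value k n (run_count n True \<tau>)"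
        by simp
    qed
    moreover have "label_determines n lab False 0 0" by (simp add: label_determines_def)
    ultimately show "case cf i of (a, b, c, d) \<Rightarrow> label_determines n lab False a b \<and> label_determines n lab True c d"
      by (simp add: cf_def)
  qed
qed

text \<open>Unequal weights of the two signs occur only with J, that is, for odd \<open>k\<close>.
  If the number of runs is even, the two signs then give the same values by
  \<open>run_value_Suc\<close>, so the initial direction matters only for an odd number of
  runs.\<close>

lemma basis_C:
  assumes n: "n \<ge> 2"
  shows "orthogonal_idempotent_basis n (C_alg n) (index_set n 1 0 <+> (index_set n 0 4 <+> index_set n 0 2)) (to_descent n \<circ> case_sum (IJ_elem n (1/2, 1/2, 0, 0)) (case_sum (IJ_elem n (-1/2, -1/2, 1/2, 1/2)) (IJ_elem n (0, 0, 1/2, -1/2))))"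
proof -
  let ?e = "to_descent n \<circ> case_sum (IJ_elem n (1/2, 1/2, 0, 0)) (case_sum (IJ_elem n (-1/2, -1/2, 1/2, 1/2)) (IJ_elem n (0, 0, 1/2, -1/2)))"
  let ?X = "index_set n 1 0 <+> (index_set n 0 4 <+> index_set n 0 2)"
  \<comment> \<open>The direction is forgotten for an even number of runs, which merges the two
    directions into one class as the generator \<open>W n (2 * k)\<close> does.\<close>
  define lab where "lab \<sigma> = (card (runs 1 n \<sigma>), odd (card (runs 1 n \<sigma>)) \<and> starts_down \<sigma>)" for \<sigma>
  define C where "C = (\<lambda>r. (r, False)) ` {1..n - 1} \<union> (\<lambda>r. (r, True)) ` {r \<in> {1..n - 1}. odd r}"
  define cf :: "nat + nat + nat \<Rightarrow> coeffs" where "cf = (case_sum (\<lambda>_. (1/2, 1/2, 0, 0)) (case_sum (\<lambda>_. (-1/2, -1/2, 1/2, 1/2)) (\<lambda>_. (0, 0, 1/2, -1/2))))"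
  define ix :: "nat + nat + nat \<Rightarrow> nat" where "ix = case_sum id (case_sum id id)"
  have lab: "lab \<sigma> \<in> C" if "\<sigma> permutes {1..n}" for \<sigma>
      using card_runs_1[OF n that] turns_le[OF n, of \<sigma>] by (auto simp: lab_def C_def)
  show ?thesis
  proof (rule orthogonal_idempotent_basis_IJ_elem[OF n, where lab = lab and C = C
      and cf = cf and ix = ix])
    have W: "W n (2 * r) = perm_sum n (\<lambda>\<sigma>. lab \<sigma> = (2 * r, False))" for r
      unfolding W_def by (rule perm_sum_cong) (auto simp: lab_def)
    have Wp: "W_plus n (2 * r - 1) = perm_sum n (\<lambda>\<sigma>. lab \<sigma> = (2 * r - 1, False))"
      "W_minus n (2 * r - 1) = perm_sum n (\<lambda>\<sigma>. lab \<sigma> = (2 * r - 1, True))" if "r \<ge> 1" for r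
      unfolding W_plus_def W_minus_def
      by (rule perm_sum_cong, use first_run_direction[OF n] that in \<open>auto simp: lab_def\<close>)+
    define D where "D = {(2 * r, False) |r. r \<ge> 1} \<union> {(2 * r - 1, b) |r b. r \<ge> (1 :: nat)}"
    have gens: "{W n (2 * k) |k. k \<ge> 1} \<union> {W_plus n (2 * k - 1) |k. k \<ge> 1} \<union> {W_minus n (2 * k - 1) |k. k \<ge> 1}
        = {perm_sum n (\<lambda>\<sigma>. lab \<sigma> = c) |c. c \<in> D}" (is "?L = ?R")
    proof (intro equalityI subsetI)
      fix f assume "f \<in> ?L"
      then obtain c where "c \<in> D" "f = perm_sum n (\<lambda>\<sigma>. lab \<sigma> = c)"
        using W Wp unfolding D_def by blast
      then show "f \<in> ?R" by blast
    next
      fix f assume "f \<in> ?R"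
      then consider r where "r \<ge> 1" "f = perm_sum n (\<lambda>\<sigma>. lab \<sigma> = (2 * r, False))"
        | r b where "r \<ge> 1" "f = perm_sum n (\<lambda>\<sigma>. lab \<sigma> = (2 * r - 1, b))"
        unfolding D_def by blast
      then show "f \<in> ?L"
      proof cases
        case 1
        then have "f = W n (2 * r)" by (simp only: W)
        with 1(1) show ?thesis by blast
      next
        case 2
        then have "f = (if b then W_minus n (2 * r - 1) else W_plus n (2 * r - 1))"
          by (cases b) (simp_all only: Wp if_True if_False)
        with 2(1) show ?thesis by (cases b) auto
      qed
    qed
    have "C \<subseteq> D"
    proof
      fix c assume c: "c \<in> C"
      obtain r b where rb': "c = (r, b)" by (cases c)
      with c have rb: "c = (r, b)" "1 \<le> r" "b \<longrightarrow> odd r" by (auto simp: C_def)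
      show "c \<in> D"
      proof (cases "even r")
        case True
        then obtain s where "r = 2 * s" by blast
        with rb True show ?thesis by (auto simp: D_def)
      next
        case False
        then obtain s where "r = 2 * s + 1" by (elim oddE)
        then have "c = (2 * Suc s - 1, b)" using rb(1) by simp
        moreover have "(2 * Suc s - 1, b) \<in> {(2 * r - 1, b) |r b. r \<ge> (1 :: nat)}"
          by (rule CollectI, intro exI conjI, rule refl, simp)
        ultimately show ?thesis unfolding D_def by (simp only: UnI2)
      qed
    qed
    then show "C_alg n = ratfun.span ((\<lambda>c. perm_sum n (\<lambda>\<sigma>. lab \<sigma> = c)) ` C)"
      unfolding C_alg_def gens using lab by (rule span_perm_sums)
    have "card {r \<in> {1..n - 1}. odd r} = n div 2"
    proof -
      have "{r \<in> {1..n - 1}. odd r} = (\<lambda>s. 2 * s + 1) ` {..<n div 2}"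
        by (auto elim!: oddE)
      then show ?thesis by (simp add: card_image inj_on_def)
    qed
    moreover have "card C \<le> card {1..n - 1} + card {r \<in> {1..n - 1}. odd r}"
      unfolding C_def by (intro order_trans[OF card_Un_le] add_mono card_image_le) auto
    ultimately show "card C \<le> card ?X"
      using n by (simp add: card_Plus card_index_sets finite_index_sets)
    show "finite ?X" using n by (simp add: finite_index_sets)
    show "finite C" by (simp add: C_def)
    show "lab \<sigma> \<in> C" if "\<sigma> permutes {1..n}" for \<sigma> using that by (rule lab)
    fix i assume i: "i \<in> ?X"
    show "ix i \<le> n" using i by (auto simp: ix_def index_set_iff)
    show "?e i = to_descent n (IJ_elem n (cf i) (ix i))"
      using i by (auto simp: cf_def ix_def)
    show "Gamma_map (IJ_elem n (cf i) (ix i)) \<noteq> 0"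
      using i n Gamma_map_idempotents_nonzero[of n] by (auto simp: cf_def ix_def)
    show "coeff_mult (cf i) (cf j) = (if i = j then cf i else (0, 0, 0, 0))"
      if "j \<in> ?X" "ix i = ix j" for j
      using i that by (auto simp: cf_def ix_def coeff_mult_def)
    have "label_determines n lab p x y" if "p \<or> x = y" for p x y
      unfolding label_determines_def
    proof (intro allI impI)
      fix \<sigma> \<tau> and k :: nat
      assume *: "\<sigma> permutes {1..n} \<and> \<tau> permutes {1..n} \<and> lab \<sigma> = lab \<tau> \<and> odd k = p"
      then have t: "turns n \<sigma> = turns n \<tau>" using card_runs_1[OF n] by (auto simp: lab_def)
      show "x * run_value k n (run_count n False \<sigma>) + y * run_value k n (run_count n True \<sigma>) =
          x * run_value k n (run_count n False \<tau>) + y * run_value k n (run_count n True \<tau>)"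
      proof (cases "starts_down \<sigma> = starts_down \<tau> \<or> x = y")
        case True
        then show ?thesis using t by (auto simp: run_count_def add.commute)
      next
        case False
        then have "even (1 + turns n \<tau>)" "odd k"
          using * that card_runs_1[OF n, of \<sigma>] card_runs_1[OF n, of \<tau>] by (auto simp: lab_def split: if_splits)
        then have "run_value k n (Suc (1 + turns n \<tau>)) = run_value k n (1 + turns n \<tau>)"
          using turns_le[OF n, of \<tau>] by (intro run_value_Suc) auto
        then show ?thesis using t by (simp add: run_count_def)
      qed
    qed
    then show "case cf i of (a, b, c, d) \<Rightarrow> label_determines n lab False a b \<and> label_determines n lab True c d"
      by (auto simp: cf_def split: sum.splits)
  qed
qed

theorem theorem5p3:
  fixes n :: nat
  assumes "n \<ge> 2"
  shows
    "orthogonal_idempotent_basis n (W_alg n) (index_set n 1 0 <+> index_set n 0 4)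
        (to_descent n \<circ> case_sum
           (\<lambda>k. scaleQ (1/2) (I_plus_deg k n + I_minus_deg k n))
           (\<lambda>l. scaleQ (1/2) (J_plus_deg l n + J_minus_deg l n - I_plus_deg l n - I_minus_deg l n)))
     \<and> (\<forall>k\<in>index_set n 1 0. Gamma_map (scaleQ (1/2) (I_plus_deg k n + I_minus_deg k n))
           = p_sum n (\<lambda>\<mu>. odd_parts \<mu> = k \<and> even_parts \<mu> = 0))
     \<and> (\<forall>l\<in>index_set n 0 4. Gamma_map (scaleQ (1/2) (J_plus_deg l n + J_minus_deg l n - I_plus_deg l n - I_minus_deg l n))
           = p_sum n (\<lambda>\<mu>. odd_parts \<mu> = l \<and> even_parts \<mu> > 0 \<and> even (even_parts \<mu>)))

     \<and> orthogonal_idempotent_basis n (W_left_alg n) (index_set n 1 0 <+> index_set n 0 2)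
        (to_descent n \<circ> case_sum
           (\<lambda>k. I_plus_deg k n)
           (\<lambda>l. J_plus_deg l n - I_plus_deg l n))
     \<and> (\<forall>k\<in>index_set n 1 0. Gamma_map (I_plus_deg k n)
           = p_sum n (\<lambda>\<mu>. odd_parts \<mu> = k \<and> even_parts \<mu> = 0))
     \<and> (\<forall>l\<in>index_set n 0 2. Gamma_map (J_plus_deg l n - I_plus_deg l n)
           = p_sum n (\<lambda>\<mu>. odd_parts \<mu> = l \<and> even_parts \<mu> > 0))

     \<and> orthogonal_idempotent_basis n (C_alg n)
        (index_set n 1 0 <+> (index_set n 0 4 <+> index_set n 0 2))
        (to_descent n \<circ> case_sum
           (\<lambda>k. scaleQ (1/2) (I_plus_deg k n + I_minus_deg k n))
           (case_sum
              (\<lambda>l. scaleQ (1/2) (J_plus_deg l n + J_minus_deg l n - I_plus_deg l n - I_minus_deg l n))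
              (\<lambda>m. scaleQ (1/2) (J_plus_deg m n - J_minus_deg m n))))
     \<and> (\<forall>k\<in>index_set n 1 0. Gamma_map (scaleQ (1/2) (I_plus_deg k n + I_minus_deg k n))
           = p_sum n (\<lambda>\<mu>. odd_parts \<mu> = k \<and> even_parts \<mu> = 0))
     \<and> (\<forall>l\<in>index_set n 0 4. Gamma_map (scaleQ (1/2) (J_plus_deg l n + J_minus_deg l n - I_plus_deg l n - I_minus_deg l n))
           = p_sum n (\<lambda>\<mu>. odd_parts \<mu> = l \<and> even_parts \<mu> > 0 \<and> even (even_parts \<mu>)))
     \<and> (\<forall>m\<in>index_set n 0 2. Gamma_map (scaleQ (1/2) (J_plus_deg m n - J_minus_deg m n))
           = p_sum n (\<lambda>\<mu>. odd_parts \<mu> = m \<and> even_parts \<mu> > 0 \<and> odd (even_parts \<mu>)))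

     \<and> orthogonal_idempotent_basis n (P_alg n) (index_set n 1 0) (to_descent n \<circ> (\<lambda>k. I_minus_deg k n))
     \<and> (\<forall>k\<in>index_set n 1 0. Gamma_map (I_minus_deg k n)
           = p_sum n (\<lambda>\<mu>. odd_parts \<mu> = k \<and> even_parts \<mu> = 0))

     \<and> orthogonal_idempotent_basis n (P_left_alg n) (index_set n 0 0) (to_descent n \<circ> (\<lambda>k. J_plus_deg k n))
     \<and> (\<forall>k\<in>index_set n 0 0. Gamma_map (J_plus_deg k n)
           = p_sum n (\<lambda>\<mu>. odd_parts \<mu> = k))"
proof -
  have n: "n > 0" using assms by simp
  show ?thesis
    \<comment> \<open>The compound expressions are rewritten before the single components, which
      would otherwise destroy their pattern.\<close>
    unfolding idempotents_eq_IJ_elem(1,2,4,5)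
    unfolding idempotents_eq_IJ_elem(3,6,7)
    by (intro conjI ballI)
       (rule basis_W[OF assms] basis_W_left[OF assms] basis_C[OF assms] basis_P[OF assms]
          basis_P_left[OF assms] Gamma_map_idempotents[OF n])+
qed

end
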